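(* There exist absolute constants $c_-,c_+>0$ such that the following holds. Let $\varepsilon'\in(0,\frac12)$, let $H$ satisfy Assumption G, and let $\mu,\nu$ be macro states with $d_\mu,d_\nu>\max\{166,\,4|\log_2(\varepsilon'/\sqrt2)|\}$. Then with probability at least $1-\varepsilon'$, $$M_{\mu\nu}\ge\Bigl(\sqrt{\varepsilon' C_\sigma}\,\frac{\max\{d_\mu,d_\nu\}}{D}\Bigr)^{16}\min\Bigl\{1,\frac{d_\nu}{d_\mu}\Bigr\},\qquad C_\sigma=\frac{c_-\sigma_-}{c_+\sigma_++C_{H_0}}.$$
   Context: Setting: $\mathcal H=\mathbb C^D$ with standard basis $|1\rangle,\dots,|D\rangle$; $[D]$ is partitioned into $m\ge2$ consecutive blocks $I_\nu=\{d_1+\dots+d_{\nu-1}+1,\dots,d_1+\dots+d_\nu\}$, $\nu=1,\dots,m$ ("macro states"); the macro space $\mathcal H_\nu$ is spanned by $\{|j\rangle:j\in I_\nu\}$, $d_\nu=\dim\mathcal H_\nu$, $P_\nu$ is the orthogonal projection onto $\mathcal H_\nu$. For a Hermitian $H$ with spectral decomposition $H=\sum_{e\in\mathcal E}e\,\Pi_e$ ($\mathcal E$ the set of distinct eigenvalues, $\Pi_e$ the eigenprojections) and a $D\times D$ matrix $B$: $M_{\mu B}=\frac1{d_\mu}\sum_{e}\mathrm{tr}(P_\mu\Pi_eB\Pi_e)$ and $M_{\mu\nu}=M_{\mu P_\nu}$. Assumption G: $H=H_0+V$, where $H_0$ is a deterministic Hermitian $D\times D$ matrix and $V=\frac1{\sqrt2}(A+A^*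 )$, where $A=(a_{ij})$ is a random $D\times D$ matrix whose real and imaginary parts $\mathrm{Re}\,a_{ij},\mathrm{Im}\,a_{ij}$, $i,j\in[D]$, are all independent with $\mathrm{Re}\,a_{ij},\mathrm{Im}\,a_{ij}\sim\mathcal N(0,\sigma_{ij}^2/2)$ for some $\sigma_{ij}=\sigma_{ji}>0$. Put $\sigma_-=\min_{i,j}\sigma_{ij}$, $\sigma_+=\max_{i,j}\sigma_{ij}$, $C_{H_0}=D^{-1/2}\max\{\|\mathrm{Re}\,H_0\|,\|\mathrm{Im}\,H_0\|\}$ (operator norms of the entrywise real/imaginary parts). *)

theory Defs
  imports "HOL-Probability.Probability" "Jordan_Normal_Form.Schur_Decomposition"
    "Jordan_Normal_Form.Char_Poly"
begin

text \<open>Indices are 0-based: the basis vector |j+1> of the paper is index j < D,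
  and macro state nu (1-based in the paper) is index nu < m.
  Block nu is I_nu = {blk_start d nu ..< blk_start d nu + d nu}.\<close>

definition blk_start :: "(nat \<Rightarrow> nat) \<Rightarrow> nat \<Rightarrow> nat" where
  "blk_start d \<nu> = (\<Sum>k<\<nu>. d k)"

definition in_block :: "(nat \<Rightarrow> nat) \<Rightarrow> nat \<Rightarrow> nat \<Rightarrow> bool" where
  "in_block d \<nu> i \<longleftrightarrow> blk_start d \<nu> \<le> i \<and> i < blk_start d \<nu> + d \<nu>"

definition Pblk :: "nat \<Rightarrow> (nat \<Rightarrow> nat) \<Rightarrow> nat \<Rightarrow> complex mat" where
  "Pblk D d \<nu> = mat D D (\<lambda>(i,j). if i = j \<and> in_block d \<nu> i then 1 else 0)"

definition mtrace :: "complex mat \<Rightarrow> complex" where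
  "mtrace A = (\<Sum>i<dim_row A. A $$ (i,i))"

definition hermitian :: "complex mat \<Rightarrow> bool" where
  "hermitian A \<longleftrightarrow> mat_adjoint A = A"

definition eigproj :: "complex mat \<Rightarrow> complex \<Rightarrow> complex mat" where
  "eigproj H e = (THE P. P \<in> carrier_mat (dim_row H) (dim_row H) \<and> P * P = P \<and> hermitian P \<and>
      (\<forall>v \<in> carrier_vec (dim_row H). P *\<^sub>v v = v \<longleftrightarrow> H *\<^sub>v v = e \<cdot>\<^sub>v v))"

definition Mcoef :: "(nat \<Rightarrow> nat) \<Rightarrow> complex mat \<Rightarrow> nat \<Rightarrow> complex mat \<Rightarrow> complex" where
  "Mcoef d H \<mu> B = (1 / of_nat (d \<mu>)) *
     (\<Sum>e \<in> {e. eigenvalue H e}. mtrace (Pblk (dim_row H) d \<mu> * eigproj H e * B * eigproj H e))"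

definition vnorm :: "complex vec \<Rightarrow> real" where
  "vnorm v = sqrt (\<Sum>i<dim_vec v. (cmod (v $ i))\<^sup>2)"

definition opnorm :: "complex mat \<Rightarrow> real" where
  "opnorm A = Sup {vnorm (A *\<^sub>v v) | v. v \<in> carrier_vec (dim_col A) \<and> vnorm v \<le> 1}"

definition re_part :: "complex mat \<Rightarrow> complex mat" where
  "re_part A = map_mat (\<lambda>z. complex_of_real (Re z)) A"

definition im_part :: "complex mat \<Rightarrow> complex mat" where
  "im_part A = map_mat (\<lambda>z. complex_of_real (Im z)) A"

definition CH0 :: "nat \<Rightarrow> complex mat \<Rightarrow> real" where
  "CH0 D H0 = max (opnorm (re_part H0)) (opnorm (im_part H0)) / sqrt (real D)"

text \<open>Probability space of Assumption G: coordinates omega (i,j,False) = Re a_ij and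
  omega (i,j,True) = Im a_ij, all independent, N(0, sigma_ij^2/2)
  (standard deviation sigma_ij / sqrt 2).\<close>
definition gauss_space :: "nat \<Rightarrow> (nat \<Rightarrow> nat \<Rightarrow> real) \<Rightarrow> ((nat \<times> nat \<times> bool) \<Rightarrow> real) measure" where
  "gauss_space D \<sigma> = PiM ({..<D} \<times> {..<D} \<times> UNIV)
     (\<lambda>(i,j,b). density lborel (normal_density 0 (\<sigma> i j / sqrt 2)))"

definition randA :: "nat \<Rightarrow> ((nat \<times> nat \<times> bool) \<Rightarrow> real) \<Rightarrow> complex mat" where
  "randA D \<omega> = mat D D (\<lambda>(i,j). Complex (\<omega> (i,j,False)) (\<omega> (i,j,True)))"

definition randV :: "nat \<Rightarrow> ((nat \<times> nat \<times> bool) \<Rightarrow> real) \<Rightarrow> complex mat" where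
  "randV D \<omega> = complex_of_real (1 / sqrt 2) \<cdot>\<^sub>m (randA D \<omega> + mat_adjoint (randA D \<omega>))"

end

(*
Let P be the larger of the two blocks and Y its complement. Since
tr(P_mu Pi P_nu Pi) is a squared Hilbert-Schmidt norm, the bound follows once every normalized
eigenvector u of H satisfies |P u|^2 >= delta = (eps C_sigma)^8 (|P|/D)^16.

Suppose u = (x, y) is an eigenvector with |x|^2 < delta. Then y is an approximate eigenvector of
H_YY, hence up to a small error lies in the spectral subspace of H_YY for a window of width
r = rho |H|, and H_PY y is small. The Gaussian block H_PY is independent of H_YY. If the window
contains at most |P|/4 eigenvalues, a net of its spectral subspace and the small ball estimate for
H_PY y exclude such y with overwhelming probability.

The number of eigenvalues in a window around E is bounded by 2 Phi, Phi = r Im tr (H_YY - E - i r)^{-1}.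
By the Schur complement formula the e-th summand is at most 1/(1 + |R h|^2), where R is the resolvent
of the minor without e and h the (independent Gaussian) e-th column. A lower tail estimate for |R h|^2
shows that a large Phi is unlikely. All probabilities are uniform in D because only powers of |P|/D
are lost; the scales rho, r, ... are powers of kappa = eps q (|P|/D)^2, where
q = sigma_- / (2 (12 sigma_+ + C_{H_0})).
*)
theory Submission
  imports Defs
begin

section \<open>Laplace transforms of Gaussian quadratic forms\<close>

text \<open>A net of the whole unit sphere would have about \<open>(9/\<eta>)^(2 D)\<close> points,
  whereas the small ball estimate for \<open>H_PY y\<close> gains one small factor per row of the
  block. The net must therefore lie in a subspace of real dimension below |P|, which is why
  eigenvalues in windows are counted. The counts must hold in about \<open>1/\<rho>\<close> windows
  at once, so a failure probability of the order of the width would be lost in the union bound. As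
  the entries are complex, each coefficient of \<open>R h\<close> has two real degrees of freedom,
  and this gives \<open>\<rho>^2 / (q^2 \<nu>^3)\<close> with \<open>\<nu> = |P|/D\<close>. It then
  suffices that \<rho> is small against \<open>\<epsilon> q^2 \<nu>^3\<close>, as is
  \<open>\<rho> = \<kappa>^2 / 10^6\<close>. This \<rho> is both the relative window width and the
  net mesh; their product \<open>\<rho>^2\<close> bounds the amplitude on the block, so \<delta> is
  \<open>\<kappa>^8\<close> up to a constant, and the factor \<open>\<nu>^2\<close> in \<kappa>
  makes the exponent 16. Eigenbases arise by choice; bad events are phrased with resolvent entries,
  finite nets and grids, and probability estimates use an eigenbasis only after the entries that
  determine it are frozen.\<close>

definition gN :: "real \<Rightarrow> real measure" where
  "gN s = density lborel (normal_density 0 s)"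

lemma space_gN [simp]: "space (gN s) = UNIV"
  and sets_gN [simp, measurable_cong]: "sets (gN s) = sets borel"
  by (auto simp: gN_def)

lemma prob_space_gN: "s > 0 \<Longrightarrow> prob_space (gN s)"
  unfolding gN_def by (rule prob_space_normal_density)

lemma gN_scale:
  fixes f :: "real \<Rightarrow> 'a::{banach, second_countable_topology}"
  assumes s: "s > 0" and f [measurable]: "f \<in> borel_measurable borel"
  shows "(LINT x|gN s. f x) = (LINT x|gN 1. f (s * x))"
proof -
  have "(LINT x|gN s. f x) = (LINT x|lborel. normal_density 0 s x *\<^sub>R f x)"
    unfolding gN_def by (subst integral_density) auto
  also have "\<dots> = \<bar>s\<bar> *\<^sub>R (LINT x|lborel. normal_density 0 s (0 + s * x) *\<^sub>R f (0 + s * x))"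
    using s by (intro lborel_integral_real_affine) simp
  also have "\<dots> = (LINT x|lborel. \<bar>s\<bar> *\<^sub>R (normal_density 0 s (0 + s * x) *\<^sub>R f (0 + s * x)))"
    by (rule integral_scaleR_right[symmetric])
  also have "\<dots> = (LINT x|lborel. normal_density 0 1 x *\<^sub>R f (s * x))"
    using s by (intro Bochner_Integration.integral_cong)
      (auto simp: normal_density_def real_sqrt_mult power_mult_distrib)
  also have "\<dots> = (LINT x|gN 1. f (s * x))"
    unfolding gN_def by (subst integral_density) auto
  finally show ?thesis .
qed

lemma char_gN:
  assumes "s > 0"
  shows "(CLINT x|gN s. iexp (t * x)) = complex_of_real (exp (- (t * s)\<^sup>2 / 2))"
proof -
  have "(CLINT x|gN s. iexp (t * x)) = (CLINT x|gN 1. iexp (t * (s * x)))"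
    using assms by (rule gN_scale) measurable
  also have "\<dots> = char std_normal_distribution (t * s)"
    unfolding char_def gN_def by (simp add: mult.assoc)
  finally show ?thesis
    by (simp add: char_std_normal_distribution)
qed

lemma gN_exp_square:
  assumes "a \<ge> 0"
  shows "(LINT x|gN 1. exp (- a * x\<^sup>2)) = 1 / sqrt (1 + 2 * a)"
proof -
  \<comment> \<open>Completing the square: the tilted density is that of a centred Gaussian with
    this standard deviation, up to the factor \<open>s\<close>.\<close>
  define s where "s = 1 / sqrt (1 + 2 * a)"
  have s: "s > 0" "s\<^sup>2 = 1 / (1 + 2 * a)" using assms by (auto simp: s_def power_divide)
  have "(LINT x|gN 1. exp (- a * x\<^sup>2)) = (LINT x|lborel. normal_density 0 1 x * exp (- a * x\<^sup>2))"
    unfolding gN_def by (subst integral_density) auto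
  also have "\<dots> = (LINT x|lborel. s * normal_density 0 s x)"
  proof (intro Bochner_Integration.integral_cong refl)
    fix x :: real
    have e: "- (x\<^sup>2 / 2) + - a * x\<^sup>2 = - x\<^sup>2 / (2 * s\<^sup>2)"
      unfolding s(2) using assms by (simp add: field_simps)
    have "normal_density 0 1 x * exp (- a * x\<^sup>2) = 1 / sqrt (2 * pi) * exp (- (x\<^sup>2 / 2) + - a * x\<^sup>2)"
      by (simp add: normal_density_def exp_add[symmetric])
    also have "\<dots> = s * normal_density 0 s x"
      unfolding e using s(1) by (simp add: normal_density_def real_sqrt_mult)
    finally show "normal_density 0 1 x * exp (- a * x\<^sup>2) = s * normal_density 0 s x" .
  qed
  also have "\<dots> = s" using s(1) by simp
  finally show ?thesis by (simp add: s_def)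
qed

lemma gN_exp_integrable:
  assumes "s > 0"
  shows "integrable (gN s) (\<lambda>x. exp (t * x))"
    and "(LINT x|gN s. exp (t * x)) = exp (t\<^sup>2 * s\<^sup>2 / 2)"
proof -
  have e: "normal_density 0 s x * exp (t * x) = exp (t\<^sup>2 * s\<^sup>2 / 2) * normal_density (t * s\<^sup>2) s x" for x
  proof -
    have "- x\<^sup>2 / (2 * s\<^sup>2) + t * x = t\<^sup>2 * s\<^sup>2 / 2 + - (x - t * s\<^sup>2)\<^sup>2 / (2 * s\<^sup>2)"
      using assms by (simp add: field_simps power2_eq_square)
    then show ?thesis
      by (simp add: normal_density_def exp_add[symmetric] mult.commute)
  qed
  show "integrable (gN s) (\<lambda>x. exp (t * x))"
    unfolding gN_def using assms by (subst integrable_density) (auto simp: e)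
  have "(LINT x|gN s. exp (t * x)) = (LINT x|lborel. normal_density 0 s x * exp (t * x))"
    unfolding gN_def by (subst integral_density) auto
  then show "(LINT x|gN s. exp (t * x)) = exp (t\<^sup>2 * s\<^sup>2 / 2)"
    using assms by (simp add: e)
qed

text \<open>Hubbard--Stratonovich: each factor \<open>exp (- \<theta> X\<^sup>2)\<close> is the characteristic function of an
  auxiliary standard Gaussian, so that the average over the original variables becomes
  a Gaussian characteristic function, in which the means \<open>c\<close> only enter as phases.\<close>

lemma gauss_laplace:
  fixes \<alpha> :: "'l \<Rightarrow> 'j \<Rightarrow> real" and c v :: "'l \<Rightarrow> real" and s :: "'j \<Rightarrow> real"
  assumes fin: "finite L" "finite J" and s: "\<And>j. s j > 0" and \<theta>: "\<theta> \<ge> 0"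
    and v: "\<And>l. l \<in> L \<Longrightarrow> v l \<ge> 0"
    and quad: "\<And>\<xi>. (\<Sum>l\<in>L. v l * (\<xi> l)\<^sup>2) \<le> (\<Sum>j\<in>J. (s j)\<^sup>2 * (\<Sum>l\<in>L. \<xi> l * \<alpha> l j)\<^sup>2)"
  shows "(LINT x|PiM J (\<lambda>j. gN (s j)). exp (- \<theta> * (\<Sum>l\<in>L. (c l + (\<Sum>j\<in>J. \<alpha> l j * x j))\<^sup>2)))
           \<le> (\<Prod>l\<in>L. 1 / sqrt (1 + 2 * \<theta> * v l))"
proof -
  \<comment> \<open>This makes the characteristic function of a standard Gaussian at
    \<open>b * X\<close> equal to \<open>exp (- \<theta> X^2)\<close>.\<close>
  define b where "b = sqrt (2 * \<theta>)"
  have b2: "b\<^sup>2 = 2 * \<theta>" using \<theta> by (simp add: b_def)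
  let ?P = "PiM J (\<lambda>j. gN (s j))" and ?Q = "PiM L (\<lambda>_::'l. gN 1)"
  define X where "X l x = c l + (\<Sum>j\<in>J. \<alpha> l j * x j)" for l x
  define F where "F x \<xi> = (\<Prod>l\<in>L. iexp (b * X l x * \<xi> l))" for x and \<xi> :: "'l \<Rightarrow> real"
  interpret P: product_prob_space "\<lambda>j. gN (s j)" J
    by (simp add: product_prob_space_def product_prob_space_axioms_def product_sigma_finite_def
        prob_space_gN s prob_space_imp_sigma_finite)
  interpret Q: product_prob_space "\<lambda>_::'l. gN 1" L
    by (simp add: product_prob_space_def product_prob_space_axioms_def product_sigma_finite_def
        prob_space_gN prob_space_imp_sigma_finite)
  interpret PQ: pair_prob_space ?P ?Q ..
  have [measurable]: "X l \<in> borel_measurable ?P" for l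
    unfolding X_def by measurable
  have normF: "norm (F x \<xi>) = 1" for x \<xi>
    unfolding F_def by (simp flip: prod_norm)
  have [measurable]: "case_prod F \<in> borel_measurable (?P \<Otimes>\<^sub>M ?Q)"
    unfolding F_def split_beta' by measurable
  have intF: "integrable (?P \<Otimes>\<^sub>M ?Q) (case_prod F)"
    by (rule PQ.integrable_const_bound[where B = 1]) (auto simp: normF split_beta')
  have 1: "(CLINT \<xi>|?Q. F x \<xi>) = complex_of_real (exp (- \<theta> * (\<Sum>l\<in>L. (X l x)\<^sup>2)))" for x
  proof -
    have "(CLINT \<xi>|?Q. F x \<xi>) = (\<Prod>l\<in>L. CLINT y|gN 1. iexp (b * X l x * y))"
      unfolding F_def
      by (rule Q.product_integral_prod[OF fin(1)])
        (auto intro!: finite_measure.integrable_const_bound[where B = 1]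
          prob_space.finite_measure[OF prob_space_gN])
    also have "\<dots> = (\<Prod>l\<in>L. complex_of_real (exp (- \<theta> * (X l x)\<^sup>2)))"
      using char_gN[of 1 "b * X l x" for l] by (simp add: power_mult_distrib b2)
    finally show ?thesis
      using fin by (simp add: sum_distrib_left exp_sum)
  qed
  \<comment> \<open>For fixed \<xi> the integrand is a product of characters: the means contribute a
    factor of modulus 1, and \<open>quad\<close>, a diagonal lower bound on the covariance form,
    leaves a bound that factorises over \<open>L\<close>.\<close>
  have 2: "norm (CLINT x|?P. F x \<xi>) \<le> (\<Prod>l\<in>L. exp (- (\<theta> * v l) * (\<xi> l)\<^sup>2))" for \<xi>
  proof -
    define k where "k j = (\<Sum>l\<in>L. \<xi> l * \<alpha> l j)" for j
    have "F x \<xi> = iexp (b * (\<Sum>l\<in>L. \<xi> l * c l)) * (\<Prod>j\<in>J. iexp (b * k j * x j))" for x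
    proof -
      have "(\<Sum>l\<in>L. b * X l x * \<xi> l) = b * (\<Sum>l\<in>L. \<xi> l * c l) + (\<Sum>l\<in>L. \<Sum>j\<in>J. b * (\<xi> l * \<alpha> l j) * x j)"
        unfolding X_def by (simp add: algebra_simps sum.distrib sum_distrib_left)
      also have "(\<Sum>l\<in>L. \<Sum>j\<in>J. b * (\<xi> l * \<alpha> l j) * x j) = (\<Sum>j\<in>J. b * k j * x j)"
        unfolding k_def by (subst sum.swap) (simp add: sum_distrib_left sum_distrib_right)
      finally have e: "(\<Sum>l\<in>L. b * X l x * \<xi> l) = b * (\<Sum>l\<in>L. \<xi> l * c l) + (\<Sum>j\<in>J. b * k j * x j)" .
      have "F x \<xi> = iexp (\<Sum>l\<in>L. b * X l x * \<xi> l)"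
        unfolding F_def using fin by (simp add: exp_sum sum_distrib_left)
      then show ?thesis
        unfolding e using fin by (simp add: exp_sum sum_distrib_left distrib_left exp_add)
    qed
    then have "(CLINT x|?P. F x \<xi>) = iexp (b * (\<Sum>l\<in>L. \<xi> l * c l)) * (CLINT x|?P. \<Prod>j\<in>J. iexp (b * k j * x j))"
      by simp
    also have "(CLINT x|?P. \<Prod>j\<in>J. iexp (b * k j * x j)) = (\<Prod>j\<in>J. CLINT y|gN (s j). iexp (b * k j * y))"
      by (rule P.product_integral_prod[OF fin(2)])
        (auto intro!: finite_measure.integrable_const_bound[where B = 1]
          prob_space.finite_measure[OF prob_space_gN] s)
    also have "\<dots> = (\<Prod>j\<in>J. complex_of_real (exp (- \<theta> * ((s j)\<^sup>2 * (k j)\<^sup>2))))"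
      by (subst char_gN[OF s]) (simp add: power_mult_distrib b2 mult_ac)
    also have "\<dots> = complex_of_real (exp (- \<theta> * (\<Sum>j\<in>J. (s j)\<^sup>2 * (k j)\<^sup>2)))"
      using fin by (simp add: sum_distrib_left exp_sum)
    finally have "norm (CLINT x|?P. F x \<xi>) = exp (- \<theta> * (\<Sum>j\<in>J. (s j)\<^sup>2 * (k j)\<^sup>2))"
      by (simp add: norm_mult)
    also have "\<dots> \<le> exp (- \<theta> * (\<Sum>l\<in>L. v l * (\<xi> l)\<^sup>2))"
      using mult_left_mono[OF quad[of \<xi>] \<theta>] by (simp add: k_def)
    also have "\<dots> = (\<Prod>l\<in>L. exp (- (\<theta> * v l) * (\<xi> l)\<^sup>2))"
      using fin by (simp add: sum_distrib_left exp_sum mult.assoc flip: sum_negf)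
    finally show ?thesis .
  qed
  have ie: "integrable (gN 1) (\<lambda>y. exp (- (\<theta> * v l) * y\<^sup>2))" if "l \<in> L" for l
    using \<theta> v[OF that] by (intro finite_measure.integrable_const_bound[where B = 1]
          prob_space.finite_measure[OF prob_space_gN]) auto
  have "complex_of_real (LINT x|?P. exp (- \<theta> * (\<Sum>l\<in>L. (X l x)\<^sup>2)))
      = (CLINT x|?P. CLINT \<xi>|?Q. F x \<xi>)"
    unfolding 1 by simp
  also have "\<dots> = (CLINT \<xi>|?Q. CLINT x|?P. F x \<xi>)"
    by (rule PQ.Fubini_integral[OF intF, symmetric])
  finally have "abs (LINT x|?P. exp (- \<theta> * (\<Sum>l\<in>L. (X l x)\<^sup>2))) = norm (CLINT \<xi>|?Q. CLINT x|?P. F x \<xi>)"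
    by (metis norm_of_real real_norm_def)
  also have "\<dots> \<le> (LINT \<xi>|?Q. norm (CLINT x|?P. F x \<xi>))"
    by (rule integral_norm_bound)
  also have "\<dots> \<le> (LINT \<xi>|?Q. (\<Prod>l\<in>L. exp (- (\<theta> * v l) * (\<xi> l)\<^sup>2)))"
    using 2 PQ.integrable_snd[OF intF] Q.product_integrable_prod[OF fin(1) ie]
    by (intro integral_mono) auto
  also have "\<dots> = (\<Prod>l\<in>L. LINT y|gN 1. exp (- (\<theta> * v l) * y\<^sup>2))"
    by (rule Q.product_integral_prod[OF fin(1) ie])
  also have "\<dots> = (\<Prod>l\<in>L. 1 / sqrt (1 + 2 * \<theta> * v l))"
    using \<theta> v by (intro prod.cong refl, subst gN_exp_square) (auto simp: mult.assoc)
  finally show ?thesis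
    unfolding X_def by linarith
qed


lemma sum_bool: "sum f UNIV = f False + f True" for f :: "bool \<Rightarrow> 'a::comm_monoid_add"
  by (simp add: UNIV_bool add.commute)

text \<open>Every complex index splits into a real and an imaginary one, so each factor of the real
  estimate occurs twice and the square root disappears. This doubling makes the later tail bound for
  a column linear in \<open>y\<close> rather than of order \<open>sqrt y\<close>.\<close>

lemma gauss_laplace_complex:
  fixes \<beta> :: "'l \<Rightarrow> 'i \<Rightarrow> 'j \<Rightarrow> complex" and c :: "'l \<Rightarrow> complex" and v :: "'l \<Rightarrow> real"
    and s :: "'i \<Rightarrow> 'j \<Rightarrow> real"
  assumes fin: "finite L" "finite A" "finite B" and s: "\<And>i j. s i j > 0" and \<theta>: "\<theta> \<ge> 0"
    and v: "\<And>l. l \<in> L \<Longrightarrow> v l \<ge> 0"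
    and quad: "\<And>\<zeta>. (\<Sum>l\<in>L. v l * (cmod (\<zeta> l))\<^sup>2)
        \<le> (\<Sum>i\<in>A. \<Sum>j\<in>B. (s i j)\<^sup>2 * (cmod (\<Sum>l\<in>L. \<zeta> l * \<beta> l i j))\<^sup>2)"
  shows "(LINT x|PiM (A \<times> B \<times> UNIV) (\<lambda>(i,j,b::bool). gN (s i j)). exp (- \<theta> *
            (\<Sum>l\<in>L. (cmod (c l + (\<Sum>i\<in>A. \<Sum>j\<in>B. \<beta> l i j * Complex (x (i,j,False)) (x (i,j,True)))))\<^sup>2)))
           \<le> (\<Prod>l\<in>L. 1 / (1 + 2 * \<theta> * v l))"
proof -
  \<comment> \<open>The real 2 by 2 matrix of multiplication by \<open>\<beta> l i j\<close>; the
    Boolean \<open>True\<close> marks imaginary parts.\<close>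
  define \<alpha> where "\<alpha> = (\<lambda>(l,e) (i,j,b). if e = b then Re (\<beta> l i j) else if e then Im (\<beta> l i j) else - Im (\<beta> l i j))"
  define c' where "c' = (\<lambda>(l,e::bool). if e then Im (c l) else Re (c l))"
  define s' where "s' = (\<lambda>(i,j,b::bool). s i j)"
  define v' where "v' = (\<lambda>(l,e::bool). v l)"
  define Z where "Z l x = c l + (\<Sum>i\<in>A. \<Sum>j\<in>B. \<beta> l i j * Complex (x (i,j,False)) (x (i,j,True)))" for l x
  have split3: "(\<Sum>t\<in>A \<times> B \<times> UNIV. f t) = (\<Sum>i\<in>A. \<Sum>j\<in>B. f (i,j,False) + f (i,j,True))" for f :: "_ \<Rightarrow> real"
    by (simp add: sum.cartesian_product' sum_bool)
  have Z: "(\<Sum>l\<in>L. (cmod (Z l x))\<^sup>2) = (\<Sum>t\<in>L \<times> UNIV. (c' t + (\<Sum>u\<in>A \<times> B \<times> UNIV. \<alpha> t u * x u))\<^sup>2)" for x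
    unfolding split3 sum.cartesian_product' sum_bool
    by (simp add: Z_def c'_def \<alpha>_def cmod_power2 add.commute)
  have "(LINT x|PiM (A \<times> B \<times> UNIV) (\<lambda>t. gN (s' t)). exp (- \<theta> *
           (\<Sum>t\<in>L \<times> UNIV. (c' t + (\<Sum>u\<in>A \<times> B \<times> UNIV. \<alpha> t u * x u))\<^sup>2)))
        \<le> (\<Prod>t\<in>L \<times> UNIV. 1 / sqrt (1 + 2 * \<theta> * v' t))"
  proof (rule gauss_laplace)
    fix \<xi> :: "'l \<times> bool \<Rightarrow> real"
    \<comment> \<open>With this sign the two real linear forms are the real part and minus the
      imaginary part of a single complex one, so the real quadratic form becomes the one in
      \<open>quad\<close>.\<close>
    define \<zeta> where "\<zeta> l = Complex (\<xi> (l,False)) (- \<xi> (l,True))" for l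
    have "(\<Sum>t\<in>L \<times> UNIV. v' t * (\<xi> t)\<^sup>2) = (\<Sum>l\<in>L. v l * (cmod (\<zeta> l))\<^sup>2)"
      unfolding sum.cartesian_product' sum_bool by (simp add: v'_def \<zeta>_def cmod_power2 algebra_simps)
    also note quad[of \<zeta>]
    also have "(\<Sum>i\<in>A. \<Sum>j\<in>B. (s i j)\<^sup>2 * (cmod (\<Sum>l\<in>L. \<zeta> l * \<beta> l i j))\<^sup>2)
        = (\<Sum>u\<in>A \<times> B \<times> UNIV. (s' u)\<^sup>2 * (\<Sum>t\<in>L \<times> UNIV. \<xi> t * \<alpha> t u)\<^sup>2)"
      unfolding split3
    proof (intro sum.cong refl)
      fix i j
      have f0: "(\<Sum>t\<in>L \<times> UNIV. \<xi> t * \<alpha> t (i,j,False)) = Re (\<Sum>l\<in>L. \<zeta> l * \<beta> l i j)"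
        unfolding sum.cartesian_product' sum_bool by (simp add: \<alpha>_def \<zeta>_def algebra_simps)
      have f1: "(\<Sum>t\<in>L \<times> UNIV. \<xi> t * \<alpha> t (i,j,True)) = - Im (\<Sum>l\<in>L. \<zeta> l * \<beta> l i j)"
        unfolding sum.cartesian_product' sum_bool by (simp add: \<alpha>_def \<zeta>_def algebra_simps flip: sum_negf)
      show "(s i j)\<^sup>2 * (cmod (\<Sum>l\<in>L. \<zeta> l * \<beta> l i j))\<^sup>2 =
         (s' (i, j, False))\<^sup>2 * (\<Sum>t\<in>L \<times> UNIV. \<xi> t * \<alpha> t (i, j, False))\<^sup>2 +
         (s' (i, j, True))\<^sup>2 * (\<Sum>t\<in>L \<times> UNIV. \<xi> t * \<alpha> t (i, j, True))\<^sup>2"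
        unfolding f0 f1 by (simp only: s'_def prod.case cmod_power2 distrib_left power2_minus)
    qed
    finally show "(\<Sum>t\<in>L \<times> UNIV. v' t * (\<xi> t)\<^sup>2) \<le> (\<Sum>u\<in>A \<times> B \<times> UNIV. (s' u)\<^sup>2 * (\<Sum>t\<in>L \<times> UNIV. \<xi> t * \<alpha> t u)\<^sup>2)" .
  qed (use fin s \<theta> v in \<open>auto simp: s'_def v'_def\<close>)
  also have "(\<Prod>t\<in>L \<times> (UNIV::bool set). 1 / sqrt (1 + 2 * \<theta> * v' t)) = (\<Prod>l\<in>L. 1 / (1 + 2 * \<theta> * v l))"
    using \<theta> v by (auto simp: prod.cartesian_product' UNIV_bool v'_def intro!: prod.cong)
  finally show ?thesis
    unfolding Z[symmetric] Z_def by (simp add: s'_def case_prod_unfold)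
qed

lemma gauss_small_ball:
  fixes \<beta> :: "'l \<Rightarrow> 'i \<Rightarrow> 'j \<Rightarrow> complex" and c :: "'l \<Rightarrow> complex" and v :: "'l \<Rightarrow> real"
    and s :: "'i \<Rightarrow> 'j \<Rightarrow> real"
  assumes fin: "finite L" "finite A" "finite B" and s: "\<And>i j. s i j > 0" and \<theta>: "\<theta> \<ge> 0"
    and v: "\<And>l. l \<in> L \<Longrightarrow> v l \<ge> 0"
    and quad: "\<And>\<zeta>. (\<Sum>l\<in>L. v l * (cmod (\<zeta> l))\<^sup>2)
        \<le> (\<Sum>i\<in>A. \<Sum>j\<in>B. (s i j)\<^sup>2 * (cmod (\<Sum>l\<in>L. \<zeta> l * \<beta> l i j))\<^sup>2)"
  defines "N \<equiv> PiM (A \<times> B \<times> UNIV) (\<lambda>(i,j,b::bool). gN (s i j))"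
  shows "measure N {x \<in> space N. (\<Sum>l\<in>L. (cmod (c l + (\<Sum>i\<in>A. \<Sum>j\<in>B. \<beta> l i j * Complex (x (i,j,False)) (x (i,j,True)))))\<^sup>2) \<le> y}
           \<le> exp (\<theta> * y) * (\<Prod>l\<in>L. 1 / (1 + 2 * \<theta> * v l))"
proof -
  define S where "S x = (\<Sum>l\<in>L. (cmod (c l + (\<Sum>i\<in>A. \<Sum>j\<in>B. \<beta> l i j * Complex (x (i,j,False)) (x (i,j,True)))))\<^sup>2)" for x
  have "prob_space N"
    unfolding N_def by (intro prob_space_PiM) (auto simp: prob_space_gN s)
  then interpret prob_space N .
  have [measurable]: "(\<lambda>x. x (i,j,b)) \<in> borel_measurable N" if "i \<in> A" "j \<in> B" for i j b
  proof -
    have "(\<lambda>x. x (i,j,b)) \<in> measurable N ((\<lambda>(i,j,b::bool). gN (s i j)) (i,j,b))"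
      unfolding N_def by (rule measurable_component_singleton) (use that in auto)
    then show ?thesis by (simp add: measurable_cong_sets[OF refl sets_gN])
  qed
  have [measurable]: "S \<in> borel_measurable N"
    unfolding S_def Complex_eq using fin by measurable
  have S0: "S x \<ge> 0" for x unfolding S_def by (simp add: sum_nonneg)
  have int: "integrable N (\<lambda>x. exp (- \<theta> * S x))"
    by (rule integrable_const_bound[where B = 1]) (auto simp: \<theta> S0)
  have "prob {x \<in> space N. S x \<le> y} = (LINT x|N. indicator {x \<in> space N. S x \<le> y} x)"
    by simp
  also have "\<dots> \<le> (LINT x|N. exp (\<theta> * y) * exp (- \<theta> * S x))"
  proof (intro integral_mono)
    show "integrable N (indicat_real {x \<in> space N. S x \<le> y})"
      by (rule integrable_const_bound[where B = 1]) (auto simp: indicator_def)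
  next
    fix x assume "x \<in> space N"
    have "1 \<le> exp (\<theta> * y - \<theta> * S x)" if "S x \<le> y" using \<theta> that by (simp add: mult_left_mono)
    then show "indicator {x \<in> space N. S x \<le> y} x \<le> exp (\<theta> * y) * exp (- \<theta> * S x)"
      by (auto simp: indicator_def simp flip: exp_add)
  qed (use int in auto)
  also have "\<dots> = exp (\<theta> * y) * (LINT x|N. exp (- \<theta> * S x))"
    by simp
  also have "\<dots> \<le> exp (\<theta> * y) * (\<Prod>l\<in>L. 1 / (1 + 2 * \<theta> * v l))"
    unfolding S_def N_def
    by (intro mult_left_mono gauss_laplace_complex fin s \<theta> v quad) auto
  finally show ?thesis unfolding S_def .
qed

text \<open>Fubini as conditioning: the coordinates outside \<open>J\<close> are frozen, and a bound
  uniform in their values suffices. Eigenbases, windows and nets that depend on frozen entries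
  thereby become deterministic data, and no measurable dependence on those entries is asked of
  them.\<close>

lemma measure_PiM_section_le:
  assumes fin: "finite I" and J: "J \<subseteq> I" and M: "\<And>i. prob_space (M i)"
    and S: "S \<in> sets (PiM I M)"
    and sec: "\<And>\<omega>. \<omega> \<in> space (PiM (I - J) M) \<Longrightarrow>
      measure (PiM J M) {x \<in> space (PiM J M). merge (I - J) J (\<omega>, x) \<in> S} \<le> p"
  shows "measure (PiM I M) S \<le> p"
proof -
  interpret product_prob_space M I
    using M by (simp add: product_prob_space_def product_prob_space_axioms_def product_sigma_finite_def
        prob_space_imp_sigma_finite)
  have fJ: "finite J" "finite (I - J)" using fin J finite_subset by auto
  have I: "(I - J) \<union> J = I" using J by auto
  interpret pJ: prob_space "PiM J M" by (intro prob_space_PiM M)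
  interpret pI: prob_space "PiM (I - J) M" by (intro prob_space_PiM M)
  have mm: "(\<lambda>x. merge (I - J) J (\<omega>, x)) \<in> measurable (PiM J M) (PiM I M)"
    if "\<omega> \<in> space (PiM (I - J) M)" for \<omega>
    using measurable_comp[OF measurable_Pair1'[OF that] measurable_merge[of "I - J" J M]]
    unfolding I by (simp add: comp_def)
  have "emeasure (PiM I M) S = (\<integral>\<^sup>+ x. indicator S x \<partial>PiM I M)"
    using S by simp
  also have "\<dots> = (\<integral>\<^sup>+ \<omega>. (\<integral>\<^sup>+ x. indicator S (merge (I - J) J (\<omega>, x)) \<partial>PiM J M) \<partial>PiM (I - J) M)"
    using product_nn_integral_fold[of "I - J" J "indicator S", unfolded I] S fJ by auto
  also have "\<dots> \<le> (\<integral>\<^sup>+ \<omega>. ennreal p \<partial>PiM (I - J) M)"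
  proof (rule nn_integral_mono)
    fix \<omega> assume \<omega>: "\<omega> \<in> space (PiM (I - J) M)"
    let ?A = "{x \<in> space (PiM J M). merge (I - J) J (\<omega>, x) \<in> S}"
    have A: "?A \<in> sets (PiM J M)"
      using measurable_sets[OF mm[OF \<omega>] S] by (simp add: vimage_def Int_def conj_commute)
    have "(\<integral>\<^sup>+ x. indicator S (merge (I - J) J (\<omega>, x)) \<partial>PiM J M) = (\<integral>\<^sup>+ x. indicator ?A x \<partial>PiM J M)"
      by (intro nn_integral_cong) (auto simp: indicator_def)
    also have "\<dots> = emeasure (PiM J M) ?A" using A by simp
    also have "\<dots> \<le> ennreal p"
      unfolding pJ.emeasure_eq_measure by (intro ennreal_leI sec \<omega>)
    finally show "(\<integral>\<^sup>+ x. indicator S (merge (I - J) J (\<omega>, x)) \<partial>PiM J M) \<le> ennreal p" .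
  qed
  also have "\<dots> = ennreal p" by (simp add: pI.emeasure_space_1)
  finally have "ennreal (measure (PiM I M) S) \<le> ennreal p"
    by (simp add: P.emeasure_eq_measure)
  \<comment> \<open>Removing \<open>ennreal\<close> requires the sign of \<open>p\<close>, which any
    single section supplies.\<close>
  moreover have "p \<ge> 0"
  proof -
    obtain \<omega> where "\<omega> \<in> space (PiM (I - J) M)" using pI.not_empty by blast
    from sec[OF this] show ?thesis by (rule order_trans[rotated]) simp
  qed
  ultimately show ?thesis by simp
qed

section \<open>Hermitian matrices on finite index sets\<close>

text \<open>Vectors and matrices are total functions that are read only on the index set. A minor is
  then the same function on a smaller set, so deleting an index or passing to a block needs no
  reindexing.\<close>

definition ip :: "'i set \<Rightarrow> ('i \<Rightarrow> complex) \<Rightarrow> ('i \<Rightarrow> complex) \<Rightarrow> complex" where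
  "ip I u v = (\<Sum>i\<in>I. cnj (u i) * v i)"

definition nsq :: "'i set \<Rightarrow> ('i \<Rightarrow> complex) \<Rightarrow> real" where
  "nsq I v = (\<Sum>i\<in>I. (cmod (v i))\<^sup>2)"

definition mv :: "'i set \<Rightarrow> ('i \<Rightarrow> 'i \<Rightarrow> complex) \<Rightarrow> ('i \<Rightarrow> complex) \<Rightarrow> 'i \<Rightarrow> complex" where
  "mv I K v = (\<lambda>i. \<Sum>j\<in>I. K i j * v j)"

definition herm :: "'i set \<Rightarrow> ('i \<Rightarrow> 'i \<Rightarrow> complex) \<Rightarrow> bool" where
  "herm I K \<longleftrightarrow> (\<forall>i\<in>I. \<forall>j\<in>I. K i j = cnj (K j i))"

definition onb :: "'i set \<Rightarrow> nat \<Rightarrow> (nat \<Rightarrow> 'i \<Rightarrow> complex) \<Rightarrow> bool" where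
  "onb I m w \<longleftrightarrow> (\<forall>k<m. \<forall>l<m. ip I (w k) (w l) = (if k = l then 1 else 0))"

text \<open>Completeness is recorded beside orthonormality as a resolution of the identity, the form
  in which expansions and resolvent identities use it. The basis is numbered by naturals whatever
  the index type is.\<close>

definition eigbasis :: "'i set \<Rightarrow> ('i \<Rightarrow> 'i \<Rightarrow> complex) \<Rightarrow> (nat \<Rightarrow> 'i \<Rightarrow> complex) \<Rightarrow> (nat \<Rightarrow> real) \<Rightarrow> bool" where
  "eigbasis I K w \<mu> \<longleftrightarrow>
     (\<forall>l<card I. \<forall>i\<in>I. mv I K (w l) i = \<mu> l * w l i) \<and> onb I (card I) w \<and>
     (\<forall>i\<in>I. \<forall>j\<in>I. (\<Sum>l<card I. w l i * cnj (w l j)) = (if i = j then 1 else 0))"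

lemma nsq_nonneg [simp]: "nsq I v \<ge> 0"
  by (simp add: nsq_def sum_nonneg)

lemma ip_self: "ip I v v = of_real (nsq I v)"
  unfolding ip_def nsq_def of_real_sum complex_norm_square by (intro sum.cong refl mult.commute)

lemma ip_cong: "(\<And>i. i \<in> I \<Longrightarrow> u i = u' i) \<Longrightarrow> (\<And>i. i \<in> I \<Longrightarrow> v i = v' i) \<Longrightarrow> ip I u v = ip I u' v'"
  by (simp add: ip_def)

lemma nsq_cong: "(\<And>i. i \<in> I \<Longrightarrow> v i = v' i) \<Longrightarrow> nsq I v = nsq I v'"
  by (simp add: nsq_def)

lemma ip_add_right: "ip I u (\<lambda>i. v i + w i) = ip I u v + ip I u w"
  and ip_add_left: "ip I (\<lambda>i. v i + w i) u = ip I v u + ip I w u"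
  and ip_diff_right: "ip I u (\<lambda>i. v i - w i) = ip I u v - ip I u w"
  and ip_diff_left: "ip I (\<lambda>i. v i - w i) u = ip I v u - ip I w u"
  and ip_scale_right: "ip I u (\<lambda>i. c * v i) = c * ip I u v"
  and ip_scale_left: "ip I (\<lambda>i. c * v i) u = cnj c * ip I v u"
  by (simp_all add: ip_def algebra_simps sum.distrib sum_subtractf sum_distrib_left)

lemma ip_sum_right: "ip I u (\<lambda>i. \<Sum>l\<in>L. v l i) = (\<Sum>l\<in>L. ip I u (v l))"
  unfolding ip_def by (subst sum.swap) (simp add: sum_distrib_left)

lemma ip_sum_left: "ip I (\<lambda>i. \<Sum>l\<in>L. v l i) u = (\<Sum>l\<in>L. ip I (v l) u)"
  unfolding ip_def by (subst sum.swap) (simp add: sum_distrib_right)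

lemma cnj_ip: "cnj (ip I u v) = ip I v u"
  by (simp add: ip_def mult.commute)

lemma mv_add: "mv I K (\<lambda>i. u i + v i) = (\<lambda>i. mv I K u i + mv I K v i)"
  and mv_diff: "mv I K (\<lambda>i. u i - v i) = (\<lambda>i. mv I K u i - mv I K v i)"
  and mv_scale: "mv I K (\<lambda>i. c * u i) = (\<lambda>i. c * mv I K u i)"
  by (simp_all add: mv_def algebra_simps sum.distrib sum_subtractf sum_distrib_left)

lemma mv_cong: "(\<And>i. i \<in> I \<Longrightarrow> u i = v i) \<Longrightarrow> mv I K u = mv I K v"
  by (simp add: mv_def)

lemma ip_mv:
  assumes "herm I K"
  shows "ip I u (mv I K v) = ip I (mv I K u) v"
proof -
  have K: "cnj (K j i) = K i j" if "i \<in> I" "j \<in> I" for i j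
    using assms that unfolding herm_def by metis
  have "ip I u (mv I K v) = (\<Sum>i\<in>I. \<Sum>j\<in>I. cnj (K j i * u i) * v j)"
    unfolding ip_def mv_def sum_distrib_left
    by (intro sum.cong refl) (simp add: K)
  also have "\<dots> = (\<Sum>j\<in>I. \<Sum>i\<in>I. cnj (K j i * u i) * v j)"
    by (rule sum.swap)
  also have "\<dots> = ip I (mv I K u) v"
    unfolding ip_def mv_def by (simp add: sum_distrib_right)
  finally show ?thesis .
qed

lemma nsq_eq_0_iff: "finite I \<Longrightarrow> nsq I v = 0 \<longleftrightarrow> (\<forall>i\<in>I. v i = 0)"
  by (simp add: nsq_def sum_nonneg_eq_0_iff)

lemma nsq_scale: "nsq I (\<lambda>i. c * v i) = (cmod c)\<^sup>2 * nsq I v"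
  by (simp add: nsq_def norm_mult power_mult_distrib sum_distrib_left)

text \<open>The Rayleigh quotient attains its maximum on the unit sphere of the orthogonal
  complement of the given eigenvectors, and a maximiser is an eigenvector because \<open>K\<close>
  preserves that complement.\<close>

lemma extend_eigenfamily:
  fixes w :: "nat \<Rightarrow> 'i \<Rightarrow> complex"
  assumes fin: "finite I" and K: "herm I K"
    and ev: "\<And>l i. l < m \<Longrightarrow> i \<in> I \<Longrightarrow> mv I K (w l) i = complex_of_real (\<mu> l) * w l i"
    and u: "nsq I u \<noteq> 0" "\<And>l. l < m \<Longrightarrow> ip I (w l) u = 0"
  obtains v \<kappa> where "nsq I v = 1" "\<And>l. l < m \<Longrightarrow> ip I (w l) v = 0"
    "\<And>i. i \<in> I \<Longrightarrow> mv I K v i = complex_of_real \<kappa> * v i"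
proof -
  \<comment> \<open>Pinning the values off \<open>I\<close> to 0 makes this set compact in the
    product topology of the whole function type: it is closed and lies in a product of discs and
    singletons.\<close>
  define C where "C = {v. (\<forall>i. i \<notin> I \<longrightarrow> v i = 0) \<and> nsq I v = 1 \<and> (\<forall>l<m. ip I (w l) v = 0)}"
  define B where "B = PiE UNIV (\<lambda>i. if i \<in> I then cball (0::complex) 1 else {0})"
  define f where "f v = Re (ip I v (mv I K v))" for v
  have coord [continuous_intros]: "continuous_on S (\<lambda>v::'i \<Rightarrow> complex. v i)" for i S
    by (rule continuous_on_subset[OF continuous_on_product_coordinates]) simp
  have "compactin (product_topology (\<lambda>_. euclidean) UNIV) B"
    unfolding B_def by (subst compactin_PiE) auto
  then have "compact B" by (simp add: euclidean_product_topology)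
  moreover have "closed C"
    unfolding C_def nsq_def ip_def imp_conv_disj
    by (intro closed_Collect_conj closed_Collect_all closed_Collect_disj closed_Collect_eq
        closed_Collect_const continuous_intros)
  moreover have "C \<subseteq> B"
  proof
    fix v assume v: "v \<in> C"
    have "cmod (v i) \<le> 1" if "i \<in> I" for i
    proof -
      have "(cmod (v i))\<^sup>2 \<le> nsq I v"
        unfolding nsq_def by (rule member_le_sum) (use that fin in auto)
      then show ?thesis using v by (simp add: C_def power_le_one_iff abs_square_le_1)
    qed
    then show "v \<in> B" using v by (auto simp: B_def C_def)
  qed
  ultimately have "compact C" by (metis compact_Int_closed inf.absorb_iff2)
  moreover have "C \<noteq> {}"
  proof -
    define c where "c = 1 / complex_of_real (sqrt (nsq I u))"
    define v where "v i = (if i \<in> I then c * u i else 0)" for i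
    have "nsq I v = nsq I (\<lambda>i. c * u i)" by (rule nsq_cong) (simp add: v_def)
    also have "\<dots> = 1"
      unfolding nsq_scale c_def using u(1) nsq_nonneg[of I u] by (simp add: norm_divide power_divide)
    finally have "nsq I v = 1" .
    moreover have "ip I (w l) v = 0" if "l < m" for l
    proof -
      have "ip I (w l) v = ip I (w l) (\<lambda>i. c * u i)" by (rule ip_cong) (simp_all add: v_def)
      then show ?thesis using u(2)[OF that] by (simp add: ip_scale_right)
    qed
    ultimately have "v \<in> C" by (auto simp: C_def v_def)
    then show ?thesis by auto
  qed
  moreover have "continuous_on C f"
    unfolding f_def ip_def mv_def by (intro continuous_intros)
  ultimately obtain v where v: "v \<in> C" and max: "\<And>v'. v' \<in> C \<Longrightarrow> f v' \<le> f v"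
    using continuous_attains_sup[of C f] by auto
  define \<kappa> where "\<kappa> = f v"
  \<comment> \<open>By homogeneity the maximum over unit vectors becomes a quadratic inequality on
    the whole complement.\<close>
  have bound: "f z \<le> \<kappa> * nsq I z" if z: "\<And>l. l < m \<Longrightarrow> ip I (w l) z = 0" for z
  proof (cases "nsq I z = 0")
    case True
    then have "\<forall>i\<in>I. z i = 0" using nsq_eq_0_iff fin by blast
    then show ?thesis using True by (simp add: f_def ip_def)
  next
    case False
    define c where "c = 1 / complex_of_real (sqrt (nsq I z))"
    have c2: "(cmod c)\<^sup>2 * nsq I z = 1"
      unfolding c_def using False nsq_nonneg[of I z] by (simp add: norm_divide power_divide)
    define z' where "z' i = (if i \<in> I then c * z i else 0)" for i
    have z': "\<And>i. i \<in> I \<Longrightarrow> z' i = c * z i" by (simp add: z'_def)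
    have "nsq I z' = 1" using nsq_cong[of I z' "\<lambda>i. c * z i"] z' c2 by (simp add: nsq_scale)
    moreover have "ip I (w l) z' = 0" if "l < m" for l
      using ip_cong[of I "w l" "w l" z' "\<lambda>i. c * z i"] z' z[OF that] by (simp add: ip_scale_right)
    ultimately have "z' \<in> C" by (auto simp: C_def z'_def)
    then have "f z' \<le> \<kappa>" using max by (simp add: \<kappa>_def)
    moreover have "f z' = (cmod c)\<^sup>2 * f z"
    proof -
      have "ip I z' (mv I K z') = ip I (\<lambda>i. c * z i) (mv I K (\<lambda>i. c * z i))"
        using mv_cong[of I z' "\<lambda>i. c * z i" K] z' by (intro ip_cong) auto
      also have "\<dots> = (cnj c * c) * ip I z (mv I K z)"
        by (simp add: mv_scale ip_scale_left ip_scale_right)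
      also have "cnj c * c = of_real ((cmod c)\<^sup>2)"
        by (metis complex_norm_square mult.commute)
      finally show ?thesis by (simp add: f_def)
    qed
    ultimately have "(cmod c)\<^sup>2 * f z * nsq I z \<le> \<kappa> * nsq I z"
      by (intro mult_right_mono) auto
    moreover have "(cmod c)\<^sup>2 * f z * nsq I z = ((cmod c)\<^sup>2 * nsq I z) * f z" by simp
    ultimately show ?thesis by (simp only: c2)
  qed
  \<comment> \<open>Up to a factor, \<open>g\<close> is the gradient of the quotient at
    \<open>v\<close>. It is again orthogonal to the family, so \<open>v + t g\<close> is an
    admissible competitor.\<close>
  define g where "g i = mv I K v i - complex_of_real \<kappa> * v i" for i
  have orth: "ip I (w l) v = 0" if "l < m" for l using v that by (simp add: C_def)
  have orthg: "ip I (w l) g = 0" if l: "l < m" for l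
  proof -
    have "ip I (w l) (mv I K v) = ip I (mv I K (w l)) v" by (rule ip_mv[OF K])
    also have "\<dots> = ip I (\<lambda>i. \<mu> l * w l i) v" using ev[OF l] by (intro ip_cong) auto
    also have "\<dots> = 0" by (simp add: ip_scale_left orth[OF l])
    finally show ?thesis
      unfolding g_def by (simp add: ip_diff_right ip_scale_right orth[OF l])
  qed
  have "g i = 0" if "i \<in> I" for i
  proof (rule ccontr)
    assume "g i \<noteq> 0"
    then have pos: "nsq I g > 0" using nsq_eq_0_iff[OF fin, of g] that nsq_nonneg[of I g]
      by (metis less_eq_real_def)
    define q where "q = \<kappa> * nsq I g - f g"
    have ineq: "2 * t * nsq I g \<le> t\<^sup>2 * q" for t :: real
    proof -
      define z where "z i = v i + complex_of_real t * g i" for i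
      have "ip I (w l) z = 0" if "l < m" for l
        unfolding z_def using orth orthg that by (simp add: ip_add_right ip_scale_right)
      from bound[OF this] have le: "f z \<le> \<kappa> * nsq I z" .
      have gg: "ip I g (mv I K v) - \<kappa> * ip I g v = nsq I g"
      proof -
        have "ip I g g = ip I g (\<lambda>i. mv I K v i - \<kappa> * v i)" by (intro ip_cong) (simp_all add: g_def)
        then show ?thesis by (simp add: ip_self ip_diff_right ip_scale_right)
      qed
      have fz: "f z = f v + 2 * t * Re (ip I g (mv I K v)) + t\<^sup>2 * f g"
      proof -
        have "Re (ip I v (mv I K g)) = Re (ip I g (mv I K v))"
          using arg_cong[OF cnj_ip[of I v "mv I K g"], of Re] ip_mv[OF K, of g v] by simp
        then show ?thesis
          unfolding f_def z_def
          by (simp add: mv_add mv_scale ip_add_left ip_add_right ip_scale_left ip_scale_right algebra_simps power2_eq_square)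
      qed
      have "complex_of_real (nsq I z) = ip I z z" by (simp add: ip_self)
      also have "Re (ip I z z) = nsq I v + 2 * t * Re (ip I g v) + t\<^sup>2 * nsq I g"
      proof -
        have "Re (ip I v g) = Re (ip I g v)" using arg_cong[OF cnj_ip[of I v g], of Re] by simp
        then show ?thesis
          unfolding z_def
          by (simp add: ip_self[of I v] ip_self[of I g] ip_add_left ip_add_right ip_scale_left ip_scale_right
              algebra_simps power2_eq_square)
      qed
      finally have nz: "nsq I z = nsq I v + 2 * t * Re (ip I g v) + t\<^sup>2 * nsq I g" by simp
      have "Re (ip I g (mv I K v)) = \<kappa> * Re (ip I g v) + nsq I g"
        using arg_cong[OF gg, of Re] by simp
      moreover have "nsq I v = 1" using v by (simp add: C_def)
      ultimately show ?thesis
        using le fz nz by (simp add: q_def \<kappa>_def algebra_simps)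
    qed
    \<comment> \<open>With this \<open>t\<close> the second-order term \<open>t^2 q\<close> is at
      most \<open>t * nsq I g\<close>, only half of the first-order gain, which is absurd. The added
      1 covers \<open>q = 0\<close>.\<close>
    define t where "t = nsq I g / (\<bar>q\<bar> + 1)"
    have t: "t > 0" using pos by (simp add: t_def)
    have "t * q \<le> t * (\<bar>q\<bar> + 1)" using t by (intro mult_left_mono) auto
    also have "\<dots> = nsq I g" by (simp add: t_def)
    finally have "t * (t * q) \<le> t * nsq I g" using t by simp
    then have "2 * t * nsq I g \<le> t * nsq I g"
      using ineq[of t] by (simp add: power2_eq_square mult.assoc)
    then show False using t pos by simp
  qed
  then have "mv I K v i = complex_of_real \<kappa> * v i" if "i \<in> I" for i
    using that by (simp add: g_def)
  with v orth show ?thesis by (intro that) (auto simp: C_def)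
qed


lemma ip_sum_scale_right: "ip I u (\<lambda>i. \<Sum>l\<in>L. c l * v l i) = (\<Sum>l\<in>L. c l * ip I u (v l))"
  by (simp add: ip_sum_right ip_scale_right)

lemma ip_unit: "finite I \<Longrightarrow> j \<in> I \<Longrightarrow> ip I u (\<lambda>i. if i = j then 1 else 0) = cnj (u j)"
  by (simp add: ip_def if_distrib cong: if_cong)

lemma sum_mult_delta:
  assumes "finite L"
  shows "(\<Sum>l\<in>L. f l * (if k = l then 1 else 0)) = (if k \<in> L then f k else (0::complex))"
    and "(\<Sum>l\<in>L. f l * (if l = k then 1 else 0)) = (if k \<in> L then f k else 0)"
    and "(\<Sum>l\<in>L. (if k = l then 1 else 0) * f l) = (if k \<in> L then f k else 0)"
    and "(\<Sum>l\<in>L. (if l = k then 1 else 0) * f l) = (if k \<in> L then f k else 0)"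
  using assms by (simp_all add: if_distrib[of "(*) _"] if_distrib[of "\<lambda>x. x * _"] cong: if_cong)

text \<open>The residuals \<open>d j\<close> of the standard basis vectors after projection have
  squared norms adding up to \<open>card I - m\<close>, by a trace count. Nonnegativity gives
  Bessel's bound on \<open>m\<close>; if no nonzero vector is orthogonal to the family, all
  residuals vanish, which is completeness together with \<open>m = card I\<close>.\<close>

lemma onb_bessel:
  assumes fin: "finite I" and on: "onb I m w"
  shows "m \<le> card I"
    and "(\<And>u. nsq I u \<noteq> 0 \<Longrightarrow> \<exists>l<m. ip I (w l) u \<noteq> 0) \<Longrightarrow>
      m = card I \<and> (\<forall>i\<in>I. \<forall>j\<in>I. (\<Sum>l<m. w l i * cnj (w l j)) = (if i = j then 1 else 0))"
proof -
  define e where "e j = (\<lambda>i. if i = j then 1 else (0::complex))" for j :: 'a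
  define d where "d j i = e j i - (\<Sum>l<m. cnj (w l j) * w l i)" for i j
  have on': "ip I (w k) (w l) = (if k = l then 1 else 0)" if "k < m" "l < m" for k l
    using on that by (simp add: onb_def)
  have wd: "ip I (w k) (d j) = 0" if "k < m" "j \<in> I" for k j
  proof -
    have "(\<Sum>l<m. cnj (w l j) * ip I (w k) (w l)) = (\<Sum>l<m. cnj (w l j) * (if k = l then 1 else 0))"
      by (intro sum.cong refl) (simp add: on' that)
    also have "\<dots> = cnj (w k j)" using that by (subst sum_mult_delta) auto
    finally have 1: "(\<Sum>l<m. cnj (w l j) * ip I (w k) (w l)) = cnj (w k j)" .
    have 2: "ip I (w k) (e j) = cnj (w k j)" unfolding e_def using that fin by (intro ip_unit)
    show ?thesis unfolding d_def ip_diff_right ip_sum_scale_right 1 2 by simp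
  qed
  have dd: "complex_of_real (nsq I (d j)) = 1 - (\<Sum>l<m. cnj (w l j) * w l j)" if j: "j \<in> I" for j
  proof -
    have "ip I (d j) (d j) = ip I (d j) (e j) - (\<Sum>l<m. cnj (w l j) * ip I (d j) (w l))"
    proof -
      have "ip I (d j) (d j) = ip I (d j) (\<lambda>i. e j i - (\<Sum>l<m. cnj (w l j) * w l i))"
        by (intro ip_cong) (simp_all add: d_def)
      then show ?thesis by (simp add: ip_diff_right ip_sum_scale_right)
    qed
    also have "\<dots> = ip I (d j) (e j)"
    proof -
      have "ip I (d j) (w l) = 0" if "l < m" for l
        using wd[OF that j] cnj_ip[of I "w l" "d j"] by simp
      then show ?thesis by simp
    qed
    also have "\<dots> = cnj (d j j)" unfolding e_def by (rule ip_unit[OF fin j])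
    also have "\<dots> = 1 - (\<Sum>l<m. cnj (w l j) * w l j)" by (simp add: d_def e_def mult.commute)
    finally show ?thesis by (simp add: ip_self)
  qed
  have tr: "(\<Sum>j\<in>I. \<Sum>l<m. cnj (w l j) * w l j) = of_nat m"
  proof -
    have "(\<Sum>j\<in>I. \<Sum>l<m. cnj (w l j) * w l j) = (\<Sum>l<m. ip I (w l) (w l))"
      unfolding ip_def by (rule sum.swap)
    also have "\<dots> = (\<Sum>l<m. 1)" by (intro sum.cong refl) (simp add: on')
    finally show ?thesis by simp
  qed
  have "complex_of_real (\<Sum>j\<in>I. nsq I (d j)) = of_nat (card I) - of_nat m"
    unfolding of_real_sum by (simp add: dd sum_subtractf tr)
  then have "complex_of_real (\<Sum>j\<in>I. nsq I (d j)) = complex_of_real (real (card I) - real m)"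
    by simp
  then have sum_d: "(\<Sum>j\<in>I. nsq I (d j)) = real (card I) - real m"
    by (simp only: of_real_eq_iff)
  moreover have "(\<Sum>j\<in>I. nsq I (d j)) \<ge> 0" by (simp add: sum_nonneg)
  ultimately show "m \<le> card I" by simp
  show "m = card I \<and> (\<forall>i\<in>I. \<forall>j\<in>I. (\<Sum>l<m. w l i * cnj (w l j)) = (if i = j then 1 else 0))"
    if A: "\<And>u. nsq I u \<noteq> 0 \<Longrightarrow> \<exists>l<m. ip I (w l) u \<noteq> 0"
  proof -
  have d0: "nsq I (d j) = 0" if "j \<in> I" for j using A[of "d j"] wd that by blast
  then have "real (card I) = real m" using sum_d by simp
  moreover have "(\<Sum>l<m. w l i * cnj (w l j)) = (if i = j then 1 else 0)" if "i \<in> I" "j \<in> I" for i j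
  proof -
    have "d j i = 0" using d0[OF that(2)] that(1) nsq_eq_0_iff[OF fin] by blast
    then show ?thesis by (simp add: d_def e_def mult.commute)
  qed
  ultimately show ?thesis
    by simp
  qed
qed

text \<open>Orthonormal families of eigenvectors have length at most \<open>card I\<close>, so one
  of maximal length exists; a nonzero vector orthogonal to it would allow it to be
  prolonged.\<close>

theorem hermitian_eigbasis:
  assumes fin: "finite I" and K: "herm I K"
  shows "\<exists>w \<mu>. eigbasis I K w \<mu>"
proof -
  define Q where "Q m \<longleftrightarrow> (\<exists>w \<mu>. (\<forall>l<m. \<forall>i\<in>I. mv I K (w l) i = complex_of_real (\<mu> l) * w l i) \<and> onb I m w)" for m
  have "Q 0" by (simp add: Q_def onb_def)
  moreover have "{m. Q m} \<subseteq> {..card I}"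
    unfolding Q_def using onb_bessel(1)[OF fin] by blast
  then have finQ: "finite {m. Q m}" using finite_subset by blast
  ultimately have "Max {m. Q m} \<in> {m. Q m}" by (intro Max_in) auto
  then obtain m where m: "Q m" "\<not> Q (Suc m)"
    using Max_ge[OF finQ] by (metis Suc_n_not_le_n mem_Collect_eq)
  obtain w \<mu> where w: "\<And>l i. l < m \<Longrightarrow> i \<in> I \<Longrightarrow> mv I K (w l) i = complex_of_real (\<mu> l) * w l i" "onb I m w"
    using m(1) unfolding Q_def by blast
  have "\<exists>l<m. ip I (w l) u \<noteq> 0" if u: "nsq I u \<noteq> 0" for u
  proof (rule ccontr)
    assume "\<not> (\<exists>l<m. ip I (w l) u \<noteq> 0)"
    then have u0: "\<And>l. l < m \<Longrightarrow> ip I (w l) u = 0" by blast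
    obtain v \<kappa> where v: "nsq I v = 1" "\<And>l. l < m \<Longrightarrow> ip I (w l) v = 0"
      "\<And>i. i \<in> I \<Longrightarrow> mv I K v i = complex_of_real \<kappa> * v i"
      by (rule extend_eigenfamily[where w = w and m = m and \<mu> = \<mu> and u = u, OF fin K]) (use w(1) u u0 in auto)
    have v': "ip I v (w l) = 0" if "l < m" for l using v(2)[OF that] by (metis cnj_ip complex_cnj_zero)
    have "Q (Suc m)"
      unfolding Q_def
    proof (intro exI conjI)
      show "\<forall>l<Suc m. \<forall>i\<in>I. mv I K ((w(m := v)) l) i = complex_of_real ((\<mu>(m := \<kappa>)) l) * (w(m := v)) l i"
        using w(1) v(3) by (auto simp: less_Suc_eq)
      show "onb I (Suc m) (w(m := v))"
        unfolding onb_def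
      proof (intro allI impI)
        fix k l assume "k < Suc m" "l < Suc m"
        then consider "k < m" "l < m" | "k < m" "l = m" | "k = m" "l < m" | "k = m" "l = m" by linarith
        then show "ip I ((w(m := v)) k) ((w(m := v)) l) = (if k = l then 1 else 0)"
          using w(2) v(1,2) v' by cases (simp_all add: onb_def ip_self)
      qed
    qed
    then show False using m(2) by simp
  qed
  from onb_bessel(2)[OF fin w(2) this] have "m = card I"
    "\<forall>i\<in>I. \<forall>j\<in>I. (\<Sum>l<m. w l i * cnj (w l j)) = (if i = j then 1 else 0)" by auto
  then have "eigbasis I K w \<mu>" using w by (auto simp: eigbasis_def)
  then show ?thesis by blast
qed

context
  fixes I :: "'i set" and K w \<mu>
  assumes fin: "finite I" and eb: "eigbasis I K w \<mu>"
begin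

lemma eigbasis_mv: "l < card I \<Longrightarrow> i \<in> I \<Longrightarrow> mv I K (w l) i = of_real (\<mu> l) * w l i"
  using eb by (simp add: eigbasis_def)

lemma eigbasis_ip: "k < card I \<Longrightarrow> l < card I \<Longrightarrow> ip I (w k) (w l) = (if k = l then 1 else 0)"
  using eb by (simp add: eigbasis_def onb_def)

lemma eigbasis_complete:
  "i \<in> I \<Longrightarrow> j \<in> I \<Longrightarrow> (\<Sum>l<card I. w l i * cnj (w l j)) = (if i = j then 1 else 0)"
  using eb by (simp add: eigbasis_def)

lemma eigbasis_expand:
  assumes "i \<in> I"
  shows "v i = (\<Sum>l<card I. ip I (w l) v * w l i)"
proof -
  have "(\<Sum>l<card I. ip I (w l) v * w l i) = (\<Sum>j\<in>I. (\<Sum>l<card I. w l i * cnj (w l j)) * v j)"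
    unfolding ip_def sum_distrib_right by (subst sum.swap) (simp add: mult_ac)
  also have "\<dots> = v i"
  proof -
    have "(\<Sum>j\<in>I. (\<Sum>l<card I. w l i * cnj (w l j)) * v j) = (\<Sum>j\<in>I. (if i = j then 1 else 0) * v j)"
      using assms by (intro sum.cong refl) (simp add: eigbasis_complete)
    then show ?thesis using assms fin by (simp add: sum_mult_delta)
  qed
  finally show ?thesis by simp
qed

lemma nsq_orthonormal_sum:
  assumes "L \<subseteq> {..<card I}"
  shows "nsq I (\<lambda>i. \<Sum>l\<in>L. c l * w l i) = (\<Sum>l\<in>L. (cmod (c l))\<^sup>2)"
proof -
  have fL: "finite L" using assms finite_subset by blast
  have "ip I (\<lambda>i. \<Sum>l\<in>L. c l * w l i) (\<lambda>i. \<Sum>l\<in>L. c l * w l i) = (\<Sum>l\<in>L. \<Sum>k\<in>L. cnj (c l) * (c k * ip I (w l) (w k)))"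
    unfolding ip_sum_left ip_scale_left ip_sum_scale_right sum_distrib_left ..
  also have "\<dots> = (\<Sum>l\<in>L. \<Sum>k\<in>L. cnj (c l) * (c k * (if l = k then 1 else 0)))"
  proof (intro sum.cong refl)
    fix k l assume "k \<in> L" "l \<in> L"
    then have "k < card I" "l < card I" using assms by auto
    then show "cnj (c k) * (c l * ip I (w k) (w l)) = cnj (c k) * (c l * (if k = l then 1 else 0))"
      by (simp add: eigbasis_ip)
  qed
  also have "\<dots> = (\<Sum>l\<in>L. cnj (c l) * c l)"
    unfolding sum_distrib_left[symmetric]
    using fL by (intro sum.cong refl arg_cong2[where f = "(*)"]) (simp_all add: sum_mult_delta)
  also have "\<dots> = of_real (\<Sum>l\<in>L. (cmod (c l))\<^sup>2)"
    unfolding of_real_sum complex_norm_square by (intro sum.cong refl mult.commute)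
  finally show ?thesis
    unfolding ip_self of_real_eq_iff .
qed

lemma eigbasis_parseval: "(\<Sum>l<card I. (cmod (ip I (w l) v))\<^sup>2) = nsq I v"
proof -
  have "nsq I v = nsq I (\<lambda>i. \<Sum>l<card I. ip I (w l) v * w l i)"
  proof (rule nsq_cong)
    fix i assume "i \<in> I"
    from eigbasis_expand[OF this, of v] show "v i = (\<Sum>l<card I. ip I (w l) v * w l i)" .
  qed
  also have "\<dots> = (\<Sum>l<card I. (cmod (ip I (w l) v))\<^sup>2)"
    by (rule nsq_orthonormal_sum) simp
  finally show ?thesis ..
qed

end

section \<open>Resolvents and the smoothed eigenvalue count\<close>

text \<open>The resolvent \<open>(K - z)^-1\<close> in spectral form. The choice is made among
  matrices rather than bases and depends on \<open>K\<close> only through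
  \<open>eigbasis Y K\<close>; this makes \<open>res_cong\<close> immediate, by which frozen minors
  are identified with a fixed matrix.\<close>

definition res :: "'i set \<Rightarrow> ('i \<Rightarrow> 'i \<Rightarrow> complex) \<Rightarrow> complex \<Rightarrow> 'i \<Rightarrow> 'i \<Rightarrow> complex" where
  "res Y K z = (SOME G. \<exists>w \<mu>. eigbasis Y K w \<mu> \<and>
     G = (\<lambda>i j. \<Sum>l<card Y. w l i * cnj (w l j) / (complex_of_real (\<mu> l) - z)))"

text \<open>A smoothed count of the eigenvalues within distance \<open>Im z\<close> of \<open>Re z\<close>; it is a measurable function
  of the matrix entries, unlike (a priori) eigenbases chosen by Hilbert choice.\<close>

definition Phi :: "'i set \<Rightarrow> ('i \<Rightarrow> 'i \<Rightarrow> complex) \<Rightarrow> complex \<Rightarrow> real" where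
  "Phi Y K z = Im z * (\<Sum>i\<in>Y. Im (res Y K z i i))"

text \<open>The vector \<open>R h\<close> of the Schur complement formula: it is used with
  \<open>e\<close> outside \<open>Y\<close>, so that \<open>h\<close> is the column deleted along
  with \<open>e\<close>.\<close>

definition rcol :: "'i set \<Rightarrow> ('i \<Rightarrow> 'i \<Rightarrow> complex) \<Rightarrow> complex \<Rightarrow> 'i \<Rightarrow> 'i \<Rightarrow> complex" where
  "rcol Y K z e p = (\<Sum>q\<in>Y. res Y K z p q * K q e)"

lemma herm_cnj: "herm Y K \<Longrightarrow> i \<in> Y \<Longrightarrow> j \<in> Y \<Longrightarrow> cnj (K i j) = K j i"
  unfolding herm_def by metis

lemma herm_subset: "herm Y K \<Longrightarrow> Y' \<subseteq> Y \<Longrightarrow> herm Y' K"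
  unfolding herm_def by blast

lemma res_eigbasis:
  assumes "finite Y" "herm Y K"
  obtains w \<mu> where "eigbasis Y K w \<mu>"
    "\<And>i j. res Y K z i j = (\<Sum>l<card Y. w l i * cnj (w l j) / (complex_of_real (\<mu> l) - z))"
proof -
  obtain w \<mu> where "eigbasis Y K w \<mu>" using hermitian_eigbasis[OF assms] by blast
  then have "\<exists>G w \<mu>. eigbasis Y K w \<mu> \<and>
     G = (\<lambda>i j. \<Sum>l<card Y. w l i * cnj (w l j) / (complex_of_real (\<mu> l) - z))" by blast
  from someI_ex[OF this] obtain w \<mu> where "eigbasis Y K w \<mu>"
     "res Y K z = (\<lambda>i j. \<Sum>l<card Y. w l i * cnj (w l j) / (complex_of_real (\<mu> l) - z))"
    unfolding res_def by blast
  then show ?thesis by (intro that[of w \<mu>]) auto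
qed

lemma eigbasis_cong:
  assumes "\<And>i j. i \<in> Y \<Longrightarrow> j \<in> Y \<Longrightarrow> K i j = K' i j"
  shows "eigbasis Y K w \<mu> = eigbasis Y K' w \<mu>"
  using assms by (simp add: eigbasis_def mv_def)

lemma res_cong:
  assumes "\<And>i j. i \<in> Y \<Longrightarrow> j \<in> Y \<Longrightarrow> K i j = K' i j"
  shows "res Y K z = res Y K' z"
  unfolding res_def using eigbasis_cong[of Y K K'] assms by simp

lemma Phi_cong:
  assumes "\<And>i j. i \<in> Y \<Longrightarrow> j \<in> Y \<Longrightarrow> K i j = K' i j"
  shows "Phi Y K z = Phi Y K' z"
  unfolding Phi_def using res_cong[of Y K K'] assms by simp

lemma res_right:
  assumes Y: "finite Y" "herm Y K" and z: "Im z > 0" and ij: "i \<in> Y" "j \<in> Y"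
  shows "(\<Sum>k\<in>Y. K i k * res Y K z k j) - z * res Y K z i j = (if i = j then 1 else 0)"
proof -
  obtain w \<mu> where eb: "eigbasis Y K w \<mu>" and
    res: "\<And>i j. res Y K z i j = (\<Sum>l<card Y. w l i * cnj (w l j) / (complex_of_real (\<mu> l) - z))"
    using res_eigbasis[OF Y] by blast
  have nz: "complex_of_real (\<mu> l) - z \<noteq> 0" for l using z by (auto simp: complex_eq_iff)
  have "(\<Sum>k\<in>Y. K i k * res Y K z k j)
      = (\<Sum>l<card Y. mv Y K (w l) i * (cnj (w l j) / (complex_of_real (\<mu> l) - z)))"
    unfolding res mv_def sum_distrib_left sum_distrib_right
    by (subst sum.swap) (simp add: mult.assoc)
  also have "\<dots> = (\<Sum>l<card Y. \<mu> l * w l i * (cnj (w l j) / (complex_of_real (\<mu> l) - z)))"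
    using ij by (intro sum.cong refl) (simp add: eigbasis_mv[OF Y(1) eb])
  finally have "(\<Sum>k\<in>Y. K i k * res Y K z k j) - z * res Y K z i j
      = (\<Sum>l<card Y. \<mu> l * w l i * (cnj (w l j) / (complex_of_real (\<mu> l) - z))
           - z * (w l i * cnj (w l j) / (complex_of_real (\<mu> l) - z)))"
    unfolding res by (simp add: sum_subtractf sum_distrib_left)
  also have "\<dots> = (\<Sum>l<card Y. w l i * cnj (w l j))"
    using nz by (intro sum.cong refl) (simp add: divide_simps, simp add: algebra_simps)
  also have "\<dots> = (if i = j then 1 else 0)"
    by (rule eigbasis_complete[OF Y(1) eb ij])
  finally show ?thesis .
qed

text \<open>Hermiticity turns the conjugated basis vectors into left eigenvectors. Inverses on both
  sides are wanted because the formulas for rows and for columns multiply by the resolvent from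
  opposite sides.\<close>

lemma res_left:
  assumes Y: "finite Y" "herm Y K" and z: "Im z > 0" and ij: "i \<in> Y" "j \<in> Y"
  shows "(\<Sum>k\<in>Y. res Y K z i k * K k j) - z * res Y K z i j = (if i = j then 1 else 0)"
proof -
  obtain w \<mu> where eb: "eigbasis Y K w \<mu>" and
    res: "\<And>i j. res Y K z i j = (\<Sum>l<card Y. w l i * cnj (w l j) / (complex_of_real (\<mu> l) - z))"
    using res_eigbasis[OF Y] by blast
  have nz: "complex_of_real (\<mu> l) - z \<noteq> 0" for l using z by (auto simp: complex_eq_iff)
  have wj: "(\<Sum>k\<in>Y. cnj (w l k) * K k j) = \<mu> l * cnj (w l j)" if "l < card Y" for l
  proof -
    have "(\<Sum>k\<in>Y. cnj (w l k) * K k j) = cnj (mv Y K (w l) j)"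
      unfolding mv_def cnj_sum
      by (intro sum.cong refl) (simp add: herm_cnj[OF Y(2)] ij mult.commute)
    then show ?thesis using eigbasis_mv[OF Y(1) eb that ij(2)] by simp
  qed
  have "(\<Sum>k\<in>Y. res Y K z i k * K k j)
      = (\<Sum>l<card Y. (\<Sum>k\<in>Y. cnj (w l k) * K k j) * (w l i / (complex_of_real (\<mu> l) - z)))"
    unfolding res sum_distrib_left sum_distrib_right
    by (subst sum.swap) (simp add: mult_ac)
  also have "\<dots> = (\<Sum>l<card Y. \<mu> l * cnj (w l j) * (w l i / (complex_of_real (\<mu> l) - z)))"
    by (intro sum.cong refl) (simp add: wj)
  finally have "(\<Sum>k\<in>Y. res Y K z i k * K k j) - z * res Y K z i j
      = (\<Sum>l<card Y. \<mu> l * cnj (w l j) * (w l i / (complex_of_real (\<mu> l) - z))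
           - z * (w l i * cnj (w l j) / (complex_of_real (\<mu> l) - z)))"
    unfolding res by (simp add: sum_subtractf sum_distrib_left)
  also have "\<dots> = (\<Sum>l<card Y. w l i * cnj (w l j))"
    using nz by (intro sum.cong refl) (simp add: divide_simps, simp add: algebra_simps)
  also have "\<dots> = (if i = j then 1 else 0)"
    by (rule eigbasis_complete[OF Y(1) eb ij])
  finally show ?thesis .
qed

lemma Im_inverse_shift: "Im (1 / (complex_of_real m - z)) = Im z / (cmod (complex_of_real m - z))\<^sup>2"
  by (simp add: Im_divide cmod_power2)

text \<open>Ward identity: both sides are the sum of \<open>|w l e|^2\<close> against the Poisson
  kernel \<open>Im z / |\<mu> l - z|^2\<close>.\<close>

lemma res_col_nsq:
  assumes Y: "finite Y" "herm Y K" and z: "Im z > 0" and e: "e \<in> Y"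
  shows "Im (res Y K z e e) = Im z * nsq Y (\<lambda>i. res Y K z i e)"
proof -
  obtain w \<mu> where eb: "eigbasis Y K w \<mu>" and
    res: "\<And>i j. res Y K z i j = (\<Sum>l<card Y. w l i * cnj (w l j) / (complex_of_real (\<mu> l) - z))"
    using res_eigbasis[OF Y] by blast
  have "nsq Y (\<lambda>i. res Y K z i e) = nsq Y (\<lambda>i. \<Sum>l<card Y. (cnj (w l e) / (complex_of_real (\<mu> l) - z)) * w l i)"
    unfolding res by (simp add: mult.commute)
  also have "\<dots> = (\<Sum>l<card Y. (cmod (w l e))\<^sup>2 / (cmod (complex_of_real (\<mu> l) - z))\<^sup>2)"
    by (subst nsq_orthonormal_sum[OF Y(1) eb]) (simp_all add: norm_divide power_divide)
  finally have n: "Im z * nsq Y (\<lambda>i. res Y K z i e)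
      = (\<Sum>l<card Y. (cmod (w l e))\<^sup>2 * (Im z / (cmod (complex_of_real (\<mu> l) - z))\<^sup>2))"
    by (simp add: sum_distrib_left mult.commute)
  have "res Y K z e e = (\<Sum>l<card Y. complex_of_real ((cmod (w l e))\<^sup>2) * (1 / (complex_of_real (\<mu> l) - z)))"
    unfolding res complex_norm_square by simp
  then have "Im (res Y K z e e) = (\<Sum>l<card Y. (cmod (w l e))\<^sup>2 * Im (1 / (complex_of_real (\<mu> l) - z)))"
    by (simp only: Im_sum times_complex.sel(2) Re_complex_of_real Im_complex_of_real mult_zero_left add_0_right)
  then show ?thesis unfolding n Im_inverse_shift .
qed

text \<open>For \<open>z = E + i r\<close>, an eigenvalue at distance \<open>x\<close> from
  \<open>E\<close> counts with weight \<open>r^2 / (x^2 + r^2)\<close>, a smooth substitute for the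
  indicator of the window.\<close>

lemma Phi_eq:
  assumes Y: "finite Y" and eb: "eigbasis Y K w \<mu>" and
    res: "\<And>i j. res Y K z i j = (\<Sum>l<card Y. w l i * cnj (w l j) / (complex_of_real (\<mu> l) - z))"
  shows "Phi Y K z = (\<Sum>l<card Y. (Im z)\<^sup>2 / (cmod (complex_of_real (\<mu> l) - z))\<^sup>2)"
proof -
  have "(\<Sum>i\<in>Y. res Y K z i i) = (\<Sum>l<card Y. ip Y (w l) (w l) * (1 / (complex_of_real (\<mu> l) - z)))"
    unfolding res ip_def sum_distrib_right by (subst sum.swap) (simp add: mult.commute)
  also have "\<dots> = (\<Sum>l<card Y. 1 / (complex_of_real (\<mu> l) - z))"
    by (intro sum.cong refl) (simp add: eigbasis_ip[OF Y eb])
  finally have "Im (\<Sum>i\<in>Y. res Y K z i i) = (\<Sum>l<card Y. Im z / (cmod (complex_of_real (\<mu> l) - z))\<^sup>2)"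
    by (simp only: Im_sum Im_inverse_shift)
  then show ?thesis
    unfolding Phi_def Im_sum[symmetric] by (simp add: sum_distrib_left power2_eq_square)
qed

lemma rcol_nsq:
  assumes Y: "finite Y" and eb: "eigbasis Y K w \<mu>" and
    res: "\<And>i j. res Y K z i j = (\<Sum>l<card Y. w l i * cnj (w l j) / (complex_of_real (\<mu> l) - z))"
  shows "nsq Y (rcol Y K z e) = (\<Sum>l<card Y. (cmod (ip Y (w l) (\<lambda>q. K q e) / (complex_of_real (\<mu> l) - z)))\<^sup>2)"
proof -
  have "rcol Y K z e p = (\<Sum>l<card Y. (ip Y (w l) (\<lambda>q. K q e) / (complex_of_real (\<mu> l) - z)) * w l p)" for p
    unfolding rcol_def res ip_def sum_distrib_right sum_divide_distrib
    by (subst sum.swap) (simp add: mult_ac)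
  then have "nsq Y (rcol Y K z e) = nsq Y (\<lambda>p. \<Sum>l<card Y. (ip Y (w l) (\<lambda>q. K q e) / (complex_of_real (\<mu> l) - z)) * w l p)"
    by (intro nsq_cong)
  then show ?thesis by (simp only: nsq_orthonormal_sum[OF Y eb order_refl])
qed

section \<open>Schur complement identities for the deletion of one index\<close>

context
  fixes Y :: "'i set" and K z e G R a col row
  assumes Y: "finite Y" "herm Y K" and z: "Im z > 0" and e: "e \<in> Y"
  defines "G \<equiv> res Y K z" and "R \<equiv> res (Y - {e}) K z" and "a \<equiv> res Y K z e e"
    and "col \<equiv> rcol (Y - {e}) K z e"
    and "row \<equiv> (\<lambda>p. \<Sum>q\<in>Y - {e}. K e q * res (Y - {e}) K z q p)"
begin

lemma Y': "finite (Y - {e})" "herm (Y - {e}) K"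
  using Y by (auto intro: herm_subset)

text \<open>Multiplying the rows of \<open>(K - z) G = 1\<close> other than \<open>e\<close> from
  the left by the resolvent of the minor solves for these rows of \<open>G\<close> in terms of row
  \<open>e\<close>.\<close>

lemma schur_left:
  assumes p: "p \<in> Y - {e}" and j: "j \<in> Y"
  shows "G p j = (if j = e then 0 else R p j) - col p * G e j"
proof -
  have eq: "(\<Sum>k\<in>Y - {e}. K i k * G k j) - z * G i j = (if i = j then 1 else 0) - K i e * G e j"
    if "i \<in> Y - {e}" for i
    using res_right[OF Y z, of i j] that j e
    by (subst (asm) sum.remove[OF Y(1) e]) (auto simp: G_def algebra_simps)
  have "(\<Sum>i\<in>Y - {e}. R p i * ((\<Sum>k\<in>Y - {e}. K i k * G k j) - z * G i j))
      = (\<Sum>i\<in>Y - {e}. R p i * (if i = j then 1 else 0)) - col p * G e j"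
  proof -
    have "(\<Sum>i\<in>Y - {e}. R p i * ((\<Sum>k\<in>Y - {e}. K i k * G k j) - z * G i j))
      = (\<Sum>i\<in>Y - {e}. R p i * ((if i = j then 1 else 0) - K i e * G e j))"
      by (intro sum.cong refl) (simp only: eq)
    then show ?thesis
      by (simp only: right_diff_distrib sum_subtractf sum_distrib_right col_def rcol_def R_def mult.assoc)
  qed
  also have "(\<Sum>i\<in>Y - {e}. R p i * (if i = j then 1 else 0)) = (if j = e then 0 else R p j)"
    using Y'(1) j by (subst sum_mult_delta) auto
  also have "(\<Sum>i\<in>Y - {e}. R p i * ((\<Sum>k\<in>Y - {e}. K i k * G k j) - z * G i j))
      = (\<Sum>k\<in>Y - {e}. ((\<Sum>i\<in>Y - {e}. R p i * K i k) - z * R p k) * G k j)"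
  proof -
    have "(\<Sum>i\<in>Y - {e}. R p i * (\<Sum>k\<in>Y - {e}. K i k * G k j))
        = (\<Sum>k\<in>Y - {e}. (\<Sum>i\<in>Y - {e}. R p i * K i k) * G k j)"
      unfolding sum_distrib_left sum_distrib_right by (subst sum.swap) (simp add: mult_ac)
    then show ?thesis
      by (simp add: right_diff_distrib left_diff_distrib sum_subtractf mult_ac)
  qed
  also have "\<dots> = (\<Sum>k\<in>Y - {e}. (if p = k then 1 else 0) * G k j)"
    unfolding R_def by (intro sum.cong refl) (simp only: res_left[OF Y' z p])
  also have "\<dots> = G p j"
    using Y'(1) p by (subst sum_mult_delta) auto
  finally show ?thesis .
qed

lemma schur_right:
  assumes p: "p \<in> Y - {e}" and i: "i \<in> Y"
  shows "G i p = (if i = e then 0 else R i p) - G i e * row p"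
proof -
  have eq: "(\<Sum>k\<in>Y - {e}. G i k * K k j) - z * G i j = (if i = j then 1 else 0) - G i e * K e j"
    if "j \<in> Y - {e}" for j
  proof -
    have "(\<Sum>k\<in>Y. G i k * K k j) = G i e * K e j + (\<Sum>k\<in>Y - {e}. G i k * K k j)"
      by (rule sum.remove[OF Y(1) e])
    then show ?thesis
      using res_left[OF Y z, of i j] that i e by (auto simp: G_def algebra_simps)
  qed
  have "(\<Sum>j\<in>Y - {e}. ((\<Sum>k\<in>Y - {e}. G i k * K k j) - z * G i j) * R j p)
      = (\<Sum>j\<in>Y - {e}. (if i = j then 1 else 0) * R j p) - G i e * row p"
  proof -
    have "(\<Sum>j\<in>Y - {e}. ((\<Sum>k\<in>Y - {e}. G i k * K k j) - z * G i j) * R j p)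
      = (\<Sum>j\<in>Y - {e}. ((if i = j then 1 else 0) - G i e * K e j) * R j p)"
      by (intro sum.cong refl) (simp only: eq)
    then show ?thesis
      by (simp only: left_diff_distrib sum_subtractf sum_distrib_left row_def R_def mult.assoc)
  qed
  also have "(\<Sum>j\<in>Y - {e}. (if i = j then 1 else 0) * R j p) = (if i = e then 0 else R i p)"
    using Y'(1) i by (subst sum_mult_delta) auto
  also have "(\<Sum>j\<in>Y - {e}. ((\<Sum>k\<in>Y - {e}. G i k * K k j) - z * G i j) * R j p)
      = (\<Sum>k\<in>Y - {e}. G i k * ((\<Sum>j\<in>Y - {e}. K k j * R j p) - z * R k p))"
  proof -
    have "(\<Sum>j\<in>Y - {e}. (\<Sum>k\<in>Y - {e}. G i k * K k j) * R j p)
        = (\<Sum>k\<in>Y - {e}. G i k * (\<Sum>j\<in>Y - {e}. K k j * R j p))"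
      unfolding sum_distrib_left sum_distrib_right by (subst sum.swap) (simp add: mult_ac)
    then show ?thesis
      by (simp add: right_diff_distrib left_diff_distrib sum_subtractf mult_ac)
  qed
  also have "\<dots> = (\<Sum>k\<in>Y - {e}. G i k * (if k = p then 1 else 0))"
    unfolding R_def by (intro sum.cong refl) (simp only: res_right[OF Y' z _ p])
  also have "\<dots> = G i p"
    using Y'(1) p by (subst sum_mult_delta) auto
  finally show ?thesis .
qed

text \<open>The entry of \<open>(K - z) G = 1\<close> at \<open>(e, e)\<close> after the rest of
  column \<open>e\<close> has been eliminated. The product form also shows that \<open>a\<close> is
  nonzero.\<close>

lemma schur_diag: "a * (K e e - z - (\<Sum>q\<in>Y - {e}. K e q * col q)) = 1"
proof -
  have "K e e * a + (\<Sum>k\<in>Y - {e}. K e k * G k e) - z * a = 1"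
    using res_right[OF Y z e e] by (subst (asm) sum.remove[OF Y(1) e]) (simp add: a_def G_def)
  moreover have "(\<Sum>k\<in>Y - {e}. K e k * G k e) = - a * (\<Sum>q\<in>Y - {e}. K e q * col q)"
    unfolding sum_distrib_left
    by (intro sum.cong refl, subst schur_left[OF _ e]) (auto simp: a_def G_def)
  ultimately show ?thesis by (simp add: algebra_simps)
qed

text \<open>\<open>row\<close> is the conjugate of the adjoint resolvent applied to
  \<open>h\<close>. In the eigenbasis of the minor its coefficients differ from those of
  \<open>R h\<close> only by conjugated denominators, which preserves the norm.\<close>

lemma nsq_row: "nsq (Y - {e}) row = nsq (Y - {e}) col"
proof -
  let ?Y = "Y - {e}"
  obtain w \<mu> where eb: "eigbasis ?Y K w \<mu>" and
    res: "\<And>i j. res ?Y K z i j = (\<Sum>l<card ?Y. w l i * cnj (w l j) / (complex_of_real (\<mu> l) - z))"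
    using res_eigbasis[OF Y'] by blast
  have "cnj (row p) = (\<Sum>l<card ?Y. (ip ?Y (w l) (\<lambda>q. K q e) / cnj (complex_of_real (\<mu> l) - z)) * w l p)"
    if "p \<in> ?Y" for p
  proof -
    have "cnj (row p) = (\<Sum>q\<in>?Y. K q e * cnj (res ?Y K z q p))"
      unfolding row_def cnj_sum by (intro sum.cong refl) (simp add: herm_cnj[OF Y(2) e])
    then show ?thesis
      unfolding res ip_def sum_distrib_right sum_divide_distrib cnj_sum sum_distrib_left
      by (subst sum.swap) (simp add: mult_ac)
  qed
  then have "nsq ?Y (\<lambda>p. cnj (row p)) = nsq ?Y (\<lambda>p. \<Sum>l<card ?Y. (ip ?Y (w l) (\<lambda>q. K q e) / cnj (complex_of_real (\<mu> l) - z)) * w l p)"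
    by (rule nsq_cong)
  also have "\<dots> = (\<Sum>l<card ?Y. (cmod (ip ?Y (w l) (\<lambda>q. K q e) / cnj (complex_of_real (\<mu> l) - z)))\<^sup>2)"
    by (rule nsq_orthonormal_sum[OF Y'(1) eb order_refl])
  also have "\<dots> = nsq ?Y col"
    unfolding col_def rcol_nsq[OF Y'(1) eb res] by (simp add: norm_divide complex_mod_cnj del: complex_cnj_diff)
  finally show ?thesis by (simp add: nsq_def)
qed

text \<open>Column \<open>e\<close> of \<open>G\<close> is \<open>a (1, - R h)\<close>, so the Ward
  identity reads \<open>Im a = Im z |a|^2 (1 + |R h|^2)\<close>; then \<open>Im a \<le> |a|\<close>,
  and one factor \<open>|a|\<close> cancels.\<close>

lemma res_diag_bound: "Im z * cmod a * (1 + nsq (Y - {e}) col) \<le> 1"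
proof -
  have "nsq Y (\<lambda>i. G i e) = (cmod a)\<^sup>2 + nsq (Y - {e}) (\<lambda>i. - a * col i)"
    unfolding nsq_def by (subst sum.remove[OF Y(1) e])
      (auto intro!: sum.cong simp: schur_left[OF _ e] G_def[symmetric] a_def norm_mult)
  also have "\<dots> = (cmod a)\<^sup>2 * (1 + nsq (Y - {e}) col)"
    by (simp only: nsq_scale norm_minus_cancel) (simp add: algebra_simps)
  finally have "Im a = Im z * ((cmod a)\<^sup>2 * (1 + nsq (Y - {e}) col))"
    using res_col_nsq[OF Y z e] by (simp add: a_def G_def)
  then have "cmod a * (Im z * cmod a * (1 + nsq (Y - {e}) col)) \<le> cmod a * 1"
    using abs_Im_le_cmod[of a] by (simp add: power2_eq_square mult_ac)
  moreover have "cmod a > 0" using schur_diag by auto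
  ultimately show ?thesis by (simp only: mult_le_cancel_left_pos)
qed

lemma res_diag_le: "Im z * Im a \<le> 1 / (1 + nsq (Y - {e}) col)"
proof -
  have "Im z * Im a \<le> Im z * cmod a"
    using z abs_Im_le_cmod[of a] by (intro mult_left_mono) auto
  also have "\<dots> \<le> 1 / (1 + nsq (Y - {e}) col)"
    using res_diag_bound nsq_nonneg[of "Y - {e}" col] by (simp add: pos_le_divide_eq add_pos_nonneg)
  finally show ?thesis .
qed

text \<open>Counterpart of eigenvalue interlacing. The traces of the two resolvents differ by
  \<open>a (1 + h* R^2 h)\<close>, whose modulus is at most \<open>|a| (1 + |R h|^2)\<close>, and
  this is at most \<open>1 / Im z\<close>.\<close>

lemma Phi_remove_le: "Phi Y K z \<le> Phi (Y - {e}) K z + 1"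
proof -
  let ?Y = "Y - {e}"
  have G: "G i i = R i i + a * (col i * row i)" if "i \<in> ?Y" for i
    using that schur_left[of i i] schur_right[of i e] e by (simp add: a_def G_def mult_ac)
  have "(\<Sum>i\<in>Y. G i i) = a + (\<Sum>i\<in>?Y. R i i) + a * (\<Sum>i\<in>?Y. col i * row i)"
    by (subst sum.remove[OF Y(1) e]) (simp add: G sum.distrib sum_distrib_left a_def G_def[symmetric])
  then have "(\<Sum>i\<in>Y. Im (G i i)) = (\<Sum>i\<in>?Y. Im (R i i)) + Im (a * (1 + (\<Sum>i\<in>?Y. col i * row i)))"
    unfolding Im_sum[symmetric] by (simp add: algebra_simps)
  also have "Im (a * (1 + (\<Sum>i\<in>?Y. col i * row i))) \<le> cmod a * (1 + nsq ?Y col)"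
  proof -
    have "cmod (\<Sum>i\<in>?Y. col i * row i) \<le> (\<Sum>i\<in>?Y. cmod (col i) * cmod (row i))"
      by (intro order_trans[OF norm_sum]) (simp add: norm_mult)
    also have "\<dots> \<le> (\<Sum>i\<in>?Y. ((cmod (col i))\<^sup>2 + (cmod (row i))\<^sup>2) / 2)"
      using sum_squares_bound[of "cmod (col _)" "cmod (row _)"] by (intro sum_mono) (simp add: field_simps)
    also have "\<dots> = (nsq ?Y col + nsq ?Y row) / 2"
      unfolding nsq_def by (simp add: sum.distrib sum_divide_distrib[symmetric])
    finally have "cmod (\<Sum>i\<in>?Y. col i * row i) \<le> nsq ?Y col" unfolding nsq_row by simp
    then have "cmod (1 + (\<Sum>i\<in>?Y. col i * row i)) \<le> 1 + nsq ?Y col"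
      using norm_triangle_ineq[of 1 "\<Sum>i\<in>?Y. col i * row i"] by simp
    then have "cmod (a * (1 + (\<Sum>i\<in>?Y. col i * row i))) \<le> cmod a * (1 + nsq ?Y col)"
      unfolding norm_mult by (intro mult_left_mono) auto
    then show ?thesis using abs_Im_le_cmod[of "a * (1 + (\<Sum>i\<in>?Y. col i * row i))"] by linarith
  qed
  finally have "Im z * (\<Sum>i\<in>Y. Im (G i i)) \<le> Im z * ((\<Sum>i\<in>?Y. Im (R i i)) + cmod a * (1 + nsq ?Y col))"
    using z by simp
  also have "\<dots> \<le> Im z * (\<Sum>i\<in>?Y. Im (R i i)) + 1"
    using res_diag_bound by (simp add: distrib_left mult_ac)
  finally show ?thesis by (simp add: Phi_def G_def R_def)
qed

end

lemma Phi_upper: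
  assumes Y: "finite Y" "herm Y K" and z: "Im z > 0"
  shows "Phi Y K z \<le> (\<Sum>e\<in>Y. 1 / (1 + nsq (Y - {e}) (rcol (Y - {e}) K z e)))"
  unfolding Phi_def sum_distrib_left
  by (intro sum_mono res_diag_le[OF Y z])

text \<open>Inside the window the Poisson weight is at least \<open>1/2\<close>. The basis is
  obtained together with the bound, as the one behind the value of \<open>res\<close>, and may
  therefore change with \<open>E\<close> and \<open>r\<close>.\<close>

lemma eig_count_le_Phi:
  assumes Y: "finite Y" "herm Y K" and r: "r > 0"
  obtains w \<mu> where "eigbasis Y K w \<mu>"
    "real (card {l \<in> {..<card Y}. \<bar>\<mu> l - E\<bar> \<le> r}) \<le> 2 * Phi Y K (Complex E r)"
proof -
  obtain w \<mu> where eb: "eigbasis Y K w \<mu>" and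
    res: "\<And>i j. res Y K (Complex E r) i j = (\<Sum>l<card Y. w l i * cnj (w l j) / (complex_of_real (\<mu> l) - Complex E r))"
    using res_eigbasis[OF Y] by blast
  let ?W = "{l \<in> {..<card Y}. \<bar>\<mu> l - E\<bar> \<le> r}"
  have "real (card ?W) / 2 = (\<Sum>l\<in>?W. 1 / 2)" by simp
  also have "\<dots> \<le> (\<Sum>l\<in>?W. r\<^sup>2 / (cmod (complex_of_real (\<mu> l) - Complex E r))\<^sup>2)"
  proof (intro sum_mono)
    fix l assume "l \<in> ?W"
    then have "(\<mu> l - E)\<^sup>2 \<le> r\<^sup>2" using r by (simp add: power2_le_iff_abs_le)
    then have "(cmod (complex_of_real (\<mu> l) - Complex E r))\<^sup>2 \<le> 2 * r\<^sup>2" by (simp add: cmod_power2)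
    moreover have "(cmod (complex_of_real (\<mu> l) - Complex E r))\<^sup>2 > 0"
      using r by (simp add: cmod_power2 sum_power2_gt_zero_iff)
    ultimately show "1 / 2 \<le> r\<^sup>2 / (cmod (complex_of_real (\<mu> l) - Complex E r))\<^sup>2"
      by (simp add: field_simps)
  qed
  also have "\<dots> \<le> (\<Sum>l<card Y. r\<^sup>2 / (cmod (complex_of_real (\<mu> l) - Complex E r))\<^sup>2)"
    by (rule sum_mono2) auto
  also have "\<dots> = Phi Y K (Complex E r)"
    using Phi_eq[OF Y(1) eb res] by simp
  finally show ?thesis by (intro that[OF eb]) simp
qed

section \<open>Eigenvalue counts of the random matrix\<close>

definition GS :: "nat \<Rightarrow> (nat \<Rightarrow> nat \<Rightarrow> real) \<Rightarrow> (nat \<times> nat \<times> bool \<Rightarrow> real) measure" where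
  "GS D s = PiM ({..<D} \<times> {..<D} \<times> UNIV) (\<lambda>(i,j,b). gN (s i j))"

definition aent :: "(nat \<times> nat \<times> bool \<Rightarrow> real) \<Rightarrow> nat \<Rightarrow> nat \<Rightarrow> complex" where
  "aent \<omega> i j = Complex (\<omega> (i,j,False)) (\<omega> (i,j,True))"

definition hent :: "(nat \<Rightarrow> nat \<Rightarrow> complex) \<Rightarrow> (nat \<times> nat \<times> bool \<Rightarrow> real) \<Rightarrow> nat \<Rightarrow> nat \<Rightarrow> complex" where
  "hent H0 \<omega> i j = H0 i j + (aent \<omega> i j + cnj (aent \<omega> j i)) / sqrt 2"

lemma herm_hent:
  assumes "herm Y H0"
  shows "herm Y (hent H0 \<omega>)"
  unfolding herm_def
proof (intro ballI)
  fix i j assume "i \<in> Y" "j \<in> Y"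
  then show "hent H0 \<omega> i j = cnj (hent H0 \<omega> j i)"
    by (simp add: hent_def herm_cnj[OF assms] add.commute)
qed

lemma prob_space_GS: "(\<And>i j. s i j > 0) \<Longrightarrow> prob_space (GS D s)"
  unfolding GS_def by (intro prob_space_PiM) (auto simp: prob_space_gN)

lemma GS_component:
  assumes "i < D" "j < D"
  shows "(\<lambda>\<omega>. \<omega> (i,j,b)) \<in> borel_measurable (GS D s)"
proof -
  have "(\<lambda>x. x (i,j,b)) \<in> measurable (GS D s) ((\<lambda>(i,j,b::bool). gN (s i j)) (i,j,b))"
    unfolding GS_def by (rule measurable_component_singleton) (use assms in auto)
  then show ?thesis by (simp add: measurable_cong_sets[OF refl sets_gN])
qed

lemma aent_measurable:
  assumes "i < D" "j < D"
  shows "(\<lambda>\<omega>. aent \<omega> i j) \<in> borel_measurable (GS D s)"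
proof -
  note GS_component[OF assms, measurable]
  show ?thesis unfolding aent_def Complex_eq by measurable
qed

lemma hent_measurable: "i < D \<Longrightarrow> j < D \<Longrightarrow> (\<lambda>\<omega>. hent H0 \<omega> i j) \<in> borel_measurable (GS D s)"
proof -
  assume "i < D" "j < D"
  then have [measurable]: "(\<lambda>\<omega>. aent \<omega> i j) \<in> borel_measurable (GS D s)"
    "(\<lambda>\<omega>. aent \<omega> j i) \<in> borel_measurable (GS D s)" by (simp_all add: aent_measurable)
  have [measurable]: "cnj \<in> borel_measurable borel"
    by (intro borel_measurable_continuous_onI continuous_intros)
  show ?thesis unfolding hent_def by measurable
qed

text \<open>Induction on \<open>Y\<close>: after insertion of \<open>e\<close> the Schur formulas
  express the new resolvent entries rationally through the matrix entries and the old resolvent, so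
  the choice in \<open>res\<close> does no harm.\<close>

lemma res_measurable:
  assumes "finite Y" and herm: "\<And>\<omega>. herm Y (K \<omega>)" and z: "Im z > 0"
    and K: "\<And>i j. i \<in> Y \<Longrightarrow> j \<in> Y \<Longrightarrow> (\<lambda>\<omega>. K \<omega> i j) \<in> borel_measurable M"
    and ij: "i \<in> Y" "j \<in> Y"
  shows "(\<lambda>\<omega>. res Y (K \<omega>) z i j) \<in> borel_measurable M"
  using assms(1,2) K ij
proof (induction Y arbitrary: i j rule: finite_induct)
  case (insert e Y)
  have Y: "insert e Y - {e} = Y" using insert.hyps by auto
  have fin: "finite (insert e Y)" using insert.hyps by simp
  note hm = insert.prems(1) and Km = insert.prems(2)
  have R: "(\<lambda>\<omega>. res Y (K \<omega>) z p q) \<in> borel_measurable M" if "p \<in> Y" "q \<in> Y" for p q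
    by (rule insert.IH) (use that hm Km herm_subset[OF hm, of Y] in auto)
  have col: "(\<lambda>\<omega>. rcol Y (K \<omega>) z e p) \<in> borel_measurable M" if "p \<in> Y" for p
    unfolding rcol_def using that by (intro borel_measurable_sum borel_measurable_times R Km) auto
  have row: "(\<lambda>\<omega>. \<Sum>q\<in>Y. K \<omega> e q * res Y (K \<omega>) z q p) \<in> borel_measurable M" if "p \<in> Y" for p
    using that by (intro borel_measurable_sum borel_measurable_times R Km) auto
  have a_eq: "res (insert e Y) (K \<omega>) z e e = 1 / (K \<omega> e e - z - (\<Sum>q\<in>Y. K \<omega> e q * rcol Y (K \<omega>) z e q))" for \<omega>
  proof -
    have "res (insert e Y) (K \<omega>) z e e * (K \<omega> e e - z - (\<Sum>q\<in>Y. K \<omega> e q * rcol Y (K \<omega>) z e q)) = 1"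
      using schur_diag[OF fin hm z insertI1, of \<omega>] unfolding Y .
    then show ?thesis by (metis mult_not_zero nonzero_eq_divide_eq one_neq_zero)
  qed
  have a: "(\<lambda>\<omega>. res (insert e Y) (K \<omega>) z e e) \<in> borel_measurable M"
    unfolding a_eq
    by (intro borel_measurable_divide borel_measurable_diff borel_measurable_sum borel_measurable_times Km col
        borel_measurable_const) auto
  have left: "res (insert e Y) (K \<omega>) z p j = (if j = e then 0 else res Y (K \<omega>) z p j)
      - rcol Y (K \<omega>) z e p * res (insert e Y) (K \<omega>) z e j" if "p \<in> Y" "j \<in> insert e Y" for p j \<omega>
    using schur_left[OF fin hm z insertI1, of p j \<omega>] that insert.hyps unfolding Y by auto
  have right: "res (insert e Y) (K \<omega>) z e p = - res (insert e Y) (K \<omega>) z e e * (\<Sum>q\<in>Y. K \<omega> e q * res Y (K \<omega>) z q p)"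
    if "p \<in> Y" for p \<omega>
    using schur_right[OF fin hm z insertI1, of p e \<omega>] that insert.hyps unfolding Y by auto
  have e_row: "(\<lambda>\<omega>. res (insert e Y) (K \<omega>) z e j) \<in> borel_measurable M" if "j \<in> insert e Y" for j
  proof (cases "j = e")
    case False
    then have j: "j \<in> Y" using that by simp
    show ?thesis unfolding right[OF j]
      by (intro borel_measurable_times borel_measurable_uminus a row j)
  qed (simp add: a)
  show ?case
  proof (cases "i = e")
    case False
    then have i: "i \<in> Y" using insert.prems by simp
    show ?thesis
    proof (cases "j = e")
      case True
      show ?thesis unfolding left[OF i insert.prems(4)] if_P[OF True]
        by (intro borel_measurable_diff borel_measurable_times col i e_row insert.prems borel_measurable_const)
    next
      case False
      then have j: "j \<in> Y" using insert.prems by simp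
      show ?thesis unfolding left[OF i insert.prems(4)] if_not_P[OF False]
        by (intro borel_measurable_diff borel_measurable_times col i e_row insert.prems R j)
    qed
  qed (use e_row insert.prems in simp)
qed simp

lemma prod_one_plus_ge:
  fixes a :: "'l \<Rightarrow> real"
  assumes "finite L" "\<And>l. l \<in> L \<Longrightarrow> a l \<ge> 0"
  shows "1 + (\<Sum>l\<in>L. a l) \<le> (\<Prod>l\<in>L. 1 + a l)"
  using assms
proof (induction L rule: finite_induct)
  case (insert x F)
  have "1 + (a x + sum a F) \<le> (1 + a x) * (1 + sum a F)"
    using insert.prems sum_nonneg[of F a] by (auto simp: algebra_simps)
  also have "\<dots> \<le> (1 + a x) * (\<Prod>l\<in>F. 1 + a l)"
    using insert by (intro mult_left_mono) auto
  finally show ?case using insert.hyps by simp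
qed simp

section \<open>Tail estimate for the smoothed eigenvalue count\<close>

context
  fixes D :: nat and s :: "nat \<Rightarrow> nat \<Rightarrow> real" and \<sigma> :: real and H0 :: "nat \<Rightarrow> nat \<Rightarrow> complex"
  assumes s: "\<And>i j. s i j > 0" and \<sigma>: "\<sigma> > 0"
    and s_ge: "\<And>i j. i < D \<Longrightarrow> j < D \<Longrightarrow> (s i j)\<^sup>2 \<ge> \<sigma>\<^sup>2 / 2"
    and H0: "herm {..<D} H0"
begin

lemma herm_hent_subset: "Y \<subseteq> {..<D} \<Longrightarrow> herm Y (hent H0 \<omega>)"
  using herm_hent[OF herm_subset[OF H0]] .

lemma Phi_measurable:
  assumes Y: "Y \<subseteq> {..<D}" and z: "Im z > 0"
  shows "(\<lambda>\<omega>. Phi Y (hent H0 \<omega>) z) \<in> borel_measurable (GS D s)"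
proof -
  have "finite Y" using Y finite_subset by blast
  then have "(\<lambda>\<omega>. res Y (hent H0 \<omega>) z i i) \<in> borel_measurable (GS D s)" if "i \<in> Y" for i
    using Y z that by (intro res_measurable herm_hent_subset hent_measurable) auto
  then show ?thesis
    unfolding Phi_def
    by (intro borel_measurable_times borel_measurable_sum borel_measurable_const)
      (auto intro: borel_measurable_complex_iff[THEN iffD1, THEN conjunct2])
qed

lemma rcol_nsq_measurable:
  assumes Y: "Y \<subseteq> {..<D}" and z: "Im z > 0" and e: "e < D"
  shows "(\<lambda>\<omega>. nsq Y (rcol Y (hent H0 \<omega>) z e)) \<in> borel_measurable (GS D s)"
proof -
  have "finite Y" using Y finite_subset by blast
  then have "(\<lambda>\<omega>. res Y (hent H0 \<omega>) z i j) \<in> borel_measurable (GS D s)" if "i \<in> Y" "j \<in> Y" for i j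
    using Y z that by (intro res_measurable herm_hent_subset hent_measurable) auto
  moreover have "(\<lambda>\<omega>. hent H0 \<omega> i e) \<in> borel_measurable (GS D s)" if "i \<in> Y" for i
    using Y that e by (intro hent_measurable) auto
  ultimately show ?thesis
    unfolding nsq_def rcol_def by measurable
qed

text \<open>Only the entries \<open>a_qe\<close> with \<open>q\<close> in \<open>Y\<close> are
  averaged. The minor and its eigenbasis are then fixed, and the other half \<open>cnj a_eq\<close>
  of the column joins the shift. In the eigenbasis \<open>R h\<close> is Gaussian with covariance
  bounded below by a diagonal form with entries of order
  \<open>\<sigma>^2 / |\<mu> l - z|^2\<close>; these add up to a multiple of
  \<open>\<sigma>^2 Phi / r^2\<close>, which produces the factor
  \<open>r^2 y / (\<sigma>^2 t)\<close>.\<close>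

lemma rcol_small_prob:
  fixes E :: real
  assumes Y: "Y \<subseteq> {..<D}" and e: "e < D" "e \<notin> Y" and r: "r > 0" and t: "t > 0" and y: "y > 0"
  defines "z \<equiv> Complex E r"
  shows "measure (GS D s) {\<omega> \<in> space (GS D s). t \<le> Phi Y (hent H0 \<omega>) z \<and> nsq Y (rcol Y (hent H0 \<omega>) z e) \<le> y}
    \<le> exp 1 * (2 * r\<^sup>2 * y / (\<sigma>\<^sup>2 * t))"
    (is "measure _ ?S \<le> ?p")
proof -
  define I where "I = {..<D} \<times> {..<D} \<times> (UNIV :: bool set)"
  define J where "J = Y \<times> {e} \<times> (UNIV :: bool set)"
  define M where "M = (\<lambda>(i,j,b::bool). gN (s i j))"
  have z: "Im z > 0" using r by (simp add: z_def)
  have finY: "finite Y" using Y finite_subset by blast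
  have GS: "GS D s = PiM I M" by (simp add: GS_def I_def M_def)
  have p0: "?p \<ge> 0" using t y by simp
  have meas: "?S \<in> sets (PiM I M)"
    using Phi_measurable[OF Y z] rcol_nsq_measurable[OF Y z e(1)] unfolding GS[symmetric] by measurable
  show ?thesis unfolding GS
  proof (rule measure_PiM_section_le)
    show "finite I" by (simp add: I_def)
    show "J \<subseteq> I" using Y e by (auto simp: I_def J_def)
    show "prob_space (M i)" for i unfolding M_def by (cases i) (simp add: prob_space_gN s)
    show "{\<omega> \<in> space (PiM I M). t \<le> Phi Y (hent H0 \<omega>) z \<and> nsq Y (rcol Y (hent H0 \<omega>) z e) \<le> y} \<in> sets (PiM I M)"
      using meas by (simp add: GS)
    fix \<omega> assume "\<omega> \<in> space (PiM (I - J) M)"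
    define m where "m x = merge (I - J) J (\<omega>, x)" for x
    \<comment> \<open>Any point may stand for the averaged coordinates, since the entries on
      \<open>Y\<close> do not involve them.\<close>
    define K0 where "K0 = hent H0 (m undefined)"
    have agree: "hent H0 (m x) i j = K0 i j" if "i \<in> Y" "j \<in> Y" for x i j
      using that e Y by (auto simp: hent_def aent_def K0_def m_def merge_def J_def I_def)
    have Phi: "Phi Y (hent H0 (m x)) z = Phi Y K0 z" and res_eq: "res Y (hent H0 (m x)) z = res Y K0 z" for x
      by (intro Phi_cong res_cong agree; assumption)+
    have hK0: "herm Y K0" unfolding K0_def by (rule herm_hent_subset[OF Y])
    obtain w \<mu> where eb: "eigbasis Y K0 w \<mu>" and
      res: "\<And>i j. res Y K0 z i j = (\<Sum>l<card Y. w l i * cnj (w l j) / (complex_of_real (\<mu> l) - z))"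
      using res_eigbasis[OF finY hK0] by blast
    define g where "g l = complex_of_real (\<mu> l) - z" for l
    have g: "(cmod (g l))\<^sup>2 > 0" for l
      using r by (auto simp: g_def z_def cmod_power2 sum_power2_gt_zero_iff)
    \<comment> \<open>\<open>\<sigma>^2 / 2\<close> bounds the variance of a real coordinate from
      below; the other factor \<open>1/2\<close> comes from the normalisation
      \<open>1 / sqrt 2\<close> of the Gaussian part.\<close>
    define v where "v l = \<sigma>\<^sup>2 / 4 / (cmod (g l))\<^sup>2" for l
    define \<beta> where "\<beta> l q e' = cnj (w l q) / (sqrt 2 * g l)" for l q and e' :: nat
    define c where "c l = ip Y (w l) (\<lambda>q. H0 q e + cnj (aent \<omega> e q) / sqrt 2) / g l" for l
    have col: "nsq Y (rcol Y (hent H0 (m x)) z e)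
       = (\<Sum>l<card Y. (cmod (c l + (\<Sum>i\<in>Y. \<Sum>j\<in>{e}. \<beta> l i j * Complex (x (i,j,False)) (x (i,j,True)))))\<^sup>2)" for x
    proof -
      have eb': "eigbasis Y (hent H0 (m x)) w \<mu>" using eb eigbasis_cong[of Y "hent H0 (m x)" K0] agree by simp
      have ent: "hent H0 (m x) q e = (H0 q e + cnj (aent \<omega> e q) / sqrt 2) + Complex (x (q,e,False)) (x (q,e,True)) / sqrt 2"
        if "q \<in> Y" for q
        using that e Y by (auto simp: hent_def aent_def m_def merge_def J_def I_def add_divide_distrib)
      have "ip Y (w l) (\<lambda>q. hent H0 (m x) q e) / g l
          = c l + (\<Sum>i\<in>Y. \<Sum>j\<in>{e}. \<beta> l i j * Complex (x (i,j,False)) (x (i,j,True)))" for l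
      proof -
        have "ip Y (w l) (\<lambda>q. hent H0 (m x) q e)
          = ip Y (w l) (\<lambda>q. (H0 q e + cnj (aent \<omega> e q) / sqrt 2) + Complex (x (q,e,False)) (x (q,e,True)) / sqrt 2)"
          by (intro ip_cong refl ent)
        then show ?thesis
          by (simp add: c_def ip_def \<beta>_def sum_divide_distrib add_divide_distrib distrib_left sum.distrib)
      qed
      then show ?thesis
        using rcol_nsq[OF finY eb', of z e] res res_eq[of x] by (simp add: g_def)
    qed
    show "measure (PiM J M) {x \<in> space (PiM J M). merge (I - J) J (\<omega>, x) \<in>
        {\<omega> \<in> space (PiM I M). t \<le> Phi Y (hent H0 \<omega>) z \<and> nsq Y (rcol Y (hent H0 \<omega>) z e) \<le> y}} \<le> ?p"
      (is "measure _ ?T \<le> _")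
    proof (cases "t \<le> Phi Y K0 z")
      \<comment> \<open>The condition on \<open>Phi\<close> concerns frozen entries only: it holds
        on the whole section or the section is empty.\<close>
      case False
      then have "?T = {}" using Phi by (auto simp: m_def)
      then show ?thesis using p0 by (metis measure_empty)
    next
      case True
      \<comment> \<open>This choice turns the prefactor \<open>exp (\<theta> * y)\<close> into
        \<open>exp 1\<close>.\<close>
      define \<theta> where "\<theta> = 1 / y"
      have \<theta>: "\<theta> > 0" using y by (simp add: \<theta>_def)
      let ?T' = "{x \<in> space (PiM J M). (\<Sum>l<card Y. (cmod (c l + (\<Sum>i\<in>Y. \<Sum>j\<in>{e}. \<beta> l i j * Complex (x (i,j,False)) (x (i,j,True)))))\<^sup>2) \<le> y}"
      have TT: "?T = ?T' \<inter> {x \<in> space (PiM J M). m x \<in> space (PiM I M)}"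
        using True Phi col by (auto simp: m_def)
      have I: "(I - J) \<union> J = I" using Y e by (auto simp: I_def J_def)
      have mm: "m x \<in> space (PiM I M)" if "x \<in> space (PiM J M)" for x
        using that \<open>\<omega> \<in> space (PiM (I - J) M)\<close> Y e
        by (auto simp: m_def space_PiM PiE_iff merge_def extensional_def M_def)
           (auto simp: I_def J_def)
      have "?T = ?T'" unfolding TT using mm by auto
      then have "measure (PiM J M) ?T = measure (PiM J M) ?T'" by simp
      also have "\<dots> \<le> exp (\<theta> * y) * (\<Prod>l<card Y. 1 / (1 + 2 * \<theta> * v l))"
        unfolding J_def M_def
      proof (rule gauss_small_ball)
        fix \<zeta> :: "nat \<Rightarrow> complex"
        have "(\<Sum>l<card Y. v l * (cmod (\<zeta> l))\<^sup>2) = \<sigma>\<^sup>2 / 2 * (\<Sum>l<card Y. (cmod (cnj (\<zeta> l) / (sqrt 2 * cnj (g l))))\<^sup>2)"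
          unfolding v_def sum_distrib_left
          by (intro sum.cong refl) (simp add: norm_divide norm_mult power_divide power_mult_distrib)
        also have "(\<Sum>l<card Y. (cmod (cnj (\<zeta> l) / (sqrt 2 * cnj (g l))))\<^sup>2)
            = nsq Y (\<lambda>q. \<Sum>l<card Y. (cnj (\<zeta> l) / (sqrt 2 * cnj (g l))) * w l q)"
          by (rule nsq_orthonormal_sum[OF finY eb order_refl, symmetric])
        also have "\<dots> = (\<Sum>q\<in>Y. (cmod (\<Sum>l<card Y. \<zeta> l * \<beta> l q e))\<^sup>2)"
          unfolding nsq_def
        proof (intro sum.cong refl)
          fix q
          have "(\<Sum>l<card Y. (cnj (\<zeta> l) / (sqrt 2 * cnj (g l))) * w l q) = cnj (\<Sum>l<card Y. \<zeta> l * \<beta> l q e)"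
            by (simp add: \<beta>_def)
          then show "(cmod (\<Sum>l<card Y. (cnj (\<zeta> l) / (sqrt 2 * cnj (g l))) * w l q))\<^sup>2 = (cmod (\<Sum>l<card Y. \<zeta> l * \<beta> l q e))\<^sup>2"
            by (simp only: complex_mod_cnj)
        qed
        also have "\<sigma>\<^sup>2 / 2 * (\<Sum>q\<in>Y. (cmod (\<Sum>l<card Y. \<zeta> l * \<beta> l q e))\<^sup>2)
           \<le> (\<Sum>q\<in>Y. \<Sum>j\<in>{e}. (s q j)\<^sup>2 * (cmod (\<Sum>l<card Y. \<zeta> l * \<beta> l q j))\<^sup>2)"
          unfolding sum_distrib_left
        proof (intro sum_mono)
          fix q assume "q \<in> Y"
          then have "\<sigma>\<^sup>2 / 2 \<le> (s q e)\<^sup>2" using s_ge e Y by auto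
          from mult_right_mono[OF this, of "(cmod (\<Sum>l<card Y. \<zeta> l * \<beta> l q e))\<^sup>2"]
          show "\<sigma>\<^sup>2 / 2 * (cmod (\<Sum>l<card Y. \<zeta> l * \<beta> l q e))\<^sup>2
             \<le> (\<Sum>j\<in>{e}. (s q j)\<^sup>2 * (cmod (\<Sum>l<card Y. \<zeta> l * \<beta> l q j))\<^sup>2)"
            by simp
        qed
        finally show "(\<Sum>l<card Y. v l * (cmod (\<zeta> l))\<^sup>2)
            \<le> (\<Sum>q\<in>Y. \<Sum>j\<in>{e}. (s q j)\<^sup>2 * (cmod (\<Sum>l<card Y. \<zeta> l * \<beta> l q j))\<^sup>2)" .
      qed (use \<theta> s finY in \<open>auto simp: v_def\<close>)
      \<comment> \<open>The product of the \<open>1 + 2 * \<theta> * v l\<close> is at least 1 plus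
        the sum of the \<open>2 * \<theta> * v l\<close>, and this sum is proportional to
        \<open>Phi\<close>.\<close>
      also have "(\<Prod>l<card Y. 1 / (1 + 2 * \<theta> * v l)) \<le> 2 * r\<^sup>2 * y / (\<sigma>\<^sup>2 * t)"
      proof -
        have v0: "2 * \<theta> * v l \<ge> 0" for l using \<theta> by (simp add: v_def)
        have "Phi Y K0 z = (\<Sum>l<card Y. r\<^sup>2 / (cmod (g l))\<^sup>2)"
          using Phi_eq[OF finY eb res] by (simp add: g_def z_def)
        also have "\<dots> * \<sigma>\<^sup>2 = (\<Sum>l<card Y. 2 * \<theta> * v l) * (2 * r\<^sup>2 * y)"
          using y by (simp add: v_def \<theta>_def sum_distrib_left sum_distrib_right mult_ac)
        finally have eq: "Phi Y K0 z * \<sigma>\<^sup>2 = (\<Sum>l<card Y. 2 * \<theta> * v l) * (2 * r\<^sup>2 * y)" .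
        have "\<sigma>\<^sup>2 * t \<le> (1 + (\<Sum>l<card Y. 2 * \<theta> * v l)) * (2 * r\<^sup>2 * y)"
        proof -
          have "\<sigma>\<^sup>2 * t \<le> (\<Sum>l<card Y. 2 * \<theta> * v l) * (2 * r\<^sup>2 * y)"
            using mult_right_mono[OF True, of "\<sigma>\<^sup>2"] unfolding eq by (simp add: mult.commute)
          also have "\<dots> \<le> (1 + (\<Sum>l<card Y. 2 * \<theta> * v l)) * (2 * r\<^sup>2 * y)"
            using y by (intro mult_right_mono) auto
          finally show ?thesis .
        qed
        also have "\<dots> \<le> (\<Prod>l<card Y. 1 + 2 * \<theta> * v l) * (2 * r\<^sup>2 * y)"
          using y by (intro mult_right_mono prod_one_plus_ge v0) auto
        finally have "\<sigma>\<^sup>2 * t \<le> (\<Prod>l<card Y. 1 + 2 * \<theta> * v l) * (2 * r\<^sup>2 * y)" .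
        moreover have "(\<Prod>l<card Y. 1 + 2 * \<theta> * v l) > 0"
          using v0 by (intro prod_pos) (auto simp: add_pos_nonneg)
        ultimately show ?thesis
          using \<sigma> t by (simp add: prod_dividef divide_simps mult_ac)
      qed
      finally show ?thesis using y by (simp add: \<theta>_def mult_left_mono)
    qed
  qed
qed

text \<open>Let \<open>Phi\<close> be at least \<open>T\<close>. In the bound
  \<open>Phi_upper\<close> the indices with \<open>|R h|^2 > y\<close> contribute at most
  \<open>D / y = T / 2\<close>, so at least \<open>T / 2\<close> indices have
  \<open>|R h|^2 \<le> y\<close>; for each of them the minor still has
  \<open>Phi \<ge> T - 1 \<ge> T / 2\<close>. Markov's inequality for the number of such indices
  reduces the claim to the estimate for a single column.\<close>

lemma Phi_large_prob:
  fixes E :: real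
  assumes Y: "Y \<subseteq> {..<D}" and r: "r > 0" and T: "T \<ge> 2" and D: "D > 0"
  defines "z \<equiv> Complex E r"
  shows "measure (GS D s) {\<omega> \<in> space (GS D s). T \<le> Phi Y (hent H0 \<omega>) z}
    \<le> 16 * exp 1 * r\<^sup>2 * (real D)\<^sup>2 / (\<sigma>\<^sup>2 * T ^ 3)"
proof -
  interpret prob_space "GS D s" by (rule prob_space_GS) (rule s)
  have z: "Im z > 0" using r by (simp add: z_def)
  have finY: "finite Y" using Y finite_subset by blast
  define y where "y = 2 * real D / T"
  have y: "y > 0" using T D by (simp add: y_def)
  define S where "S e = {\<omega> \<in> space (GS D s). T / 2 \<le> Phi (Y - {e}) (hent H0 \<omega>) z \<and>
      nsq (Y - {e}) (rcol (Y - {e}) (hent H0 \<omega>) z e) \<le> y}" for e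
  have Se: "S e \<in> events" if "e \<in> Y" for e
  proof -
    have *: "Y - {e} \<subseteq> {..<D}" "e < D" using Y that by auto
    have [measurable]: "(\<lambda>\<omega>. Phi (Y - {e}) (hent H0 \<omega>) z) \<in> borel_measurable (GS D s)"
      "(\<lambda>\<omega>. nsq (Y - {e}) (rcol (Y - {e}) (hent H0 \<omega>) z e)) \<in> borel_measurable (GS D s)"
      by (intro Phi_measurable rcol_nsq_measurable * z)+
    show ?thesis unfolding S_def by measurable
  qed
  let ?A = "{\<omega> \<in> space (GS D s). T \<le> Phi Y (hent H0 \<omega>) z}"
  have [measurable]: "?A \<in> events" using Phi_measurable[OF Y z] by measurable
  have key: "T / 2 * indicator ?A \<omega> \<le> (\<Sum>e\<in>Y. indicator (S e) \<omega> :: real)" if \<omega>: "\<omega> \<in> space (GS D s)" for \<omega>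
  proof (cases "\<omega> \<in> ?A")
    case True
    have "1 / (1 + nsq (Y - {e}) (rcol (Y - {e}) (hent H0 \<omega>) z e)) \<le> T / (2 * real D) + indicator (S e) \<omega>"
      if e: "e \<in> Y" for e
    proof (cases "nsq (Y - {e}) (rcol (Y - {e}) (hent H0 \<omega>) z e) \<le> y")
      case le: True
      have "T \<le> Phi (Y - {e}) (hent H0 \<omega>) z + 1"
        using Phi_remove_le[OF finY herm_hent_subset[OF Y] z e, of \<omega>] True by simp
      then have "\<omega> \<in> S e" using T \<omega> le by (auto simp: S_def)
      moreover have "1 / (1 + nsq (Y - {e}) (rcol (Y - {e}) (hent H0 \<omega>) z e)) \<le> 1"
        by (simp add: divide_le_eq_1 add_pos_nonneg)
      moreover have "T / (2 * real D) \<ge> 0" using T by simp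
      ultimately show ?thesis by simp
    next
      case False
      then have "1 / (1 + nsq (Y - {e}) (rcol (Y - {e}) (hent H0 \<omega>) z e)) \<le> 1 / y"
        using y by (intro divide_left_mono) (auto simp: add_pos_nonneg)
      also have "1 / y = T / (2 * real D)" by (simp add: y_def)
      finally show ?thesis by (simp add: add_increasing2)
    qed
    then have "(\<Sum>e\<in>Y. 1 / (1 + nsq (Y - {e}) (rcol (Y - {e}) (hent H0 \<omega>) z e)))
        \<le> (\<Sum>e\<in>Y. T / (2 * real D) + indicator (S e) \<omega>)" by (rule sum_mono)
    also have "\<dots> = real (card Y) / real D * (T / 2) + (\<Sum>e\<in>Y. indicator (S e) \<omega>)"
      by (simp add: sum.distrib)
    also have "real (card Y) / real D * (T / 2) \<le> 1 * (T / 2)"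
      using T D card_mono[OF _ Y] by (intro mult_right_mono) (auto simp: divide_le_eq_1)
    finally have "T \<le> T / 2 + (\<Sum>e\<in>Y. indicator (S e) \<omega>)"
      using Phi_upper[OF finY herm_hent_subset[OF Y] z, of \<omega>] True by simp
    then show ?thesis using True by simp
  qed (simp add: sum_nonneg)
  have "T / 2 * prob ?A = (LINT \<omega>|GS D s. T / 2 * indicator ?A \<omega>)" by simp
  also have "\<dots> \<le> (LINT \<omega>|GS D s. (\<Sum>e\<in>Y. indicator (S e) \<omega>))"
    using Se key by (intro integral_mono Bochner_Integration.integrable_sum integrable_mult_right integrable_real_indicator)
      (auto simp: emeasure_eq_measure)
  also have "\<dots> = (\<Sum>e\<in>Y. prob (S e))"
    using Se by (subst Bochner_Integration.integral_sum)
      (auto intro!: integrable_real_indicator simp: emeasure_eq_measure)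
  also have "\<dots> \<le> (\<Sum>e\<in>Y. exp 1 * (2 * r\<^sup>2 * y / (\<sigma>\<^sup>2 * (T / 2))))"
    unfolding S_def z_def using Y r T y by (intro sum_mono rcol_small_prob) auto
  also have "\<dots> = real (card Y) * (exp 1 * (2 * r\<^sup>2 * y / (\<sigma>\<^sup>2 * (T / 2))))" by simp
  also have "\<dots> \<le> real D * (exp 1 * (2 * r\<^sup>2 * y / (\<sigma>\<^sup>2 * (T / 2))))"
    using card_mono[OF _ Y] T y by (intro mult_right_mono) auto
  finally have "2 / T * (T / 2 * prob ?A) \<le> 2 / T * (real D * (exp 1 * (2 * r\<^sup>2 * y / (\<sigma>\<^sup>2 * (T / 2)))))"
    using T by (intro mult_left_mono) auto
  then have "prob ?A \<le> 2 / T * (real D * (exp 1 * (2 * r\<^sup>2 * y / (\<sigma>\<^sup>2 * (T / 2)))))"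
    using T by simp
  also have "\<dots> = 16 * exp 1 * r\<^sup>2 * (real D)\<^sup>2 / (\<sigma>\<^sup>2 * T ^ 3)"
    using T \<sigma> by (simp add: y_def field_simps power2_eq_square power3_eq_cube)
  finally show ?thesis .
qed

end

section \<open>Nets of the unit ball\<close>

lemma sum_power_abs_int:
  fixes x :: real
  assumes "x \<noteq> 1"
  shows "(\<Sum>j\<in>{- int B..int B}. x ^ nat \<bar>j\<bar>) = (1 + x - 2 * x ^ (B + 1)) / (1 - x)"
proof (induction B)
  case 0
  then show ?case using assms by simp
next
  case (Suc B)
  have *: "{- int (Suc B)..int (Suc B)} = insert (- int (Suc B)) (insert (int (Suc B)) {- int B..int B})"
    by auto
  have "(\<Sum>j\<in>{- int (Suc B)..int (Suc B)}. x ^ nat \<bar>j\<bar>) = 2 * x ^ Suc B + (1 + x - 2 * x ^ (B + 1)) / (1 - x)"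
    unfolding * using Suc by (simp add: nat_add_distrib)
  also have "\<dots> = (1 + x - 2 * x ^ (Suc B + 1)) / (1 - x)"
    using assms by (simp add: field_simps)
  finally show ?case .
qed

text \<open>The points of the scaled lattice \<open>h \<int>\<^sup>K\<close> (with \<open>h = \<eta> / sqrt (card K)\<close>) that arise by rounding
  points of the unit ball towards \<open>0\<close> have \<open>l\<^sup>1\<close>-norm at most \<open>card K / \<eta>\<close> in lattice units, and are
  counted by means of the generating function of the \<open>l\<^sup>1\<close>-norm at \<open>x = 1 / (1 + \<eta>)\<close>.\<close>

lemma unit_ball_net:
  fixes K :: "'k set" and \<eta> :: real
  assumes fin: "finite K" and \<eta>: "0 < \<eta>" "\<eta> \<le> 1"
  obtains Z :: "('k \<Rightarrow> real) set" where "finite Z" "real (card Z) \<le> (9 / \<eta>) ^ card K"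
    "\<And>\<zeta>. \<zeta> \<in> Z \<Longrightarrow> (\<Sum>k\<in>K. (\<zeta> k)\<^sup>2) \<le> 1"
    "\<And>\<xi>. (\<Sum>k\<in>K. (\<xi> k)\<^sup>2) \<le> 1 \<Longrightarrow> \<exists>\<zeta>\<in>Z. (\<Sum>k\<in>K. (\<xi> k - \<zeta> k)\<^sup>2) \<le> \<eta>\<^sup>2"
proof (cases "K = {}")
  case True
  then show ?thesis using \<eta> by (intro that[of "{\<lambda>_. 0}"]) auto
next
  case False
  define N where "N = card K"
  have N: "N > 0" using False fin by (simp add: N_def card_gt_0_iff)
  define h where "h = \<eta> / sqrt N"
  have h: "h > 0" using N \<eta> by (simp add: h_def)
  \<comment> \<open>The box only provides finiteness: the constraint on the \<open>l^1\<close>-norm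
    keeps the rounded points inside it, and its size does not enter the count.\<close>
  define B where "B = nat \<lceil>N / \<eta>\<rceil>"
  define P where "P = PiE K (\<lambda>_. {- int B..int B})"
  have finP: "finite P" unfolding P_def using fin by (intro finite_PiE) auto
  define m where "m z = (\<Sum>k\<in>K. nat \<bar>z k\<bar>)" for z :: "'k \<Rightarrow> int"
  define Q where "Q = {z \<in> P. real (m z) \<le> N / \<eta> \<and> (\<Sum>k\<in>K. (h * z k)\<^sup>2) \<le> 1}"
  have finQ: "finite Q" using finP by (simp add: Q_def)
  define Z where "Z = (\<lambda>z k. h * real_of_int (z k)) ` Q"
  define x where "x = 1 / (1 + \<eta>)"
  have x: "0 < x" "x < 1" using \<eta> by (auto simp: x_def)
  have cardQ: "real (card Q) \<le> (9 / \<eta>) ^ N"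
  proof -
    have "real (card Q) * x powr (N / \<eta>) = (\<Sum>z\<in>Q. x powr (N / \<eta>))" by simp
    also have "\<dots> \<le> (\<Sum>z\<in>Q. x ^ m z)"
    proof (intro sum_mono)
      fix z assume "z \<in> Q"
      then have "real (m z) \<le> N / \<eta>" by (simp add: Q_def)
      then have "x powr (N / \<eta>) \<le> x powr real (m z)" using x by (simp add: powr_mono')
      then show "x powr (N / \<eta>) \<le> x ^ m z" using x by (simp add: powr_realpow)
    qed
    also have "\<dots> \<le> (\<Sum>z\<in>P. x ^ m z)"
      using finP x by (intro sum_mono2) (auto simp: Q_def)
    also have "\<dots> = (\<Sum>z\<in>P. \<Prod>k\<in>K. x ^ nat \<bar>z k\<bar>)"
      by (simp add: m_def power_sum)
    also have "\<dots> = (\<Prod>k\<in>K. \<Sum>j\<in>{- int B..int B}. x ^ nat \<bar>j\<bar>)"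
      unfolding P_def by (rule prod_sum_PiE[symmetric]) (use fin in auto)
    also have "\<dots> = ((1 + x - 2 * x ^ (B + 1)) / (1 - x)) ^ N"
      using x by (simp add: sum_power_abs_int N_def)
    also have "\<dots> \<le> (3 / \<eta>) ^ N"
    proof (rule power_mono)
      have "(1 + x - 2 * x ^ (B + 1)) / (1 - x) \<le> (1 + x) / (1 - x)"
        using x by (intro divide_right_mono) auto
      also have "\<dots> = (2 + \<eta>) / \<eta>"
      proof -
        have "1 + x = (2 + \<eta>) / (1 + \<eta>)" "1 - x = \<eta> / (1 + \<eta>)" using \<eta> by (auto simp: x_def field_simps)
        then show ?thesis using \<eta> by simp
      qed
      also have "\<dots> \<le> 3 / \<eta>" using \<eta> by (intro divide_right_mono) auto
      finally show "(1 + x - 2 * x ^ (B + 1)) / (1 - x) \<le> 3 / \<eta>" .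
      have "x ^ (B + 1) \<le> x" using x power_le_one[of x B] by (simp add: mult_left_le)
      then have "0 \<le> 1 + x - 2 * x ^ (B + 1)" using x by linarith
      then show "0 \<le> (1 + x - 2 * x ^ (B + 1)) / (1 - x)" using x by (intro divide_nonneg_nonneg) auto
    qed
    finally have 1: "real (card Q) * x powr (N / \<eta>) \<le> (3 / \<eta>) ^ N" .
    \<comment> \<open>Since \<open>(1 + \<eta>) powr (1 / \<eta>) \<le> exp 1 \<le> 3\<close>,
      weighting the points by \<open>x\<close> to the power of their norm costs at most
      \<open>3 ^ N\<close>.\<close>
    have "1 \<le> 3 ^ N * x powr (N / \<eta>)"
    proof -
      have "ln (1 + \<eta>) \<le> \<eta>" using \<eta> by (intro ln_add_one_self_le_self) auto
      then have "N / \<eta> * ln (1 + \<eta>) \<le> N / \<eta> * \<eta>" using \<eta> by (intro mult_left_mono) auto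
      then have "N / \<eta> * ln (1 + \<eta>) \<le> N" using \<eta> by simp
      then have "exp (- real N) \<le> exp (- (N / \<eta> * ln (1 + \<eta>)))" by simp
      also have "\<dots> = x powr (N / \<eta>)"
        using \<eta> by (simp add: x_def powr_def ln_div)
      finally have "exp (- real N) \<le> x powr (N / \<eta>)" .
      moreover have "exp (real N) \<le> 3 ^ N"
        using exp_le power_mono[of "exp 1" "3::real" N] exp_of_nat_mult[of N "1::real"] by simp
      ultimately have "exp (real N) * exp (- real N) \<le> 3 ^ N * x powr (N / \<eta>)"
        by (intro mult_mono) auto
      then show ?thesis by (simp add: exp_minus)
    qed
    then have "real (card Q) * 1 \<le> real (card Q) * (3 ^ N * x powr (N / \<eta>))"
      by (intro mult_left_mono) auto
    also have "\<dots> = 3 ^ N * (real (card Q) * x powr (N / \<eta>))" by simp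
    also have "\<dots> \<le> 3 ^ N * (3 / \<eta>) ^ N" using 1 by (intro mult_left_mono) auto
    also have "\<dots> = (9 / \<eta>) ^ N" by (simp flip: power_mult_distrib)
    finally show ?thesis by simp
  qed
  show ?thesis
  proof (rule that[of Z])
    show "finite Z" using finQ by (simp add: Z_def)
    have "real (card Z) \<le> real (card Q)" unfolding Z_def using card_image_le[OF finQ] by (simp add: of_nat_mono)
    then show "real (card Z) \<le> (9 / \<eta>) ^ card K" using cardQ by (simp add: N_def)
    show "(\<Sum>k\<in>K. (\<zeta> k)\<^sup>2) \<le> 1" if "\<zeta> \<in> Z" for \<zeta>
      using that by (auto simp: Z_def Q_def)
    fix \<xi> :: "'k \<Rightarrow> real" assume \<xi>: "(\<Sum>k\<in>K. (\<xi> k)\<^sup>2) \<le> 1"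
    \<comment> \<open>Rounding the modulus down moves a coordinate by less than \<open>h\<close>, so
      the squared error is at most \<open>N h^2 = \<eta>^2\<close> while no coordinate grows in
      modulus.\<close>
    define a where "a k = \<lfloor>\<bar>\<xi> k\<bar> / h\<rfloor>" for k
    define z where "z k = (if k \<in> K then (if \<xi> k \<ge> 0 then a k else - a k) else undefined)" for k
    have a0: "a k \<ge> 0" for k using h by (simp add: a_def)
    have z_abs: "\<bar>z k\<bar> = a k" if "k \<in> K" for k using that a0[of k] by (simp add: z_def)
    have a_le: "h * a k \<le> \<bar>\<xi> k\<bar>" "\<bar>\<xi> k\<bar> < h * a k + h" for k
    proof -
      have "of_int (a k) \<le> \<bar>\<xi> k\<bar> / h" "\<bar>\<xi> k\<bar> / h < of_int (a k) + 1" by (auto simp: a_def)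
      then show "h * a k \<le> \<bar>\<xi> k\<bar>" "\<bar>\<xi> k\<bar> < h * a k + h" using h by (auto simp: field_simps)
    qed
    have l1: "(\<Sum>k\<in>K. \<bar>\<xi> k\<bar>) \<le> sqrt N"
    proof -
      have "(\<Sum>k\<in>K. \<bar>\<xi> k\<bar> * \<bar>1\<bar>) \<le> L2_set \<xi> K * L2_set (\<lambda>_. 1) K" by (rule L2_set_mult_ineq)
      also have "\<dots> \<le> 1 * sqrt N"
        using \<xi> by (intro mult_mono) (auto simp: L2_set_def N_def)
      finally show ?thesis by simp
    qed
    have mz: "real (m z) \<le> N / \<eta>"
    proof -
      have "h * real (m z) = (\<Sum>k\<in>K. h * a k)"
        unfolding m_def of_nat_sum sum_distrib_left using a0 by (intro sum.cong refl) (simp add: z_abs)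
      also have "\<dots> \<le> (\<Sum>k\<in>K. \<bar>\<xi> k\<bar>)" by (intro sum_mono a_le)
      also note l1
      finally have "real (m z) \<le> sqrt N / h" using h by (simp add: field_simps)
      also have "sqrt N / h = N / \<eta>" using N \<eta> by (simp add: h_def field_simps)
      finally show ?thesis .
    qed
    have "z \<in> P"
    proof -
      have "z k \<in> {- int B..int B}" if "k \<in> K" for k
      proof -
        have "nat \<bar>z k\<bar> \<le> m z" unfolding m_def using that fin by (intro member_le_sum) auto
        then have "real (nat \<bar>z k\<bar>) \<le> N / \<eta>" using mz by linarith
        then have "real (nat \<bar>z k\<bar>) \<le> real B" unfolding B_def by linarith
        then show ?thesis by auto
      qed
      then show ?thesis by (auto simp: P_def z_def)
    qed
    moreover have "(\<Sum>k\<in>K. (h * z k)\<^sup>2) \<le> 1"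
    proof -
      have "(h * z k)\<^sup>2 \<le> (\<xi> k)\<^sup>2" if "k \<in> K" for k
      proof -
        have "\<bar>h * z k\<bar> \<le> \<bar>\<xi> k\<bar>" using a_le(1)[of k] z_abs[OF that] h by (simp add: abs_mult flip: of_int_abs)
        then show ?thesis by (simp add: abs_le_square_iff)
      qed
      then have "(\<Sum>k\<in>K. (h * z k)\<^sup>2) \<le> (\<Sum>k\<in>K. (\<xi> k)\<^sup>2)" by (rule sum_mono)
      then show ?thesis using \<xi> by simp
    qed
    ultimately have "z \<in> Q" using mz by (simp add: Q_def)
    moreover have "(\<Sum>k\<in>K. (\<xi> k - h * z k)\<^sup>2) \<le> \<eta>\<^sup>2"
    proof -
      have "(\<xi> k - h * z k)\<^sup>2 \<le> h\<^sup>2" if "k \<in> K" for k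
      proof -
        have "\<bar>\<xi> k - h * z k\<bar> \<le> \<bar>h\<bar>" using a_le[of k] h that by (auto simp: z_def)
        then show ?thesis by (simp add: abs_le_square_iff)
      qed
      then have "(\<Sum>k\<in>K. (\<xi> k - h * z k)\<^sup>2) \<le> (\<Sum>k\<in>K. h\<^sup>2)" by (rule sum_mono)
      also have "\<dots> = \<eta>\<^sup>2" using N by (simp add: h_def power_divide N_def[symmetric])
      finally show ?thesis .
    qed
    ultimately show "\<exists>\<zeta>\<in>Z. (\<Sum>k\<in>K. (\<xi> k - \<zeta> k)\<^sup>2) \<le> \<eta>\<^sup>2"
      unfolding Z_def by (intro bexI[of _ "\<lambda>k. h * real_of_int (z k)"]) auto
  qed
qed

section \<open>Operator norm of the random matrix\<close>

lemma gauss_linear_tail: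
  fixes \<alpha> :: "'j \<Rightarrow> real" and s :: "'j \<Rightarrow> real"
  assumes fin: "finite I" and s: "\<And>u. s u > 0" and V: "V > 0" "(\<Sum>u\<in>I. (\<alpha> u)\<^sup>2 * (s u)\<^sup>2) \<le> V" and t: "t \<ge> 0"
  defines "N \<equiv> PiM I (\<lambda>u. gN (s u))"
  shows "measure N {x \<in> space N. t \<le> (\<Sum>u\<in>I. \<alpha> u * x u)} \<le> exp (- t\<^sup>2 / (2 * V))"
proof -
  define X where "X x = (\<Sum>u\<in>I. \<alpha> u * x u)" for x
  \<comment> \<open>The minimiser of \<open>\<theta>^2 V / 2 - \<theta> t\<close>, the exponent in
    Chernoff's bound.\<close>
  define \<theta> where "\<theta> = t / V"
  interpret P: product_prob_space "\<lambda>u. gN (s u)" I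
    by (simp add: product_prob_space_def product_prob_space_axioms_def product_sigma_finite_def
        prob_space_gN s prob_space_imp_sigma_finite)
  have "prob_space N"
    unfolding N_def by (intro prob_space_PiM) (auto simp: prob_space_gN s)
  then interpret prob_space N .
  have [measurable]: "X \<in> borel_measurable N" unfolding X_def N_def by measurable
  have eX: "exp (\<theta> * X x) = (\<Prod>u\<in>I. exp (\<theta> * \<alpha> u * x u))" for x
    unfolding X_def using fin by (simp add: exp_sum sum_distrib_left mult.assoc)
  have int: "integrable N (\<lambda>x. exp (\<theta> * X x))"
    unfolding eX N_def by (rule P.product_integrable_prod[OF fin gN_exp_integrable(1)[OF s]])
  have "prob {x \<in> space N. t \<le> X x} = (LINT x|N. indicator {x \<in> space N. t \<le> X x} x)"
    by simp
  also have "\<dots> \<le> (LINT x|N. exp (- \<theta> * t) * exp (\<theta> * X x))"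
  proof (intro integral_mono)
    show "integrable N (indicat_real {x \<in> space N. t \<le> X x})"
      by (rule integrable_const_bound[where B = 1]) (auto simp: indicator_def)
    fix x
    have "\<theta> * t \<le> \<theta> * X x" if "t \<le> X x" using that t V unfolding \<theta>_def by (intro mult_left_mono) auto
    then show "indicator {x \<in> space N. t \<le> X x} x \<le> exp (- \<theta> * t) * exp (\<theta> * X x)"
      by (auto simp: indicator_def simp flip: exp_add)
  qed (use int in simp)
  also have "\<dots> = exp (- \<theta> * t) * (LINT x|N. exp (\<theta> * X x))" by simp
  also have "(LINT x|N. exp (\<theta> * X x)) = (\<Prod>u\<in>I. exp ((\<theta> * \<alpha> u)\<^sup>2 * (s u)\<^sup>2 / 2))"
    unfolding eX N_def
    by (subst P.product_integral_prod[OF fin gN_exp_integrable(1)[OF s]]) (simp add: gN_exp_integrable(2)[OF s])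
  also have "\<dots> = exp (\<theta>\<^sup>2 / 2 * (\<Sum>u\<in>I. (\<alpha> u)\<^sup>2 * (s u)\<^sup>2))"
    using fin by (simp add: exp_sum[symmetric] sum_distrib_left power_mult_distrib mult.assoc)
  also have "\<dots> \<le> exp (\<theta>\<^sup>2 / 2 * V)" using V by (simp add: mult_left_mono)
  also have "exp (- \<theta> * t) * exp (\<theta>\<^sup>2 / 2 * V) = exp (- t\<^sup>2 / (2 * V))"
    using V by (simp add: \<theta>_def exp_add[symmetric] field_simps power2_eq_square)
  finally show ?thesis unfolding X_def by simp
qed

lemma ip_cauchy_schwarz: "cmod (ip I u v) \<le> sqrt (nsq I u) * sqrt (nsq I v)"
proof -
  have "cmod (ip I u v) \<le> (\<Sum>i\<in>I. \<bar>cmod (u i)\<bar> * \<bar>cmod (v i)\<bar>)"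
    unfolding ip_def by (intro order_trans[OF norm_sum]) (simp add: norm_mult)
  also have "\<dots> \<le> L2_set (\<lambda>i. cmod (u i)) I * L2_set (\<lambda>i. cmod (v i)) I"
    by (rule L2_set_mult_ineq)
  finally show ?thesis by (simp add: L2_set_def nsq_def)
qed

lemma sqrt_nsq_add_le: "sqrt (nsq I (\<lambda>i. u i + v i)) \<le> sqrt (nsq I u) + sqrt (nsq I v)"
proof -
  have "L2_set (\<lambda>i. cmod (u i + v i)) I \<le> L2_set (\<lambda>i. cmod (u i) + cmod (v i)) I"
    by (intro L2_set_mono norm_triangle_ineq) auto
  also have "\<dots> \<le> L2_set (\<lambda>i. cmod (u i)) I + L2_set (\<lambda>i. cmod (v i)) I"
    by (rule L2_set_triangle_ineq)
  finally show ?thesis by (simp add: L2_set_def nsq_def)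
qed

lemma eigbasis_nsq_mv:
  assumes Y: "finite Y" "herm Y K" and eb: "eigbasis Y K w \<mu>"
  shows "nsq Y (mv Y K v) = (\<Sum>l<card Y. (\<mu> l)\<^sup>2 * (cmod (ip Y (w l) v))\<^sup>2)"
proof -
  have "ip Y (w l) (mv Y K v) = \<mu> l * ip Y (w l) v" if "l < card Y" for l
  proof -
    have "ip Y (w l) (mv Y K v) = ip Y (mv Y K (w l)) v" by (rule ip_mv[OF Y(2)])
    also have "\<dots> = ip Y (\<lambda>i. \<mu> l * w l i) v" by (intro ip_cong refl eigbasis_mv[OF Y(1) eb that])
    finally show ?thesis by (simp add: ip_scale_left)
  qed
  then show ?thesis
    unfolding eigbasis_parseval[OF Y(1) eb, symmetric]
    by (intro sum.cong refl) (simp add: norm_mult power_mult_distrib)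
qed

text \<open>Take an eigenvector whose eigenvalue has the largest modulus \<Lambda>. Moving it by at
  most \<open>1/4\<close> within the unit ball changes the quadratic form by at most
  \<open>\<Lambda>/4 + \<Lambda>/4\<close>, whence \<open>\<Lambda> \<le> L + \<Lambda>/2\<close>.
  The form is used instead of the norm because it is linear in the Gaussian entries.\<close>

lemma herm_norm_le_net:
  assumes Y: "finite Y" "herm Y K" and L: "L \<ge> 0"
    and net: "\<And>v. nsq Y v = 1 \<Longrightarrow> \<exists>y. nsq Y y \<le> 1 \<and> nsq Y (\<lambda>i. v i - y i) \<le> 1 / 16 \<and>
      cmod (ip Y y (mv Y K y)) \<le> L"
  shows "nsq Y (mv Y K v) \<le> (2 * L)\<^sup>2 * nsq Y v"
proof -
  obtain w \<mu> where eb: "eigbasis Y K w \<mu>" using hermitian_eigbasis[OF Y] by blast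
  define \<Lambda> where "\<Lambda> = Max ((\<lambda>l. \<bar>\<mu> l\<bar>) ` {..<card Y})"
  have le: "nsq Y (mv Y K u) \<le> \<Lambda>\<^sup>2 * nsq Y u" for u
    unfolding eigbasis_nsq_mv[OF Y eb] eigbasis_parseval[OF Y(1) eb, of u, symmetric] sum_distrib_left
  proof (intro sum_mono mult_right_mono)
    fix l assume "l \<in> {..<card Y}"
    then have "\<bar>\<mu> l\<bar> \<le> \<Lambda>" unfolding \<Lambda>_def by (intro Max_ge) auto
    from power_mono[OF this, of 2] show "(\<mu> l)\<^sup>2 \<le> \<Lambda>\<^sup>2" by simp
  qed simp
  show ?thesis
  proof (cases "Y = {}")
    case True
    then show ?thesis by (simp add: nsq_def)
  next
    case False
    then have "(\<lambda>l. \<bar>\<mu> l\<bar>) ` {..<card Y} \<noteq> {}" using Y by (auto simp: card_gt_0_iff lessThan_empty_iff)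
    then have "\<Lambda> \<in> (\<lambda>l. \<bar>\<mu> l\<bar>) ` {..<card Y}" unfolding \<Lambda>_def by (intro Max_in) auto
    then obtain k where k: "k < card Y" "\<Lambda> = \<bar>\<mu> k\<bar>" by auto
    have \<Lambda>0: "\<Lambda> \<ge> 0" using k by simp
    have wk: "nsq Y (w k) = 1" using eigbasis_ip[OF Y(1) eb k(1) k(1)] by (simp add: ip_self)
    obtain y where y: "nsq Y y \<le> 1" "nsq Y (\<lambda>i. w k i - y i) \<le> 1 / 16" "cmod (ip Y y (mv Y K y)) \<le> L"
      using net[OF wk] by blast
    define d where "d i = w k i - y i" for i
    have "nsq Y d \<le> 1 / 16" using y(2) unfolding d_def .
    from real_sqrt_le_mono[OF this] have sd: "sqrt (nsq Y d) \<le> 1 / 4" by (simp add: real_sqrt_divide)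
    have smv: "sqrt (nsq Y (mv Y K u)) \<le> \<Lambda> * sqrt (nsq Y u)" for u
      using real_sqrt_le_mono[OF le[of u]] \<Lambda>0 by (simp add: real_sqrt_mult)
    have "ip Y (w k) (mv Y K (w k)) = ip Y (w k) (\<lambda>i. \<mu> k * w k i)"
      by (intro ip_cong refl eigbasis_mv[OF Y(1) eb k(1)])
    then have ik: "cmod (ip Y (w k) (mv Y K (w k))) = \<Lambda>"
      by (simp add: ip_scale_right ip_self wk k(2))
    have "ip Y (w k) (mv Y K (w k)) = ip Y d (mv Y K (w k)) + ip Y y (mv Y K d) + ip Y y (mv Y K y)"
    proof -
      have 1: "ip Y (w k) (mv Y K (w k)) = ip Y d (mv Y K (w k)) + ip Y y (mv Y K (w k))"
        unfolding d_def ip_diff_left by simp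
      have "mv Y K (w k) = (\<lambda>i. mv Y K d i + mv Y K y i)"
        unfolding mv_add[symmetric] by (simp add: d_def)
      then have 2: "ip Y y (mv Y K (w k)) = ip Y y (mv Y K d) + ip Y y (mv Y K y)"
        by (simp only: ip_add_right)
      show ?thesis unfolding 1 2 by simp
    qed
    then have "\<Lambda> \<le> cmod (ip Y d (mv Y K (w k))) + cmod (ip Y y (mv Y K d)) + cmod (ip Y y (mv Y K y))"
      unfolding ik[symmetric] by (metis add_mono_thms_linordered_semiring(3) norm_triangle_ineq order_trans)
    also have "cmod (ip Y d (mv Y K (w k))) \<le> 1 / 4 * \<Lambda>"
      using smv[of "w k"] wk sd \<Lambda>0
      by (intro order_trans[OF ip_cauchy_schwarz mult_mono]) auto
    also have "cmod (ip Y y (mv Y K d)) \<le> 1 * (\<Lambda> * (1 / 4))"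
      using y(1) \<Lambda>0 sd
      by (intro order_trans[OF ip_cauchy_schwarz mult_mono] order_trans[OF smv] mult_left_mono) auto
    finally have "\<Lambda> \<le> 2 * L" using y(3) by simp
    then have "\<Lambda>\<^sup>2 \<le> (2 * L)\<^sup>2" using \<Lambda>0 by (intro power_mono)
    then show ?thesis using le[of v] by (meson mult_right_mono nsq_nonneg order_trans)
  qed
qed

definition cvec :: "('i \<times> bool \<Rightarrow> real) \<Rightarrow> 'i \<Rightarrow> complex" where
  "cvec \<zeta> i = Complex (\<zeta> (i,False)) (\<zeta> (i,True))"

lemma nsq_cvec: "nsq Y (cvec \<zeta>) = (\<Sum>k\<in>Y \<times> UNIV. (\<zeta> k)\<^sup>2)"
  by (simp add: nsq_def cvec_def cmod_power2 sum.cartesian_product' sum_bool)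

lemma cvec_diff: "cvec \<xi> i - cvec \<zeta> i = cvec (\<lambda>k. \<xi> k - \<zeta> k) i"
  by (simp add: cvec_def complex_eq_iff)

lemma unit_ball_net_complex:
  fixes Y :: "'i set" and \<eta> :: real
  assumes fin: "finite Y" and \<eta>: "0 < \<eta>" "\<eta> \<le> 1"
  obtains Z :: "('i \<Rightarrow> complex) set" where "finite Z" "real (card Z) \<le> (9 / \<eta>) ^ (2 * card Y)"
    "\<And>y. y \<in> Z \<Longrightarrow> nsq Y y \<le> 1"
    "\<And>v. nsq Y v \<le> 1 \<Longrightarrow> \<exists>y\<in>Z. nsq Y (\<lambda>i. v i - y i) \<le> \<eta>\<^sup>2"
proof -
  have fin2: "finite (Y \<times> (UNIV :: bool set))" using fin by simp
  obtain Z :: "('i \<times> bool \<Rightarrow> real) set" where Z: "finite Z" "real (card Z) \<le> (9 / \<eta>) ^ card (Y \<times> (UNIV :: bool set))"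
    "\<And>\<zeta>. \<zeta> \<in> Z \<Longrightarrow> (\<Sum>k\<in>Y \<times> UNIV. (\<zeta> k)\<^sup>2) \<le> 1"
    "\<And>\<xi>. (\<Sum>k\<in>Y \<times> UNIV. (\<xi> k)\<^sup>2) \<le> 1 \<Longrightarrow> \<exists>\<zeta>\<in>Z. (\<Sum>k\<in>Y \<times> UNIV. (\<xi> k - \<zeta> k)\<^sup>2) \<le> \<eta>\<^sup>2"
    by (rule unit_ball_net[OF fin2 \<eta>]) blast
  show ?thesis
  proof (rule that[of "cvec ` Z"])
    show "finite (cvec ` Z)" using Z(1) by simp
    have "real (card (cvec ` Z)) \<le> real (card Z)" using card_image_le[OF Z(1)] by (simp add: of_nat_mono)
    then show "real (card (cvec ` Z)) \<le> (9 / \<eta>) ^ (2 * card Y)"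
      using Z(2) by (simp add: card_cartesian_product mult.commute)
    show "nsq Y y \<le> 1" if "y \<in> cvec ` Z" for y using that Z(3) by (auto simp: nsq_cvec)
    show "\<exists>y\<in>cvec ` Z. nsq Y (\<lambda>i. v i - y i) \<le> \<eta>\<^sup>2" if v: "nsq Y v \<le> 1" for v
    proof -
      define \<xi> where "\<xi> = (\<lambda>(i,b). if b then Im (v i) else Re (v i))"
      have v': "v = cvec \<xi>" by (rule ext) (simp add: cvec_def \<xi>_def complex_eq_iff)
      obtain \<zeta> where "\<zeta> \<in> Z" "(\<Sum>k\<in>Y \<times> UNIV. (\<xi> k - \<zeta> k)\<^sup>2) \<le> \<eta>\<^sup>2"
        using Z(4)[of \<xi>] v unfolding v' nsq_cvec by blast
      then show ?thesis unfolding v' by (intro bexI[of _ "cvec \<zeta>"]) (simp_all add: cvec_diff nsq_cvec)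
    qed
  qed
qed

definition vent :: "(nat \<times> nat \<times> bool \<Rightarrow> real) \<Rightarrow> nat \<Rightarrow> nat \<Rightarrow> complex" where
  "vent = hent (\<lambda>_ _. 0)"

lemma hent_split: "hent H0 \<omega> i j = H0 i j + vent \<omega> i j"
  by (simp add: hent_def vent_def)

lemma herm_vent: "herm Y (vent \<omega>)"
  unfolding vent_def by (intro herm_hent) (simp add: herm_def)

text \<open>The adjoint half contributes the conjugate of what the first half contributes, so the
  form is twice a real part: a real linear form in independent Gaussians, to which a scalar tail
  bound applies.\<close>

lemma vent_form:
  "ip {..<D} y (mv {..<D} (vent \<omega>) y) = complex_of_real (\<Sum>(i,j,b)\<in>{..<D} \<times> {..<D} \<times> UNIV.
     (if b then - sqrt 2 * Im (cnj (y i) * y j) else sqrt 2 * Re (cnj (y i) * y j)) * \<omega> (i,j,b))"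
proof -
  define c where "c i j = cnj (y i) * y j" for i j
  have cs: "cnj (c i j) = c j i" for i j by (simp add: c_def)
  have "ip {..<D} y (mv {..<D} (vent \<omega>) y) = (\<Sum>i<D. \<Sum>j<D. c i j * aent \<omega> i j / sqrt 2) + (\<Sum>i<D. \<Sum>j<D. c i j * cnj (aent \<omega> j i) / sqrt 2)"
    unfolding ip_def mv_def vent_def hent_def c_def
    by (simp add: sum_distrib_left sum.distrib[symmetric] field_simps)
  also have "(\<Sum>i<D. \<Sum>j<D. c i j * cnj (aent \<omega> j i) / sqrt 2) = (\<Sum>j<D. \<Sum>i<D. cnj (c j i * aent \<omega> j i / sqrt 2))"
    by (subst sum.swap) (simp add: cs)
  also have "(\<Sum>i<D. \<Sum>j<D. c i j * aent \<omega> i j / sqrt 2) + (\<Sum>j<D. \<Sum>i<D. cnj (c j i * aent \<omega> j i / sqrt 2))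
     = (\<Sum>i<D. \<Sum>j<D. complex_of_real (2 * Re (c i j * aent \<omega> i j / sqrt 2)))"
    unfolding sum.distrib[symmetric] by (simp only: complex_add_cnj)
  also have "\<dots> = complex_of_real (\<Sum>i<D. \<Sum>j<D. sqrt 2 * Re (c i j) * \<omega> (i,j,False) - sqrt 2 * Im (c i j) * \<omega> (i,j,True))"
  proof -
    have s2: "2 * (x / sqrt 2) = sqrt 2 * x" for x by (metis mult.commute real_div_sqrt times_divide_eq_left zero_le_numeral)
    have "2 * Re (c i j * aent \<omega> i j / sqrt 2) = sqrt 2 * Re (c i j) * \<omega> (i,j,False) - sqrt 2 * Im (c i j) * \<omega> (i,j,True)" for i j
      by (simp only: Re_divide_of_real s2) (simp add: aent_def algebra_simps)
    then show ?thesis by simp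
  qed
  finally show ?thesis
    by (simp add: sum.cartesian_product' sum_bool c_def)
qed

text \<open>At a net point the form has variance at most \<open>\<sigma>^2\<close>, hence its
  modulus reaches \<open>6 \<sigma> sqrt D\<close> with probability at most
  \<open>2 exp (-18 D)\<close>. The net of mesh \<open>1/4\<close> has at most
  \<open>36^(2 D) = 1296^D\<close> points, and \<open>1296 exp (-18) \<le> 1/128\<close>. Passing
  from the form to the norm doubles the threshold, which is the origin of the constant 12.\<close>

lemma vent_norm_bound:
  fixes s :: "nat \<Rightarrow> nat \<Rightarrow> real" and \<sigma> :: real
  assumes s: "\<And>i j. s i j > 0" and \<sigma>: "\<sigma> > 0"
    and s_le: "\<And>i j. i < D \<Longrightarrow> j < D \<Longrightarrow> (s i j)\<^sup>2 \<le> \<sigma>\<^sup>2 / 2" and D: "D > 0"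
  obtains A where "A \<in> sets (GS D s)" "measure (GS D s) A \<le> 2 * (1 / 128) ^ D"
    "\<And>\<omega> v. \<omega> \<in> space (GS D s) - A \<Longrightarrow>
       nsq {..<D} (mv {..<D} (vent \<omega>) v) \<le> (12 * \<sigma> * sqrt D)\<^sup>2 * nsq {..<D} v"
proof -
  let ?Y = "{..<D}"
  let ?I = "?Y \<times> ?Y \<times> (UNIV::bool set)"
  interpret prob_space "GS D s" by (rule prob_space_GS) (rule s)
  obtain Z :: "(nat \<Rightarrow> complex) set" where Z: "finite Z" "real (card Z) \<le> (9 / (1/4)) ^ (2 * card ?Y)"
    "\<And>y. y \<in> Z \<Longrightarrow> nsq ?Y y \<le> 1"
    "\<And>v. nsq ?Y v \<le> 1 \<Longrightarrow> \<exists>y\<in>Z. nsq ?Y (\<lambda>i. v i - y i) \<le> (1/4)\<^sup>2"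
    by (rule unit_ball_net_complex[of ?Y "1/4"]) auto
  define L where "L = 6 * \<sigma> * sqrt D"
  have L: "L > 0" using \<sigma> D by (simp add: L_def)
  define c where "c y i j = cnj (y i) * y j" for y :: "nat \<Rightarrow> complex" and i j
  define \<alpha> where "\<alpha> y = (\<lambda>(i,j,b). if b then - sqrt 2 * Im (c y i j) else sqrt 2 * Re (c y i j))" for y :: "nat \<Rightarrow> complex"
  define s' where "s' = (\<lambda>(i,j,b::bool). s i j)"
  have GS: "GS D s = PiM ?I (\<lambda>u. gN (s' u))"
    unfolding GS_def s'_def by (simp add: case_prod_unfold)
  have form: "ip ?Y y (mv ?Y (vent \<omega>) y) = complex_of_real (\<Sum>u\<in>?I. \<alpha> y u * \<omega> u)" for y \<omega>
    unfolding vent_form \<alpha>_def c_def by (intro arg_cong[where f = complex_of_real] sum.cong refl) auto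
  define S where "S y = {\<omega> \<in> space (GS D s). L \<le> \<bar>\<Sum>u\<in>?I. \<alpha> y u * \<omega> u\<bar>}" for y
  have [measurable]: "(\<lambda>\<omega>. \<Sum>u\<in>?I. \<alpha> y u * \<omega> u) \<in> borel_measurable (GS D s)" for y
    unfolding GS by measurable
  have Sm: "S y \<in> events" for y unfolding S_def by measurable
  have SP: "prob (S y) \<le> 2 * exp (- 18 * real D)" if y: "nsq ?Y y \<le> 1" for y
  proof -
    have "(\<Sum>u\<in>?I. (\<alpha> y u)\<^sup>2 * (s' u)\<^sup>2) = (\<Sum>i<D. \<Sum>j<D. 2 * (cmod (y i))\<^sup>2 * (cmod (y j))\<^sup>2 * (s i j)\<^sup>2)"
    proof -
      have "(sqrt 2 * Re c)\<^sup>2 * x + (sqrt 2 * Im c)\<^sup>2 * x = 2 * (cmod c)\<^sup>2 * x" for c x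
        by (simp add: power_mult_distrib cmod_power2 algebra_simps)
      then have "(\<Sum>u\<in>?I. (\<alpha> y u)\<^sup>2 * (s' u)\<^sup>2) = (\<Sum>i<D. \<Sum>j<D. 2 * (cmod (c y i j))\<^sup>2 * (s i j)\<^sup>2)"
        by (simp add: sum.cartesian_product' sum_bool \<alpha>_def s'_def)
      then show ?thesis by (simp add: c_def norm_mult power_mult_distrib mult.assoc)
    qed
    also have "\<dots> \<le> (\<Sum>i<D. \<Sum>j<D. 2 * (cmod (y i))\<^sup>2 * (cmod (y j))\<^sup>2 * (\<sigma>\<^sup>2 / 2))"
      using s_le by (intro sum_mono mult_left_mono) auto
    also have "\<dots> = \<sigma>\<^sup>2 * (nsq ?Y y * nsq ?Y y)"
      unfolding nsq_def sum_product by (simp add: sum_distrib_left mult_ac)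
    also have "\<dots> \<le> \<sigma>\<^sup>2 * (1 * 1)" using y by (intro mult_left_mono mult_mono) auto
    finally have V: "(\<Sum>u\<in>?I. (\<alpha> y u)\<^sup>2 * (s' u)\<^sup>2) \<le> \<sigma>\<^sup>2" by simp
    have e: "exp (- L\<^sup>2 / (2 * \<sigma>\<^sup>2)) = exp (- 18 * real D)"
      using \<sigma> by (simp add: L_def power_mult_distrib)
    have 1: "prob {\<omega> \<in> space (GS D s). L \<le> (\<Sum>u\<in>?I. \<alpha> y u * \<omega> u)} \<le> exp (- 18 * real D)"
      unfolding GS e[symmetric] by (rule gauss_linear_tail) (use s \<sigma> L V in \<open>auto simp: s'_def\<close>)
    have 2: "prob {\<omega> \<in> space (GS D s). L \<le> (\<Sum>u\<in>?I. - \<alpha> y u * \<omega> u)} \<le> exp (- 18 * real D)"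
      unfolding GS e[symmetric] by (rule gauss_linear_tail) (use s \<sigma> L V in \<open>auto simp: s'_def\<close>)
    have "S y \<subseteq> {\<omega> \<in> space (GS D s). L \<le> (\<Sum>u\<in>?I. \<alpha> y u * \<omega> u)}
       \<union> {\<omega> \<in> space (GS D s). L \<le> (\<Sum>u\<in>?I. - \<alpha> y u * \<omega> u)}"
      by (auto simp: S_def sum_negf)
    then have "prob (S y) \<le> prob ({\<omega> \<in> space (GS D s). L \<le> (\<Sum>u\<in>?I. \<alpha> y u * \<omega> u)}
       \<union> {\<omega> \<in> space (GS D s). L \<le> (\<Sum>u\<in>?I. - \<alpha> y u * \<omega> u)})"
      by (intro finite_measure_mono) (simp_all add: sum_negf)
    also have "\<dots> \<le> prob {\<omega> \<in> space (GS D s). L \<le> (\<Sum>u\<in>?I. \<alpha> y u * \<omega> u)}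
       + prob {\<omega> \<in> space (GS D s). L \<le> (\<Sum>u\<in>?I. - \<alpha> y u * \<omega> u)}"
      by (intro measure_Un_le) (simp_all add: sum_negf)
    finally show ?thesis using 1 2 by linarith
  qed
  show ?thesis
  proof (rule that[of "\<Union>y\<in>Z. S y"])
    show "(\<Union>y\<in>Z. S y) \<in> events" using Z(1) Sm by auto
    have "prob (\<Union>y\<in>Z. S y) \<le> (\<Sum>y\<in>Z. prob (S y))"
      using Z(1) Sm by (intro finite_measure_subadditive_finite) auto
    also have "\<dots> \<le> (\<Sum>y\<in>Z. 2 * exp (- 18 * real D))" by (intro sum_mono SP Z(3))
    also have "\<dots> \<le> 36 ^ (2 * D) * (2 * exp (- 18 * real D))"
      using Z(2) by (simp add: mult_right_mono)
    also have "\<dots> = 2 * (1296 * exp (- 18)) ^ D"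
    proof -
      have "(36::real) ^ (2 * D) = 1296 ^ D" by (simp add: power_mult)
      then show ?thesis using exp_of_nat_mult[of D "-18::real"] by (simp add: power_mult_distrib mult.commute)
    qed
    also have "\<dots> \<le> 2 * (1 / 128) ^ D"
    proof (intro mult_left_mono power_mono)
      have "(2::real) \<le> exp 1" using exp_ge_add_one_self[of 1] by simp
      then have "(2::real) ^ 18 \<le> exp 1 ^ 18" by (intro power_mono) auto
      also have "exp 1 ^ 18 = exp (18::real)" using exp_of_nat_mult[of 18 "1::real"] by simp
      finally show "1296 * exp (- 18) \<le> (1 / 128 :: real)" by (simp add: exp_minus field_simps)
    qed auto
    finally show "prob (\<Union>y\<in>Z. S y) \<le> 2 * (1 / 128) ^ D" .
    fix \<omega> v assume \<omega>: "\<omega> \<in> space (GS D s) - (\<Union>y\<in>Z. S y)"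
    have "nsq ?Y (mv ?Y (vent \<omega>) v) \<le> (2 * L)\<^sup>2 * nsq ?Y v"
    proof (rule herm_norm_le_net)
      fix v :: "nat \<Rightarrow> complex" assume "nsq ?Y v = 1"
      then obtain y where y: "y \<in> Z" "nsq ?Y (\<lambda>i. v i - y i) \<le> (1/4)\<^sup>2" using Z(4)[of v] by auto
      have "\<omega> \<notin> S y" using \<omega> y(1) by auto
      then have "cmod (ip ?Y y (mv ?Y (vent \<omega>) y)) \<le> L"
        using \<omega> unfolding form norm_of_real by (auto simp: S_def)
      then show "\<exists>y. nsq ?Y y \<le> 1 \<and> nsq ?Y (\<lambda>i. v i - y i) \<le> 1 / 16 \<and> cmod (ip ?Y y (mv ?Y (vent \<omega>) y)) \<le> L"
        using y Z(3)[OF y(1)] by (auto simp: power_divide)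
    qed (use L herm_vent in auto)
    then show "nsq ?Y (mv ?Y (vent \<omega>) v) \<le> (12 * \<sigma> * sqrt D)\<^sup>2 * nsq ?Y v"
      by (simp add: L_def mult.assoc)
  qed
qed

section \<open>Mass of eigenvectors on a block\<close>

lemma mv_disjoint_union:
  assumes "finite Y" "finite P" "Y \<inter> P = {}"
  shows "mv (Y \<union> P) K v i = mv Y K v i + mv P K v i"
  using assms by (simp add: mv_def sum.union_disjoint)

lemma nsq_mono: "finite I \<Longrightarrow> X \<subseteq> I \<Longrightarrow> nsq X u \<le> nsq I u"
  unfolding nsq_def by (intro sum_mono2) auto

lemma nsq_uminus: "nsq I (\<lambda>i. - u i) = nsq I u"
  by (simp add: nsq_def)

lemma sqrt_nsq_diff_le: "sqrt (nsq I (\<lambda>i. u i - v i)) \<le> sqrt (nsq I u) + sqrt (nsq I v)"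
  using sqrt_nsq_add_le[of I u "\<lambda>i. - v i"] by (simp add: nsq_uminus)

lemma sqrt_nsq_scale: "sqrt (nsq I (\<lambda>i. c * u i)) = cmod c * sqrt (nsq I u)"
  by (simp add: nsq_scale real_sqrt_mult)

lemma mv_restrict_le:
  assumes I: "finite I" "X \<subseteq> I" "Z \<subseteq> I" and \<Lambda>: "\<Lambda> \<ge> 0"
    and norm: "\<And>v. nsq I (mv I K v) \<le> \<Lambda>\<^sup>2 * nsq I v"
  shows "sqrt (nsq X (mv Z K u)) \<le> \<Lambda> * sqrt (nsq Z u)"
proof -
  define u' where "u' i = (if i \<in> Z then u i else 0)" for i
  have "mv I K u' = mv Z K u"
    unfolding mv_def u'_def using I by (intro ext sum.mono_neutral_cong_right) auto
  moreover have "nsq I u' = nsq Z u"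
    unfolding nsq_def u'_def using I by (intro sum.mono_neutral_cong_right) auto
  ultimately have "nsq X (mv Z K u) \<le> \<Lambda>\<^sup>2 * nsq Z u"
    using norm[of u'] nsq_mono[OF I(1,2), of "mv Z K u"] by simp
  from real_sqrt_le_mono[OF this] show ?thesis using \<Lambda> by (simp add: real_sqrt_mult)
qed

text \<open>The deterministic core. On \<open>Y\<close> the vector solves the eigenvalue equation of
  \<open>H_YY\<close> up to \<open>5 \<Lambda> s\<close>; spectral coefficients outside the window
  are divided by at least \<open>r/2\<close>, so their norm is at most
  \<open>10 \<Lambda> s / r = 10 \<eta>\<close>. The rows in \<open>P\<close> of the full equation
  then force \<open>H_PY\<close> to be small on the window part, and a net point near its
  coefficients inherits this.\<close>

lemma small_mass_window:
  assumes fin: "finite Y" "finite P" and disj: "Y \<inter> P = {}" and herm: "herm Y K"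
    and norm: "\<And>v. nsq (Y \<union> P) (mv (Y \<union> P) K v) \<le> \<Lambda>\<^sup>2 * nsq (Y \<union> P) v" and \<Lambda>: "\<Lambda> > 0"
    and \<rho>: "0 < \<rho>" "\<rho> \<le> 1" and r: "r = \<rho> * \<Lambda>" and \<eta>: "s = \<rho> * \<eta>" "0 < \<eta>" "\<eta> \<le> 1 / 100"
    and v: "1 / 4 \<le> nsq (Y \<union> P) v" "nsq (Y \<union> P) v \<le> 1" "nsq P v \<le> (2 * s)\<^sup>2"
    and ev: "nsq (Y \<union> P) (\<lambda>i. mv (Y \<union> P) K v i - complex_of_real x * v i) \<le> (3 * \<Lambda> * s)\<^sup>2"
    and x: "\<bar>x\<bar> \<le> 2 * \<Lambda>" "\<bar>E - x\<bar> \<le> r / 2"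
    and eb: "eigbasis Y K w \<mu>"
    and W: "W = {l \<in> {..<card Y}. \<bar>\<mu> l - E\<bar> \<le> r}"
    and net: "\<And>c. nsq W c \<le> 1 \<Longrightarrow> \<exists>y\<in>Z. nsq W (\<lambda>i. c i - y i) \<le> \<eta>\<^sup>2"
  shows "\<exists>y\<in>Z. nsq W y \<ge> 1 / 16 \<and> nsq P (mv Y K (\<lambda>j. \<Sum>l\<in>W. y l * w l j)) \<le> (20 * \<Lambda> * \<eta>)\<^sup>2"
proof -
  let ?I = "Y \<union> P"
  have finI: "finite ?I" using fin by simp
  have s: "0 < s" "s \<le> \<eta>" using \<rho> \<eta> by (simp_all add: mult_left_le_one_le)
  have s1: "s \<le> 1 / 100" using s \<eta> by linarith
  have r0: "r > 0" using \<rho> \<Lambda> r by simp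
  define g where "g i = mv ?I K v i - complex_of_real x * v i" for i
  have gI: "sqrt (nsq ?I g) \<le> 3 * \<Lambda> * s"
    unfolding g_def using ev \<Lambda> s by (intro real_le_lsqrt) auto
  have gX: "sqrt (nsq X g) \<le> 3 * \<Lambda> * s" if "X \<subseteq> ?I" for X
    using real_sqrt_le_mono[OF nsq_mono[OF finI that, of g]] gI by linarith
  have vP: "sqrt (nsq P v) \<le> 2 * s" using v(3) s by (intro real_le_lsqrt) auto
  have restr: "sqrt (nsq X (mv Z K u)) \<le> \<Lambda> * sqrt (nsq Z u)" if "X \<subseteq> ?I" "Z \<subseteq> ?I" for X Z u
    by (rule mv_restrict_le[OF finI that _ norm]) (use \<Lambda> in simp)
  have mvP: "sqrt (nsq X (mv P K v)) \<le> 2 * \<Lambda> * s" if "X \<subseteq> ?I" for X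
  proof -
    have "sqrt (nsq X (mv P K v)) \<le> \<Lambda> * sqrt (nsq P v)" by (rule restr[OF that]) simp
    also have "\<dots> \<le> \<Lambda> * (2 * s)" using vP \<Lambda> by (intro mult_left_mono) auto
    finally show ?thesis by simp
  qed
  have split: "mv Y K v i = g i + complex_of_real x * v i - mv P K v i" for i
    using mv_disjoint_union[OF fin disj, of K v i] by (simp add: g_def)
  define c where "c l = ip Y (w l) v" for l
  define W' where "W' = {..<card Y} - W"
  have WW: "W \<subseteq> {..<card Y}" "W' \<subseteq> {..<card Y}" "W \<union> W' = {..<card Y}" "W \<inter> W' = {}"
    by (auto simp: W W'_def)
  have finW: "finite W" "finite W'" using WW(1,2) finite_subset by blast+
  have cW': "sqrt (nsq W' c) \<le> 10 * \<eta>"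
  proof -
    have "(r / 2)\<^sup>2 * nsq W' c \<le> (\<Sum>l\<in>W'. (cmod ((\<mu> l - x) * c l))\<^sup>2)"
      unfolding nsq_def sum_distrib_left
    proof (intro sum_mono)
      fix l assume "l \<in> W'"
      then have "\<bar>\<mu> l - E\<bar> > r" by (auto simp: W'_def W)
      then have "r / 2 \<le> \<bar>\<mu> l - x\<bar>" using x(2) by linarith
      then have "(r / 2)\<^sup>2 \<le> (\<mu> l - x)\<^sup>2" using r0 power_mono[of "r / 2" "\<bar>\<mu> l - x\<bar>" 2] by simp
      then show "(r / 2)\<^sup>2 * (cmod (c l))\<^sup>2 \<le> (cmod ((\<mu> l - x) * c l))\<^sup>2"
        by (simp add: norm_mult power_mult_distrib mult_right_mono flip: of_real_diff)
    qed
    also have "\<dots> \<le> (\<Sum>l<card Y. (cmod ((\<mu> l - x) * c l))\<^sup>2)"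
      using WW by (intro sum_mono2) auto
    also have "\<dots> = (\<Sum>l<card Y. (cmod (ip Y (w l) (\<lambda>i. mv Y K v i - complex_of_real x * v i)))\<^sup>2)"
    proof (intro sum.cong refl)
      fix l assume "l \<in> {..<card Y}"
      then have l: "l < card Y" by simp
      have "ip Y (w l) (mv Y K v) = ip Y (mv Y K (w l)) v" by (rule ip_mv[OF herm])
      also have "\<dots> = ip Y (\<lambda>i. \<mu> l * w l i) v" by (intro ip_cong refl eigbasis_mv[OF fin(1) eb l])
      finally show "(cmod ((\<mu> l - x) * c l))\<^sup>2 = (cmod (ip Y (w l) (\<lambda>i. mv Y K v i - complex_of_real x * v i)))\<^sup>2"
        by (simp add: ip_diff_right ip_scale_right ip_scale_left c_def algebra_simps)
    qed
    also have "\<dots> = nsq Y (\<lambda>i. mv Y K v i - complex_of_real x * v i)"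
      by (rule eigbasis_parseval[OF fin(1) eb])
    \<comment> \<open>\<open>3 \<Lambda> s\<close> is the residual of the full equation and
      \<open>2 \<Lambda> s\<close> the effect of the small part of \<open>v\<close> on
      \<open>P\<close>.\<close>
    also have "\<dots> \<le> (5 * \<Lambda> * s)\<^sup>2"
    proof -
      have "sqrt (nsq Y (\<lambda>i. mv Y K v i - complex_of_real x * v i)) = sqrt (nsq Y (\<lambda>i. g i - mv P K v i))"
        by (simp add: split)
      also have "\<dots> \<le> sqrt (nsq Y g) + sqrt (nsq Y (mv P K v))" by (rule sqrt_nsq_diff_le)
      also have "\<dots> \<le> 5 * \<Lambda> * s" using gX[of Y] mvP[of Y] by simp
      finally show ?thesis by (rule sqrt_le_D)
    qed
    finally have "nsq W' c \<le> (5 * \<Lambda> * s)\<^sup>2 / (r / 2)\<^sup>2" using r0 by (simp add: pos_le_divide_eq mult.commute)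
    also have "\<dots> = (10 * \<eta>)\<^sup>2"
      using \<rho> \<Lambda> by (simp add: r \<eta>(1) power_divide power_mult_distrib)
    finally show ?thesis using \<eta> by (intro real_le_lsqrt) auto
  qed
  have csum: "nsq W c + nsq W' c = nsq Y v"
    using eigbasis_parseval[OF fin(1) eb, of v] finW WW(3,4)
    by (simp add: nsq_def c_def flip: sum.union_disjoint)
  have vsum: "nsq Y v + nsq P v = nsq ?I v"
    using fin disj by (simp add: nsq_def sum.union_disjoint)
  have cW: "nsq W c \<le> 1" using csum vsum v(2) nsq_nonneg[of W' c] nsq_nonneg[of P v] by linarith
  have cW2: "1 / 9 \<le> nsq W c"
  proof -
    have "nsq W' c \<le> (10 * \<eta>)\<^sup>2" using cW' by (rule sqrt_le_D)
    also have "\<dots> \<le> (1 / 10)\<^sup>2" using \<eta> by (intro power_mono) auto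
    finally have "nsq W' c \<le> 1 / 100" by (simp add: power2_eq_square)
    moreover have "(2 * s)\<^sup>2 \<le> (1 / 50)\<^sup>2" using s s1 by (intro power_mono) auto
    then have "nsq P v \<le> 1 / 2500" using v(3) by (simp add: power2_eq_square)
    ultimately show ?thesis using csum vsum v(1) by linarith
  qed
  define yW where "yW j = (\<Sum>l\<in>W. c l * w l j)" for j
  define yW' where "yW' j = (\<Sum>l\<in>W'. c l * w l j)" for j
  have vy: "v j = yW j + yW' j" if "j \<in> Y" for j
    using eigbasis_expand[OF fin(1) eb that, of v] finW WW(3,4)
    by (simp add: yW_def yW'_def c_def flip: sum.union_disjoint)
  \<comment> \<open>In the rows of \<open>P\<close> the residual gives \<open>3 \<Lambda> s\<close>,
    the term \<open>x v\<close> gives \<open>4 \<Lambda> s\<close>, \<open>H_PP\<close> acting on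
    \<open>v\<close> gives \<open>2 \<Lambda> s\<close>, and the discarded coefficients give
    \<open>10 \<Lambda> \<eta>\<close>; now use \<open>s \<le> \<eta>\<close>.\<close>
  have AyW: "sqrt (nsq P (mv Y K yW)) \<le> 19 * \<Lambda> * \<eta>"
  proof -
    have "mv Y K v = mv Y K (\<lambda>j. yW j + yW' j)" by (rule mv_cong) (rule vy)
    then have "mv Y K yW i = mv Y K v i - mv Y K yW' i" for i by (simp add: mv_add)
    then have "mv Y K yW i = (g i + complex_of_real x * v i) - (mv P K v i + mv Y K yW' i)" for i
      by (simp add: split)
    then have "mv Y K yW = (\<lambda>i. (g i + complex_of_real x * v i) - (mv P K v i + mv Y K yW' i))"
      by (rule ext)
    then have "sqrt (nsq P (mv Y K yW)) \<le> sqrt (nsq P (\<lambda>i. g i + complex_of_real x * v i)) + sqrt (nsq P (\<lambda>i. mv P K v i + mv Y K yW' i))"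
      by (simp only: sqrt_nsq_diff_le)
    also have "sqrt (nsq P (\<lambda>i. g i + complex_of_real x * v i)) \<le> 3 * \<Lambda> * s + 2 * \<Lambda> * (2 * s)"
    proof -
      have "\<bar>x\<bar> * sqrt (nsq P v) \<le> 2 * \<Lambda> * (2 * s)" using x vP \<Lambda> by (intro mult_mono) auto
      then show ?thesis
        using sqrt_nsq_add_le[of P g "\<lambda>i. complex_of_real x * v i"] gX[of P] by (simp add: sqrt_nsq_scale)
    qed
    also have "sqrt (nsq P (\<lambda>i. mv P K v i + mv Y K yW' i)) \<le> 2 * \<Lambda> * s + \<Lambda> * (10 * \<eta>)"
    proof -
      have "sqrt (nsq P (mv Y K yW')) \<le> \<Lambda> * sqrt (nsq Y yW')" by (rule restr) auto
      also have "nsq Y yW' = nsq W' c"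
        unfolding yW'_def nsq_orthonormal_sum[OF fin(1) eb WW(2)] by (simp add: nsq_def)
      also have "\<Lambda> * sqrt (nsq W' c) \<le> \<Lambda> * (10 * \<eta>)" using cW' \<Lambda> by (intro mult_left_mono) auto
      finally show ?thesis
        using sqrt_nsq_add_le[of P "mv P K v" "mv Y K yW'"] mvP[of P] by simp
    qed
    finally have "sqrt (nsq P (mv Y K yW)) \<le> 9 * (\<Lambda> * s) + 10 * (\<Lambda> * \<eta>)" by simp
    also have "\<dots> \<le> 9 * (\<Lambda> * \<eta>) + 10 * (\<Lambda> * \<eta>)" using s \<Lambda> by simp
    finally show ?thesis by simp
  qed
  obtain y where y: "y \<in> Z" "nsq W (\<lambda>i. c i - y i) \<le> \<eta>\<^sup>2" using net[OF cW] by blast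
  define d where "d i = c i - y i" for i
  have dW: "sqrt (nsq W d) \<le> \<eta>" unfolding d_def using y(2) \<eta> by (intro real_le_lsqrt) auto
  have "1 / 4 \<le> sqrt (nsq W y)"
  proof -
    have "sqrt (1 / 9) \<le> sqrt (nsq W c)" using cW2 by (rule real_sqrt_le_mono)
    also have "\<dots> = sqrt (nsq W (\<lambda>i. d i + y i))" by (simp add: d_def)
    also have "\<dots> \<le> \<eta> + sqrt (nsq W y)" using sqrt_nsq_add_le[of W d y] dW by linarith
    finally have "1 / 3 \<le> 1 / 100 + sqrt (nsq W y)" using \<eta> by (simp add: real_sqrt_divide)
    then show ?thesis by linarith
  qed
  then have "(1 / 4)\<^sup>2 \<le> (sqrt (nsq W y))\<^sup>2" by (intro power_mono) auto
  then have yn: "1 / 16 \<le> nsq W y" by (simp add: power2_eq_square)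
  have "sqrt (nsq P (mv Y K (\<lambda>j. \<Sum>l\<in>W. y l * w l j))) \<le> 20 * \<Lambda> * \<eta>"
  proof -
    have "(\<lambda>j. \<Sum>l\<in>W. y l * w l j) = (\<lambda>j. yW j - (\<Sum>l\<in>W. d l * w l j))"
      by (simp add: yW_def d_def algebra_simps sum_subtractf)
    then have "sqrt (nsq P (mv Y K (\<lambda>j. \<Sum>l\<in>W. y l * w l j)))
       \<le> sqrt (nsq P (mv Y K yW)) + sqrt (nsq P (mv Y K (\<lambda>j. \<Sum>l\<in>W. d l * w l j)))"
      using sqrt_nsq_diff_le by (simp add: mv_diff)
    also have "sqrt (nsq P (mv Y K (\<lambda>j. \<Sum>l\<in>W. d l * w l j))) \<le> \<Lambda> * sqrt (nsq Y (\<lambda>j. \<Sum>l\<in>W. d l * w l j))"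
      by (rule restr) auto
    also have "nsq Y (\<lambda>j. \<Sum>l\<in>W. d l * w l j) = nsq W d"
      unfolding nsq_orthonormal_sum[OF fin(1) eb WW(1)] by (simp add: nsq_def)
    also have "\<Lambda> * sqrt (nsq W d) \<le> \<Lambda> * \<eta>" using dW \<Lambda> by (intro mult_left_mono) auto
    finally show ?thesis using AyW by simp
  qed
  then have "nsq P (mv Y K (\<lambda>j. \<Sum>l\<in>W. y l * w l j)) \<le> (20 * \<Lambda> * \<eta>)\<^sup>2" by (rule sqrt_le_D)
  then show ?thesis using y(1) yn by blast
qed

section \<open>Approximate eigenvectors with little mass on the block: freezing, nets and the small
  ball estimate\<close>

context
  fixes D :: nat and s :: "nat \<Rightarrow> nat \<Rightarrow> real" and \<sigma> :: real and H0 :: "nat \<Rightarrow> nat \<Rightarrow> complex"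
    and P Y :: "nat set"
  assumes s: "\<And>i j. s i j > 0" and \<sigma>: "\<sigma> > 0"
    and s_ge: "\<And>i j. i < D \<Longrightarrow> j < D \<Longrightarrow> (s i j)\<^sup>2 \<ge> \<sigma>\<^sup>2 / 2"
    and H0: "herm {..<D} H0"
    and PY: "Y \<union> P = {..<D}" "Y \<inter> P = {}" and P0: "P \<noteq> {}"
begin

lemma finPY: "finite P" "finite Y"
  using PY(1) by (metis finite_Un finite_lessThan)+

lemma mv_hent_measurable:
  assumes "i < D" "Z \<subseteq> {..<D}"
  shows "(\<lambda>\<omega>. mv Z (hent H0 \<omega>) v i) \<in> borel_measurable (GS D s)"
  unfolding mv_def using assms
  by (intro borel_measurable_sum borel_measurable_times hent_measurable borel_measurable_const) auto

lemma nsq_mv_hent_measurable: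
  assumes "X \<subseteq> {..<D}" "Z \<subseteq> {..<D}"
  shows "(\<lambda>\<omega>. nsq X (\<lambda>i. mv Z (hent H0 \<omega>) v i - c i)) \<in> borel_measurable (GS D s)"
proof -
  have [measurable]: "(\<lambda>\<omega>. mv Z (hent H0 \<omega>) v i) \<in> borel_measurable (GS D s)" if "i \<in> X" for i
    using mv_hent_measurable[of i Z v] assms that by auto
  show ?thesis unfolding nsq_def by measurable
qed

text \<open>Averaged are the \<open>a_ij\<close> with \<open>i\<close> in \<open>P\<close> and
  \<open>j\<close> in \<open>Y\<close>; the mirrored entries \<open>cnj a_ji\<close> and all of
  \<open>H_YY\<close> stay frozen in \<omega>, so \<open>y\<close> may be built from
  \<open>H_YY\<close>. The rows of \<open>H_PY y\<close> are independent, and each complex row gives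
  one factor of order \<open>\<tau>^2 / (card P * \<sigma>^2)\<close>.\<close>

lemma block_small_prob:
  fixes y :: "nat \<Rightarrow> complex" and \<omega>
  assumes y: "nsq Y y \<ge> 1 / 16" and \<tau>: "\<tau> > 0"
  defines "I \<equiv> {..<D} \<times> {..<D} \<times> (UNIV :: bool set)" and "J \<equiv> P \<times> Y \<times> (UNIV :: bool set)"
    and "M \<equiv> (\<lambda>(i,j,b::bool). gN (s i j))"
  shows "measure (PiM J M) {x \<in> space (PiM J M). nsq P (mv Y (hent H0 (merge (I - J) J (\<omega>, x))) y) \<le> \<tau>\<^sup>2}
     \<le> (32 * exp 1 * \<tau>\<^sup>2 / (card P * \<sigma>\<^sup>2)) ^ card P"
proof -
  define n where "n = card P"
  have n: "n > 0" using P0 finPY by (simp add: n_def card_gt_0_iff)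
  \<comment> \<open>With this choice the prefactor is one \<open>exp 1\<close> per row.\<close>
  define \<theta> where "\<theta> = n / \<tau>\<^sup>2"
  have \<theta>: "\<theta> > 0" using n \<tau> by (simp add: \<theta>_def)
  define \<beta> where "\<beta> i i' j = (if i = i' then y j / sqrt 2 else 0)" for i i' :: nat and j
  define c where "c i = (\<Sum>j\<in>Y. (H0 i j + cnj (aent \<omega> j i) / sqrt 2) * y j)" for i
  have form: "mv Y (hent H0 (merge (I - J) J (\<omega>, x))) y i
      = c i + (\<Sum>i'\<in>P. \<Sum>j\<in>Y. \<beta> i i' j * Complex (x (i',j,False)) (x (i',j,True)))" if i: "i \<in> P" for i x
  proof -
    have "(\<Sum>i'\<in>P. \<Sum>j\<in>Y. \<beta> i i' j * Complex (x (i',j,False)) (x (i',j,True)))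
       = (\<Sum>i'\<in>P. if i = i' then \<Sum>j\<in>Y. y j / sqrt 2 * Complex (x (i',j,False)) (x (i',j,True)) else 0)"
      by (intro sum.cong refl) (simp add: \<beta>_def)
    also have "\<dots> = (\<Sum>j\<in>Y. y j / sqrt 2 * Complex (x (i,j,False)) (x (i,j,True)))"
      using i finPY by simp
    finally have 1: "(\<Sum>i'\<in>P. \<Sum>j\<in>Y. \<beta> i i' j * Complex (x (i',j,False)) (x (i',j,True)))
      = (\<Sum>j\<in>Y. y j / sqrt 2 * Complex (x (i,j,False)) (x (i,j,True)))" .
    have ent: "hent H0 (merge (I - J) J (\<omega>, x)) i j
        = H0 i j + cnj (aent \<omega> j i) / sqrt 2 + Complex (x (i,j,False)) (x (i,j,True)) / sqrt 2" if "j \<in> Y" for j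
      using i that PY
      by (auto simp: hent_def aent_def merge_def I_def J_def add_divide_distrib)
    show ?thesis
      unfolding 1 c_def mv_def sum.distrib[symmetric]
      by (intro sum.cong refl) (simp add: ent algebra_simps)
  qed
  have "measure (PiM J M) {x \<in> space (PiM J M). nsq P (mv Y (hent H0 (merge (I - J) J (\<omega>, x))) y) \<le> \<tau>\<^sup>2}
    = measure (PiM J M) {x \<in> space (PiM J M). (\<Sum>i\<in>P. (cmod (c i + (\<Sum>i'\<in>P. \<Sum>j\<in>Y. \<beta> i i' j * Complex (x (i',j,False)) (x (i',j,True)))))\<^sup>2) \<le> \<tau>\<^sup>2}"
    by (simp add: nsq_def form)
  \<comment> \<open>\<open>\<sigma>^2 / 64\<close> collects \<open>\<sigma>^2 / 2\<close> from the
    variance of a real coordinate, \<open>1/2\<close> from the normalisation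
    \<open>1 / sqrt 2\<close> and \<open>1/16\<close> from the lower bound on
    \<open>nsq Y y\<close>.\<close>
  also have "\<dots> \<le> exp (\<theta> * \<tau>\<^sup>2) * (\<Prod>i\<in>P. 1 / (1 + 2 * \<theta> * (\<sigma>\<^sup>2 / 64)))"
    unfolding J_def M_def
  proof (rule gauss_small_ball)
    fix \<zeta> :: "nat \<Rightarrow> complex"
    have z: "(\<Sum>l\<in>P. \<zeta> l * \<beta> l i j) = \<zeta> i * y j / sqrt 2" if "i \<in> P" for i j
    proof -
      have "(\<Sum>l\<in>P. \<zeta> l * \<beta> l i j) = (\<Sum>l\<in>P. if l = i then \<zeta> l * y j / sqrt 2 else 0)"
        by (intro sum.cong refl) (simp add: \<beta>_def)
      then show ?thesis using that finPY by simp
    qed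
    have "(\<Sum>l\<in>P. \<sigma>\<^sup>2 / 64 * (cmod (\<zeta> l))\<^sup>2) \<le> (\<Sum>l\<in>P. \<sigma>\<^sup>2 / 4 * (cmod (\<zeta> l))\<^sup>2 * nsq Y y)"
    proof (intro sum_mono)
      fix l
      have "\<sigma>\<^sup>2 / 4 * (cmod (\<zeta> l))\<^sup>2 * (1 / 16) \<le> \<sigma>\<^sup>2 / 4 * (cmod (\<zeta> l))\<^sup>2 * nsq Y y"
        using y by (intro mult_left_mono) auto
      then show "\<sigma>\<^sup>2 / 64 * (cmod (\<zeta> l))\<^sup>2 \<le> \<sigma>\<^sup>2 / 4 * (cmod (\<zeta> l))\<^sup>2 * nsq Y y" by simp
    qed
    also have "\<dots> = (\<Sum>i\<in>P. \<Sum>j\<in>Y. \<sigma>\<^sup>2 / 2 * (cmod (\<zeta> i * y j / sqrt 2))\<^sup>2)"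
      by (simp add: nsq_def sum_distrib_left norm_mult norm_divide power_mult_distrib power_divide mult.assoc)
    also have "\<dots> \<le> (\<Sum>i\<in>P. \<Sum>j\<in>Y. (s i j)\<^sup>2 * (cmod (\<Sum>l\<in>P. \<zeta> l * \<beta> l i j))\<^sup>2)"
    proof (intro sum_mono)
      fix i j assume "i \<in> P" "j \<in> Y"
      then have "\<sigma>\<^sup>2 / 2 \<le> (s i j)\<^sup>2" using PY(1) by (intro s_ge) auto
      then show "\<sigma>\<^sup>2 / 2 * (cmod (\<zeta> i * y j / sqrt 2))\<^sup>2 \<le> (s i j)\<^sup>2 * (cmod (\<Sum>l\<in>P. \<zeta> l * \<beta> l i j))\<^sup>2"
        unfolding z[OF \<open>i \<in> P\<close>] by (intro mult_right_mono) auto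
    qed
    finally show "(\<Sum>l\<in>P. \<sigma>\<^sup>2 / 64 * (cmod (\<zeta> l))\<^sup>2) \<le> (\<Sum>i\<in>P. \<Sum>j\<in>Y. (s i j)\<^sup>2 * (cmod (\<Sum>l\<in>P. \<zeta> l * \<beta> l i j))\<^sup>2)" .
  qed (use finPY s \<theta> in auto)
  also have "\<dots> = exp 1 ^ n * (1 / (1 + 2 * \<theta> * (\<sigma>\<^sup>2 / 64))) ^ n"
    using \<tau> exp_of_nat_mult[of n "1::real"] by (simp add: \<theta>_def n_def)
  also have "\<dots> \<le> exp 1 ^ n * (32 * \<tau>\<^sup>2 / (n * \<sigma>\<^sup>2)) ^ n"
  proof (intro mult_left_mono power_mono)
    have "1 / (1 + 2 * \<theta> * (\<sigma>\<^sup>2 / 64)) \<le> 1 / (2 * \<theta> * (\<sigma>\<^sup>2 / 64))"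
      using \<theta> \<sigma> by (intro divide_left_mono) (auto simp: add_pos_pos)
    also have "\<dots> = 32 * \<tau>\<^sup>2 / (n * \<sigma>\<^sup>2)" using n \<tau> by (simp add: \<theta>_def)
    finally show "1 / (1 + 2 * \<theta> * (\<sigma>\<^sup>2 / 64)) \<le> 32 * \<tau>\<^sup>2 / (n * \<sigma>\<^sup>2)" .
    show "0 \<le> 1 / (1 + 2 * \<theta> * (\<sigma>\<^sup>2 / 64))" using \<theta> by simp
  qed auto
  also have "\<dots> = (32 * exp 1 * \<tau>\<^sup>2 / (card P * \<sigma>\<^sup>2)) ^ card P"
    unfolding n_def by (simp add: power_mult_distrib[symmetric] mult_ac)
  finally show ?thesis .
qed

text \<open>Ranging over a finite net of vectors and a countable grid of eigenvalues makes this a measurable event.\<close>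

definition small_approx_eigvec :: "(nat \<Rightarrow> complex) set \<Rightarrow> real \<Rightarrow> real \<Rightarrow> (nat \<times> nat \<times> bool \<Rightarrow> real) \<Rightarrow> bool" where
  "small_approx_eigvec Z \<Lambda> t \<omega> \<longleftrightarrow> (\<exists>v\<in>Z. \<exists>k::int. \<bar>\<Lambda> * t * k\<bar> \<le> 2 * \<Lambda> \<and> 1 / 4 \<le> nsq (Y \<union> P) v \<and>
     nsq (Y \<union> P) v \<le> 1 \<and> nsq P v \<le> (2 * t)\<^sup>2 \<and>
     nsq (Y \<union> P) (\<lambda>i. mv (Y \<union> P) (hent H0 \<omega>) v i - complex_of_real (\<Lambda> * t * k) * v i) \<le> (3 * \<Lambda> * t)\<^sup>2)"

lemma small_approx_eigvec_measurable:
  assumes "finite Z"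
  shows "{\<omega> \<in> space (GS D s). small_approx_eigvec Z \<Lambda> t \<omega>} \<in> sets (GS D s)"
proof -
  have [measurable]: "(\<lambda>\<omega>. nsq (Y \<union> P) (\<lambda>i. mv (Y \<union> P) (hent H0 \<omega>) v i - c i)) \<in> borel_measurable (GS D s)" for v c
    by (rule nsq_mv_hent_measurable) (simp_all add: PY)
  have "{\<omega> \<in> space (GS D s). small_approx_eigvec Z \<Lambda> t \<omega>} = (\<Union>v\<in>Z. \<Union>k::int.
     {\<omega> \<in> space (GS D s). \<bar>\<Lambda> * t * k\<bar> \<le> 2 * \<Lambda> \<and> 1 / 4 \<le> nsq (Y \<union> P) v \<and>
     nsq (Y \<union> P) v \<le> 1 \<and> nsq P v \<le> (2 * t)\<^sup>2 \<and>
     nsq (Y \<union> P) (\<lambda>i. mv (Y \<union> P) (hent H0 \<omega>) v i - complex_of_real (\<Lambda> * t * k) * v i) \<le> (3 * \<Lambda> * t)\<^sup>2})"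
    unfolding small_approx_eigvec_def by blast
  also have "\<dots> \<in> sets (GS D s)"
    by (intro sets.finite_UN assms sets.countable_UN) (auto simp: image_subset_iff)
  finally show ?thesis .
qed

text \<open>Once all entries but those in \<open>P \<times> Y\<close> are frozen, windows and nets
  are deterministic, and the event is covered by the small ball events of the net points over all
  grid windows. A window holds at most \<open>2 T\<close> eigenvalues, so its net has at most
  \<open>(9/\<eta>)^(4 T)\<close> points against \<open>(\<eta>/9)^card P\<close> for each;
  \<open>4 T + 2 \<le> card P\<close> leaves two powers of \<open>\<eta>/9\<close>, one of which
  later pays for the grid. The size of \<open>Z\<close> does not enter.\<close>

lemma small_approx_eigvec_prob:
  fixes \<Lambda> \<rho> \<eta> T t r :: real and Grid :: "int set"
  assumes A: "A \<in> sets (GS D s)" and fZ: "finite Z"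
    and norm: "\<And>\<omega> v. \<omega> \<in> space (GS D s) - A \<Longrightarrow>
       nsq {..<D} (mv {..<D} (hent H0 \<omega>) v) \<le> \<Lambda>\<^sup>2 * nsq {..<D} v" and \<Lambda>: "\<Lambda> > 0"
    and \<rho>: "0 < \<rho>" "\<rho> \<le> 1" and r: "r = \<rho> * \<Lambda>" and \<eta>: "t = \<rho> * \<eta>" "0 < \<eta>" "\<eta> \<le> 1 / 100"
    and Grid: "finite Grid" "\<And>k::int. \<bar>real_of_int k\<bar> \<le> 2 / \<rho> + 1 \<Longrightarrow> k \<in> Grid"
    and T: "4 * T + 2 \<le> card P"
    and b: "32 * exp 1 * (20 * \<Lambda> * \<eta>)\<^sup>2 / (card P * \<sigma>\<^sup>2) \<le> \<eta> / 9"
  shows "measure (GS D s) {\<omega> \<in> space (GS D s). small_approx_eigvec Z \<Lambda> t \<omega> \<and> \<omega> \<notin> A \<and>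
     (\<forall>k\<in>Grid. Phi Y (hent H0 \<omega>) (Complex (r * k) r) < T)} \<le> card Grid * (\<eta> / 9)\<^sup>2"
    (is "measure _ ?S \<le> _")
proof -
  define I where "I = {..<D} \<times> {..<D} \<times> (UNIV :: bool set)"
  define J where "J = P \<times> Y \<times> (UNIV :: bool set)"
  define M where "M = (\<lambda>(i,j,b::bool). gN (s i j))"
  define \<tau> where "\<tau> = 20 * \<Lambda> * \<eta>"
  have \<tau>: "\<tau> > 0" using \<Lambda> \<eta> by (simp add: \<tau>_def)
  have r0: "r > 0" using r \<rho> \<Lambda> by simp
  have GS: "GS D s = PiM I M" by (simp add: GS_def I_def M_def)
  have Ysub: "Y \<subseteq> {..<D}" "P \<subseteq> {..<D}" using PY(1) by auto
  have [measurable]: "(\<lambda>\<omega>. Phi Y (hent H0 \<omega>) (Complex (r * k) r)) \<in> borel_measurable (GS D s)" for k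
    by (rule Phi_measurable[OF s \<sigma> s_ge H0 Ysub(1)]) (use r0 in auto)
  have Sm: "?S \<in> sets (PiM I M)"
  proof -
    have "?S = {\<omega> \<in> space (GS D s). small_approx_eigvec Z \<Lambda> t \<omega>} \<inter> (space (GS D s) - A) \<inter>
       {\<omega> \<in> space (GS D s). \<forall>k\<in>Grid. Phi Y (hent H0 \<omega>) (Complex (r * k) r) < T}" by auto
    moreover have "{\<omega> \<in> space (GS D s). \<forall>k\<in>Grid. Phi Y (hent H0 \<omega>) (Complex (r * k) r) < T} \<in> sets (GS D s)"
      using Grid(1) by measurable
    ultimately show ?thesis
      using small_approx_eigvec_measurable[OF fZ] A unfolding GS by simp
  qed
  show ?thesis unfolding GS
  proof (rule measure_PiM_section_le)
    show "finite I" by (simp add: I_def)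
    show JI: "J \<subseteq> I" using Ysub by (auto simp: I_def J_def)
    show prob: "prob_space (M i)" for i unfolding M_def by (cases i) (simp add: prob_space_gN s)
    show "{\<omega> \<in> space (PiM I M). small_approx_eigvec Z \<Lambda> t \<omega> \<and> \<omega> \<notin> A \<and>
     (\<forall>k\<in>Grid. Phi Y (hent H0 \<omega>) (Complex (r * k) r) < T)} \<in> sets (PiM I M)"
      using Sm by (simp add: GS)
    fix \<omega> assume \<omega>: "\<omega> \<in> space (PiM (I - J) M)"
    define m where "m x = merge (I - J) J (\<omega>, x)" for x
    interpret J: prob_space "PiM J M" by (intro prob_space_PiM prob)
    have IJ: "(I - J) \<union> J = I" using JI by auto
    have mm: "m \<in> measurable (PiM J M) (PiM I M)"
      using measurable_comp[OF measurable_Pair1'[OF \<omega>] measurable_merge[of "I - J" J M]]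
      unfolding IJ m_def by (simp add: comp_def)
    \<comment> \<open>Entries on \<open>Y\<close> are frozen, so the unspecified values inserted for
      the block are immaterial.\<close>
    define K0 where "K0 = hent H0 (m undefined)"
    have agree: "hent H0 (m x) i j = K0 i j" if "i \<in> Y" "j \<in> Y" for x i j
      using that PY Ysub by (auto simp: hent_def aent_def K0_def m_def merge_def J_def I_def)
    have Phi: "Phi Y (hent H0 (m x)) z = Phi Y K0 z" for x z
      by (intro Phi_cong agree; assumption)
    have eb_eq: "eigbasis Y (hent H0 (m x)) w \<mu> = eigbasis Y K0 w \<mu>" for x w \<mu>
      by (intro eigbasis_cong agree; assumption)
    have hK0: "herm Y K0" unfolding K0_def by (rule herm_hent_subset[OF s \<sigma> s_ge H0 Ysub(1)])
    let ?T = "{x \<in> space (PiM J M). m x \<in> {\<omega> \<in> space (PiM I M). small_approx_eigvec Z \<Lambda> t \<omega> \<and> \<omega> \<notin> A \<and>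
     (\<forall>k\<in>Grid. Phi Y (hent H0 \<omega>) (Complex (r * k) r) < T)}}"
    have "measure (PiM J M) ?T \<le> card Grid * (\<eta> / 9)\<^sup>2"
    proof (cases "\<forall>k\<in>Grid. Phi Y K0 (Complex (r * real_of_int k) r) < T")
      case False
      then have "?T = {}" using Phi by auto
      then show ?thesis by (metis measure_empty mult_nonneg_nonneg of_nat_0_le_iff zero_le_power2)
    next
      case True
      \<comment> \<open>Each grid point receives its own eigenbasis, because the count at that point
        is tied to the basis delivered with it.\<close>
      have "\<forall>k. \<exists>w \<mu>. eigbasis Y K0 w \<mu> \<and>
        real (card {l \<in> {..<card Y}. \<bar>\<mu> l - r * real_of_int k\<bar> \<le> r}) \<le> 2 * Phi Y K0 (Complex (r * real_of_int k) r)"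
      proof
        fix k :: int
        show "\<exists>w \<mu>. eigbasis Y K0 w \<mu> \<and>
          real (card {l \<in> {..<card Y}. \<bar>\<mu> l - r * real_of_int k\<bar> \<le> r}) \<le> 2 * Phi Y K0 (Complex (r * real_of_int k) r)"
          by (rule eig_count_le_Phi[OF finPY(2) hK0 r0, of "r * real_of_int k"]) blast
      qed
      from choice[OF this] obtain w where "\<forall>k. \<exists>\<mu>. eigbasis Y K0 (w k) \<mu> \<and>
        real (card {l \<in> {..<card Y}. \<bar>\<mu> l - r * real_of_int k\<bar> \<le> r}) \<le> 2 * Phi Y K0 (Complex (r * real_of_int k) r)" ..
      from choice[OF this] obtain \<mu> where eb_cnt: "\<forall>k. eigbasis Y K0 (w k) (\<mu> k) \<and>
        real (card {l \<in> {..<card Y}. \<bar>\<mu> k l - r * real_of_int k\<bar> \<le> r}) \<le> 2 * Phi Y K0 (Complex (r * real_of_int k) r)" ..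
      have eb: "eigbasis Y K0 (w k) (\<mu> k)" and
        cnt: "real (card {l \<in> {..<card Y}. \<bar>\<mu> k l - r * real_of_int k\<bar> \<le> r}) \<le> 2 * Phi Y K0 (Complex (r * real_of_int k) r)" for k
        using eb_cnt by blast+
      define W where "W k = {l \<in> {..<card Y}. \<bar>\<mu> k l - r * real_of_int k\<bar> \<le> r}" for k
      have finW: "finite (W k)" for k by (simp add: W_def)
      have "\<forall>k. \<exists>Zk :: (nat \<Rightarrow> complex) set. finite Zk \<and> real (card Zk) \<le> (9 / \<eta>) ^ (2 * card (W k)) \<and>
        (\<forall>c. nsq (W k) c \<le> 1 \<longrightarrow> (\<exists>y\<in>Zk. nsq (W k) (\<lambda>i. c i - y i) \<le> \<eta>\<^sup>2))"
      proof
        fix k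
        have e1: "\<eta> \<le> 1" using \<eta> by simp
        show "\<exists>Zk :: (nat \<Rightarrow> complex) set. finite Zk \<and> real (card Zk) \<le> (9 / \<eta>) ^ (2 * card (W k)) \<and>
          (\<forall>c. nsq (W k) c \<le> 1 \<longrightarrow> (\<exists>y\<in>Zk. nsq (W k) (\<lambda>i. c i - y i) \<le> \<eta>\<^sup>2))"
          by (rule unit_ball_net_complex[OF finW[of k] \<eta>(2) e1]) blast
      qed
      from choice[OF this] obtain N :: "int \<Rightarrow> (nat \<Rightarrow> complex) set" where
        "\<forall>k. finite (N k) \<and> real (card (N k)) \<le> (9 / \<eta>) ^ (2 * card (W k)) \<and>
        (\<forall>c. nsq (W k) c \<le> 1 \<longrightarrow> (\<exists>y\<in>N k. nsq (W k) (\<lambda>i. c i - y i) \<le> \<eta>\<^sup>2))" ..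
      then have N: "\<And>k. finite (N k)" "\<And>k. real (card (N k)) \<le> (9 / \<eta>) ^ (2 * card (W k))"
        "\<And>k c. nsq (W k) c \<le> 1 \<Longrightarrow> \<exists>y\<in>N k. nsq (W k) (\<lambda>i. c i - y i) \<le> \<eta>\<^sup>2" by blast+
      \<comment> \<open>Short net points are dropped: the small ball bound needs norm at least
        \<open>1/4\<close>, and \<open>small_mass_window\<close> delivers such points only.\<close>
      define N' where "N' k = {y \<in> N k. 1 / 16 \<le> nsq (W k) y}" for k
      have fN': "finite (N' k)" for k using N(1) by (simp add: N'_def)
      define vec where "vec k y = (\<lambda>j. \<Sum>l\<in>W k. y l * w k l j)" for k and y :: "nat \<Rightarrow> complex"
      define Q where "Q k y = {x \<in> space (PiM J M). nsq P (mv Y (hent H0 (m x)) (vec k y)) \<le> \<tau>\<^sup>2}" for k y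
      have Qm: "Q k y \<in> sets (PiM J M)" for k y
      proof -
        have "(\<lambda>\<omega>. nsq P (mv Y (hent H0 \<omega>) (vec k y))) \<in> borel_measurable (PiM I M)"
          using nsq_mv_hent_measurable[OF Ysub(2,1), of "vec k y" "\<lambda>_. 0"] by (simp add: GS)
        from measurable_compose[OF mm this] show ?thesis unfolding Q_def by measurable
      qed
      have Um: "(\<Union>y\<in>N' k. Q k y) \<in> sets (PiM J M)" for k
        by (intro sets.finite_UN fN' Qm)
      have Qp: "measure (PiM J M) (Q k y) \<le> (\<eta> / 9) ^ card P" if "y \<in> N' k" for k y
      proof -
        have "nsq Y (vec k y) = nsq (W k) y"
          unfolding vec_def by (subst nsq_orthonormal_sum[OF finPY(2) eb]) (auto simp: W_def nsq_def)
        then have "1 / 16 \<le> nsq Y (vec k y)" using that by (simp add: N'_def)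
        from block_small_prob[OF this \<tau>, of \<omega>]
        have "measure (PiM J M) (Q k y) \<le> (32 * exp 1 * \<tau>\<^sup>2 / (card P * \<sigma>\<^sup>2)) ^ card P"
          by (simp add: Q_def m_def I_def J_def M_def)
        also have "\<dots> \<le> (\<eta> / 9) ^ card P"
          using b by (intro power_mono) (simp_all add: \<tau>_def)
        finally show ?thesis .
      qed
      have sub: "?T \<subseteq> (\<Union>k\<in>Grid. \<Union>y\<in>N' k. Q k y)"
      proof
        fix x assume x: "x \<in> ?T"
        define K where "K = hent H0 (m x)"
        obtain v k0 where v: "\<bar>\<Lambda> * t * real_of_int k0\<bar> \<le> 2 * \<Lambda>" "1 / 4 \<le> nsq (Y \<union> P) v"
          "nsq (Y \<union> P) v \<le> 1" "nsq P v \<le> (2 * t)\<^sup>2"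
          "nsq (Y \<union> P) (\<lambda>i. mv (Y \<union> P) K v i - complex_of_real (\<Lambda> * t * k0) * v i) \<le> (3 * \<Lambda> * t)\<^sup>2"
          using x by (auto simp: small_approx_eigvec_def K_def)
        define e where "e = \<Lambda> * t * real_of_int k0"
        \<comment> \<open>The approximate eigenvalue is rounded to the grid of mesh
          \<open>r\<close>; as its modulus is at most \<open>2 \<Lambda>\<close>, the index stays
          within \<open>2 / \<rho> + 1/2\<close>.\<close>
        define k where "k = round (e / r)"
        have k: "\<bar>real_of_int k - e / r\<bar> \<le> 1 / 2" unfolding k_def by (rule of_int_round_abs_le)
        have "\<bar>e / r\<bar> \<le> 2 / \<rho>"
        proof -
          have "\<Lambda> * \<bar>t * real_of_int k0\<bar> \<le> \<Lambda> * 2"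
            using v(1) \<Lambda> by (simp add: abs_mult mult.assoc mult.commute)
          then have "\<bar>t * real_of_int k0\<bar> \<le> 2" using \<Lambda> by simp
          then have "\<bar>t * real_of_int k0\<bar> / \<rho> \<le> 2 / \<rho>" using \<rho> by (intro divide_right_mono) auto
          then show ?thesis using \<Lambda> \<rho> by (simp add: e_def r abs_mult)
        qed
        then have kG: "k \<in> Grid" using k by (intro Grid(2)) linarith
        have Ee: "\<bar>r * real_of_int k - e\<bar> \<le> r / 2"
        proof -
          have "\<bar>r * (real_of_int k - e / r)\<bar> \<le> r * (1 / 2)"
            unfolding abs_mult using k r0 by (intro mult_mono) auto
          moreover have "r * (real_of_int k - e / r) = r * real_of_int k - e"
            using r0 by (simp add: right_diff_distrib)
          ultimately show ?thesis by simp
        qed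
        have "\<exists>y\<in>N k. 1 / 16 \<le> nsq (W k) y \<and> nsq P (mv Y K (\<lambda>j. \<Sum>l\<in>W k. y l * w k l j)) \<le> (20 * \<Lambda> * \<eta>)\<^sup>2"
        proof (rule small_mass_window[where v = v and x = e and E = "r * real_of_int k" and \<mu> = "\<mu> k"])
          show "herm Y K" unfolding K_def by (rule herm_hent_subset[OF s \<sigma> s_ge H0 Ysub(1)])
          show "nsq (Y \<union> P) (mv (Y \<union> P) K u) \<le> \<Lambda>\<^sup>2 * nsq (Y \<union> P) u" for u
            unfolding PY(1) K_def by (rule norm) (use x in \<open>simp add: GS\<close>)
          show "eigbasis Y K (w k) (\<mu> k)" unfolding K_def eb_eq by (rule eb)
        qed (use finPY PY \<Lambda> \<rho> r \<eta> v Ee N(3) in \<open>simp_all add: e_def W_def\<close>)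
        then obtain y where "y \<in> N' k" "nsq P (mv Y K (vec k y)) \<le> \<tau>\<^sup>2"
          by (auto simp: N'_def vec_def \<tau>_def)
        then show "x \<in> (\<Union>k\<in>Grid. \<Union>y\<in>N' k. Q k y)"
          using kG x by (auto simp: Q_def K_def)
      qed
      have "measure (PiM J M) ?T \<le> measure (PiM J M) (\<Union>k\<in>Grid. \<Union>y\<in>N' k. Q k y)"
        by (intro J.finite_measure_mono[OF sub] sets.finite_UN Grid(1) Um)
      also have "\<dots> \<le> (\<Sum>k\<in>Grid. measure (PiM J M) (\<Union>y\<in>N' k. Q k y))"
        using Grid(1) Um by (intro J.finite_measure_subadditive_finite) auto
      also have "\<dots> \<le> (\<Sum>k\<in>Grid. (\<eta> / 9)\<^sup>2)"
      proof (intro sum_mono)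
        fix k assume k: "k \<in> Grid"
        have "measure (PiM J M) (\<Union>y\<in>N' k. Q k y) \<le> (\<Sum>y\<in>N' k. measure (PiM J M) (Q k y))"
          using fN' Qm by (intro J.finite_measure_subadditive_finite) auto
        also have "\<dots> \<le> (\<Sum>y\<in>N' k. (\<eta> / 9) ^ card P)" by (intro sum_mono Qp)
        also have "\<dots> = real (card (N' k)) * (\<eta> / 9) ^ card P" by simp
        also have "\<dots> \<le> (9 / \<eta>) ^ (2 * card (W k)) * (\<eta> / 9) ^ card P"
        proof (intro mult_right_mono)
          have "real (card (N' k)) \<le> real (card (N k))"
            using N(1) by (intro of_nat_mono card_mono) (auto simp: N'_def)
          then show "real (card (N' k)) \<le> (9 / \<eta>) ^ (2 * card (W k))" using N(2)[of k] by linarith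
        qed (use \<eta> in simp)
        also have "\<dots> \<le> (\<eta> / 9)\<^sup>2"
        proof -
          have "real (card (W k)) \<le> 2 * T" using cnt[of k] True k by (fastforce simp: W_def)
          then have "real (2 * card (W k) + 2) \<le> real (card P)" using T by simp
          then have le: "2 * card (W k) + 2 \<le> card P" by linarith
          have "(9 / \<eta>) ^ (2 * card (W k)) * (\<eta> / 9) ^ card P
             = (9 / \<eta>) ^ (2 * card (W k)) * (\<eta> / 9) ^ (2 * card (W k)) * (\<eta> / 9) ^ (card P - 2 * card (W k))"
            using le by (simp flip: power_add)
          also have "(9 / \<eta>) ^ (2 * card (W k)) * (\<eta> / 9) ^ (2 * card (W k)) = 1"
            using \<eta> by (simp flip: power_mult_distrib)
          also have "1 * (\<eta> / 9) ^ (card P - 2 * card (W k)) \<le> (\<eta> / 9)\<^sup>2"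
            using \<eta> le by (simp only: mult_1, intro power_decreasing) auto
          finally show ?thesis .
        qed
        finally show "measure (PiM J M) (\<Union>y\<in>N' k. Q k y) \<le> (\<eta> / 9)\<^sup>2" .
      qed
      finally show ?thesis by simp
    qed
    then show "measure (PiM J M) {x \<in> space (PiM J M). merge (I - J) J (\<omega>, x) \<in>
       {\<omega> \<in> space (PiM I M). small_approx_eigvec Z \<Lambda> t \<omega> \<and> \<omega> \<notin> A \<and>
     (\<forall>k\<in>Grid. Phi Y (hent H0 \<omega>) (Complex (r * k) r) < T)}} \<le> card Grid * (\<eta> / 9)\<^sup>2"
      by (simp add: m_def)
  qed
qed

text \<open>The eigenvector is rounded to the net and its eigenvalue, at most \<Lambda> in modulus,
  to a multiple of \<open>\<Lambda> t\<close>. With \<open>d\<close> the rounding error of the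
  vector, the terms \<open>x d\<close> and \<open>H d\<close> cost \<open>\<Lambda> t\<close> each
  and the rounded eigenvalue \<open>\<Lambda> t / 2\<close>, in total less than
  \<open>3 \<Lambda> t\<close>.\<close>

lemma small_eigvec_approx:
  assumes norm: "\<And>v. nsq {..<D} (mv {..<D} (hent H0 \<omega>) v) \<le> \<Lambda>\<^sup>2 * nsq {..<D} v" and \<Lambda>: "\<Lambda> > 0"
    and t: "0 < t" "t \<le> 1 / 2"
    and Z: "\<And>y. y \<in> Z \<Longrightarrow> nsq {..<D} y \<le> 1"
      "\<And>v. nsq {..<D} v \<le> 1 \<Longrightarrow> \<exists>y\<in>Z. nsq {..<D} (\<lambda>i. v i - y i) \<le> t\<^sup>2"
    and u: "nsq {..<D} u = 1" "\<And>i. i < D \<Longrightarrow> mv {..<D} (hent H0 \<omega>) u i = complex_of_real x * u i"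
    and small: "nsq P u \<le> t\<^sup>2"
  shows "small_approx_eigvec Z \<Lambda> t \<omega>"
proof -
  let ?I = "{..<D}" and ?K = "hent H0 \<omega>"
  have finI: "finite ?I" by simp
  have PI: "P \<subseteq> ?I" using PY(1) by auto
  have mvn: "sqrt (nsq ?I (mv ?I ?K v)) \<le> \<Lambda> * sqrt (nsq ?I v)" for v
    by (rule mv_restrict_le[OF finI order_refl order_refl _ norm]) (use \<Lambda> in simp)
  have "nsq ?I (mv ?I ?K u) = nsq ?I (\<lambda>i. complex_of_real x * u i)"
    by (rule nsq_cong) (simp add: u(2))
  then have xL: "\<bar>x\<bar> \<le> \<Lambda>" using mvn[of u] by (simp add: u(1) nsq_scale)
  obtain v where v: "v \<in> Z" "nsq ?I (\<lambda>i. u i - v i) \<le> t\<^sup>2" using Z(2)[of u] u(1) by auto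
  define d where "d i = u i - v i" for i
  have d: "nsq ?I d \<le> t\<^sup>2" using v(2) unfolding d_def .
  have sd: "sqrt (nsq ?I d) \<le> t" using d t by (intro real_le_lsqrt) auto
  have vd: "v = (\<lambda>i. u i - d i)" by (simp add: d_def)
  define k where "k = round (x / (\<Lambda> * t))"
  have Lt: "\<Lambda> * t > 0" using \<Lambda> t by simp
  have kx: "\<bar>\<Lambda> * t * real_of_int k - x\<bar> \<le> \<Lambda> * t / 2"
  proof -
    have "\<bar>\<Lambda> * t * (real_of_int k - x / (\<Lambda> * t))\<bar> \<le> \<Lambda> * t * (1 / 2)"
      unfolding abs_mult[of "\<Lambda> * t"] k_def using of_int_round_abs_le[of "x / (\<Lambda> * t)"] Lt
      by (intro mult_mono) auto
    moreover have "\<Lambda> * t * (real_of_int k - x / (\<Lambda> * t)) = \<Lambda> * t * real_of_int k - x"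
      using \<Lambda> t by (simp add: right_diff_distrib)
    ultimately show ?thesis by simp
  qed
  have "\<Lambda> * t \<le> \<Lambda> * (1 / 2)" using \<Lambda> t by (intro mult_left_mono) auto
  then have 1: "\<bar>\<Lambda> * t * real_of_int k\<bar> \<le> 2 * \<Lambda>" using kx xL \<Lambda> by linarith
  have "1 / 2 \<le> sqrt (nsq ?I v)"
  proof -
    have "sqrt (nsq ?I u) = sqrt (nsq ?I (\<lambda>i. v i + d i))" by (simp add: d_def)
    also have "\<dots> \<le> sqrt (nsq ?I v) + sqrt (nsq ?I d)" by (rule sqrt_nsq_add_le)
    finally show ?thesis using sd t u(1) by simp
  qed
  then have "(1 / 2)\<^sup>2 \<le> (sqrt (nsq ?I v))\<^sup>2" by (intro power_mono) auto
  then have 2: "1 / 4 \<le> nsq ?I v" by (simp add: power2_eq_square)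
  have 3: "nsq ?I v \<le> 1" using Z(1)[OF v(1)] .
  have 4: "nsq P v \<le> (2 * t)\<^sup>2"
  proof (rule sqrt_le_D)
    have "sqrt (nsq P v) \<le> sqrt (nsq P u) + sqrt (nsq P d)" unfolding vd by (rule sqrt_nsq_diff_le)
    moreover have "sqrt (nsq P u) \<le> t" using small t by (intro real_le_lsqrt) auto
    moreover have "sqrt (nsq P d) \<le> sqrt (nsq ?I d)" by (intro real_sqrt_le_mono nsq_mono PI) simp
    ultimately show "sqrt (nsq P v) \<le> 2 * t" using sd by linarith
  qed
  have 5: "nsq ?I (\<lambda>i. mv ?I ?K v i - complex_of_real (\<Lambda> * t * k) * v i) \<le> (3 * \<Lambda> * t)\<^sup>2"
  proof (rule sqrt_le_D)
    let ?c = "\<Lambda> * t * real_of_int k - x"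
    have "nsq ?I (\<lambda>i. mv ?I ?K v i - complex_of_real (\<Lambda> * t * k) * v i)
        = nsq ?I (\<lambda>i. complex_of_real x * d i - (mv ?I ?K d i + complex_of_real ?c * v i))"
    proof (rule nsq_cong)
      fix i assume "i \<in> ?I"
      then have "mv ?I ?K v i = complex_of_real x * u i - mv ?I ?K d i"
        unfolding vd by (simp add: mv_diff u(2))
      then show "mv ?I ?K v i - complex_of_real (\<Lambda> * t * k) * v i
         = complex_of_real x * d i - (mv ?I ?K d i + complex_of_real ?c * v i)"
        by (simp add: d_def algebra_simps)
    qed
    then have "sqrt (nsq ?I (\<lambda>i. mv ?I ?K v i - complex_of_real (\<Lambda> * t * k) * v i))
       \<le> sqrt (nsq ?I (\<lambda>i. complex_of_real x * d i)) + sqrt (nsq ?I (\<lambda>i. mv ?I ?K d i + complex_of_real ?c * v i))"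
      by (simp only: sqrt_nsq_diff_le)
    also have "\<dots> \<le> sqrt (nsq ?I (\<lambda>i. complex_of_real x * d i)) + (sqrt (nsq ?I (mv ?I ?K d)) + sqrt (nsq ?I (\<lambda>i. complex_of_real ?c * v i)))"
      using sqrt_nsq_add_le by (intro add_left_mono)
    also have "sqrt (nsq ?I (\<lambda>i. complex_of_real x * d i)) \<le> \<Lambda> * t"
      unfolding sqrt_nsq_scale using xL sd \<Lambda> by (intro mult_mono) auto
    also have "sqrt (nsq ?I (mv ?I ?K d)) \<le> \<Lambda> * t"
      using mvn[of d] mult_left_mono[OF sd, of \<Lambda>] \<Lambda> by linarith
    also have "sqrt (nsq ?I (\<lambda>i. complex_of_real ?c * v i)) \<le> \<Lambda> * t / 2 * 1"
      unfolding sqrt_nsq_scale norm_of_real using kx 3 Lt by (intro mult_mono) (auto simp: real_sqrt_le_1_iff)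
    finally show "sqrt (nsq ?I (\<lambda>i. mv ?I ?K v i - complex_of_real (\<Lambda> * t * k) * v i)) \<le> 3 * \<Lambda> * t"
      using Lt by simp
  qed
  show ?thesis
    unfolding small_approx_eigvec_def PY(1)
    using v(1) 1 2 3 4 5 by blast
qed

end

lemma card_int_interval_le:
  fixes x :: real
  assumes "x \<ge> 0"
  shows "finite {k::int. \<bar>real_of_int k\<bar> \<le> x}" "real (card {k::int. \<bar>real_of_int k\<bar> \<le> x}) \<le> 2 * x + 1"
proof -
  have e: "{k::int. \<bar>real_of_int k\<bar> \<le> x} = {- \<lfloor>x\<rfloor>..\<lfloor>x\<rfloor>}"
    by (auto simp: le_floor_iff abs_le_iff) linarith+
  show "finite {k::int. \<bar>real_of_int k\<bar> \<le> x}" unfolding e by simp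
  have "0 \<le> \<lfloor>x\<rfloor>" using assms by simp
  then have "real (card {- \<lfloor>x\<rfloor>..\<lfloor>x\<rfloor>}) = 2 * real_of_int \<lfloor>x\<rfloor> + 1" by simp
  also have "\<dots> \<le> 2 * x + 1" by simp
  finally show "real (card {k::int. \<bar>real_of_int k\<bar> \<le> x}) \<le> 2 * x + 1" unfolding e .
qed

text \<open>Three events of probability at most \<open>\<epsilon>/4\<close> each are removed: a
  large norm of the Gaussian part, a crowded window, and a small approximate eigenvector in the
  absence of the former two. All scales are powers of \<kappa>, whose exponents are dictated by the
  second event.\<close>

lemma eigenvector_mass:
  fixes D :: nat and s :: "nat \<Rightarrow> nat \<Rightarrow> real" and \<sigma>m \<sigma>p C \<epsilon> :: real
    and H0 :: "nat \<Rightarrow> nat \<Rightarrow> complex" and P :: "nat set"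
  assumes s: "\<And>i j. s i j > 0" and \<sigma>: "0 < \<sigma>m" "\<sigma>m \<le> \<sigma>p" and C: "C \<ge> 0"
    and s_ge: "\<And>i j. i < D \<Longrightarrow> j < D \<Longrightarrow> (s i j)\<^sup>2 \<ge> \<sigma>m\<^sup>2 / 2"
    and s_le: "\<And>i j. i < D \<Longrightarrow> j < D \<Longrightarrow> (s i j)\<^sup>2 \<le> \<sigma>p\<^sup>2 / 2"
    and H0: "herm {..<D} H0"
    and H0_norm: "\<And>v. nsq {..<D} (mv {..<D} H0 v) \<le> (2 * sqrt D * C)\<^sup>2 * nsq {..<D} v"
    and P: "P \<subseteq> {..<D}" "card P \<ge> 16"
    and \<epsilon>: "0 < \<epsilon>" "\<epsilon> < 1 / 2" "(1 / 2) ^ card P \<le> \<epsilon>"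
  defines "\<kappa> \<equiv> \<epsilon> * (\<sigma>m / (2 * (12 * \<sigma>p + C))) * (card P / D)\<^sup>2"
  shows "\<exists>S\<in>sets (GS D s). measure (GS D s) S \<ge> 1 - \<epsilon> \<and>
    (\<forall>\<omega>\<in>S. \<forall>u x. nsq {..<D} u = 1 \<longrightarrow> (\<forall>i<D. mv {..<D} (hent H0 \<omega>) u i = complex_of_real x * u i) \<longrightarrow>
       nsq P u \<ge> (1 / 1000) ^ 8 * \<kappa> ^ 8)"
proof -
  let ?I = "{..<D}"
  define Y where "Y = ?I - P"
  have PY: "Y \<union> P = ?I" "Y \<inter> P = {}" using P by (auto simp: Y_def)
  have P0: "P \<noteq> {}" using P(2) by auto
  define n where "n = card P"
  have nD: "n \<le> D" using card_mono[OF _ P(1)] by (simp add: n_def)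
  have n: "n \<ge> 16" using P by (simp add: n_def)
  have D: "D > 0" using nD n by simp
  \<comment> \<open>\<open>q \<Lambda> = \<sigma>m sqrt D\<close> compares the norm bound with the
    noise level, so every ratio of \<Lambda> and \<open>\<sigma>m\<close> below becomes a power of
    \<open>q\<close>.\<close>
  define q where "q = \<sigma>m / (2 * (12 * \<sigma>p + C))"
  define \<nu> where "\<nu> = real n / real D"
  \<comment> \<open>\<open>2 sqrt D C\<close> bounds \<open>H0\<close> and
    \<open>12 \<sigma>p sqrt D\<close> the Gaussian part; the latter is doubled so that a single
    factor \<open>12 \<sigma>p + C\<close> remains.\<close>
  define \<Lambda> where "\<Lambda> = 2 * sqrt D * (12 * \<sigma>p + C)"
  \<comment> \<open>Used both as relative window width and as net mesh. The constant absorbs the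
    172032 of the union over windows and the 38400 of the small ball estimate.\<close>
  define \<rho> where "\<rho> = \<kappa>\<^sup>2 / 10 ^ 6"
  define t where "t = \<rho>\<^sup>2"
  define r where "r = \<rho> * \<Lambda>"
  \<comment> \<open>Then \<open>4 T + 2 \<le> n\<close>, so the net loses against the small ball
    bound, and \<open>n \<ge> 16\<close> ensures the \<open>T \<ge> 2\<close> required by the tail
    estimate.\<close>
  define T where "T = real n / 8"
  have \<kappa>: "\<kappa> = \<epsilon> * q * \<nu>\<^sup>2" by (simp add: \<kappa>_def q_def \<nu>_def n_def)
  have \<sigma>p: "\<sigma>p > 0" using \<sigma> by simp
  have q: "0 < q" "q \<le> 1"
    using \<sigma> C \<sigma>p by (auto simp: q_def divide_le_eq_1 add_pos_nonneg)
  have \<nu>: "0 < \<nu>" "\<nu> \<le> 1" using n nD D by (auto simp: \<nu>_def)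
  have \<nu>pow: "\<nu> ^ k \<le> 1" "0 < \<nu> ^ k" for k using \<nu> by (auto intro: power_le_one)
  have \<kappa>0: "0 < \<kappa>" using q \<nu> \<epsilon> by (simp add: \<kappa>)
  have \<kappa>e: "\<kappa> \<le> \<epsilon>"
  proof -
    have "q * \<nu>\<^sup>2 \<le> 1 * 1" using q \<nu>pow by (intro mult_mono) auto
    then have "\<epsilon> * (q * \<nu>\<^sup>2) \<le> \<epsilon> * 1" using \<epsilon> by (intro mult_left_mono) auto
    then show ?thesis by (simp add: \<kappa> mult.assoc)
  qed
  have \<kappa>1: "\<kappa> \<le> 1 / 2" using \<kappa>e \<epsilon> by simp
  have \<kappa>2: "\<kappa>\<^sup>2 \<le> \<epsilon> / 2"
    using mult_mono[OF \<kappa>e \<kappa>1] \<kappa>0 \<epsilon> by (simp add: power2_eq_square)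
  have \<rho>0: "0 < \<rho>" using \<kappa>0 by (simp add: \<rho>_def)
  have \<rho>s: "\<rho> \<le> \<epsilon> / 10 ^ 6" using \<kappa>2 \<epsilon> by (simp add: \<rho>_def)
  have \<rho>1: "\<rho> \<le> 1 / 100" using \<rho>s \<epsilon> by simp
  \<comment> \<open>The form demanded by the union over about \<open>1/\<rho>\<close> windows. The
    spare factor \<open>\<epsilon> \<nu>\<close> of \<open>\<kappa>^2\<close> is at most
    \<open>1/2\<close>.\<close>
  have \<rho>q: "\<rho> \<le> \<epsilon> * q\<^sup>2 * \<nu> ^ 3 / (2 * 10 ^ 6)"
  proof -
    have "\<kappa>\<^sup>2 = (\<epsilon> * q\<^sup>2 * \<nu> ^ 3) * (\<epsilon> * \<nu>)"
      by (simp add: \<kappa> power2_eq_square power3_eq_cube)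
    also have "\<dots> \<le> (\<epsilon> * q\<^sup>2 * \<nu> ^ 3) * (1 / 2 * 1)"
      using \<epsilon> \<nu> q by (intro mult_left_mono mult_mono) auto
    finally show ?thesis by (simp add: \<rho>_def)
  qed
  have \<Lambda>: "\<Lambda> > 0" using D \<sigma>p C by (simp add: \<Lambda>_def add_pos_nonneg)
  have q\<Lambda>: "q * \<Lambda> = \<sigma>m * sqrt D"
  proof -
    have "12 * \<sigma>p + C > 0" using \<sigma>p C by simp
    then show ?thesis unfolding q_def \<Lambda>_def by (simp del: distrib_left_numeral)
  qed
  have \<Lambda>2: "\<Lambda>\<^sup>2 = \<sigma>m\<^sup>2 * D / q\<^sup>2"
  proof -
    have "q\<^sup>2 * \<Lambda>\<^sup>2 = \<sigma>m\<^sup>2 * D" using arg_cong[OF q\<Lambda>, of "\<lambda>x. x\<^sup>2"] by (simp add: power_mult_distrib)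
    then show ?thesis using q by (simp add: field_simps)
  qed
  have nn: "real n = \<nu> * D" using D by (simp add: \<nu>_def)
  have r0: "r > 0" using \<rho>0 \<Lambda> by (simp add: r_def)
  have e3: "exp 1 \<le> (3::real)" by (rule exp_le)
  interpret prob_space "GS D s" by (rule prob_space_GS) (rule s)
  obtain A where A: "A \<in> events" "prob A \<le> 2 * (1 / 128) ^ D"
    "\<And>\<omega> v. \<omega> \<in> space (GS D s) - A \<Longrightarrow> nsq ?I (mv ?I (vent \<omega>) v) \<le> (12 * \<sigma>p * sqrt D)\<^sup>2 * nsq ?I v"
    by (rule vent_norm_bound[of s \<sigma>p D]) (use s \<sigma>p s_le D in auto)
  have norm: "nsq ?I (mv ?I (hent H0 \<omega>) v) \<le> \<Lambda>\<^sup>2 * nsq ?I v" if "\<omega> \<in> space (GS D s) - A" for \<omega> v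
  proof -
    have "mv ?I (hent H0 \<omega>) v = (\<lambda>i. mv ?I H0 v i + mv ?I (vent \<omega>) v i)"
      by (rule ext) (simp add: mv_def hent_split distrib_right sum.distrib)
    then have "sqrt (nsq ?I (mv ?I (hent H0 \<omega>) v)) \<le> sqrt (nsq ?I (mv ?I H0 v)) + sqrt (nsq ?I (mv ?I (vent \<omega>) v))"
      by (simp only: sqrt_nsq_add_le)
    also have "sqrt (nsq ?I (mv ?I H0 v)) \<le> 2 * sqrt D * C * sqrt (nsq ?I v)"
      using real_sqrt_le_mono[OF H0_norm[of v]] C by (simp add: real_sqrt_mult)
    also have "sqrt (nsq ?I (mv ?I (vent \<omega>) v)) \<le> 12 * \<sigma>p * sqrt D * sqrt (nsq ?I v)"
      using real_sqrt_le_mono[OF A(3)[OF that, of v]] \<sigma>p by (simp add: real_sqrt_mult)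
    also have "2 * sqrt D * C * sqrt (nsq ?I v) + 12 * \<sigma>p * sqrt D * sqrt (nsq ?I v)
        \<le> \<Lambda> * sqrt (nsq ?I v)"
    proof -
      have "2 * sqrt D * C + 12 * \<sigma>p * sqrt D \<le> \<Lambda>"
        using \<sigma>p by (simp add: \<Lambda>_def algebra_simps)
      from mult_right_mono[OF this, of "sqrt (nsq ?I v)"] show ?thesis by (simp add: distrib_right)
    qed
    finally have "sqrt (nsq ?I (mv ?I (hent H0 \<omega>) v)) \<le> sqrt (\<Lambda>\<^sup>2 * nsq ?I v)"
      using \<Lambda> by (simp add: real_sqrt_mult)
    then show ?thesis by simp
  qed
  obtain Z :: "(nat \<Rightarrow> complex) set" where Z: "finite Z" "\<And>y. y \<in> Z \<Longrightarrow> nsq ?I y \<le> 1"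
    "\<And>v. nsq ?I v \<le> 1 \<Longrightarrow> \<exists>y\<in>Z. nsq ?I (\<lambda>i. v i - y i) \<le> t\<^sup>2"
  proof -
    have "0 < t" "t \<le> 1" using \<rho>0 \<rho>1 by (auto simp: t_def power_le_one)
    then show ?thesis using unit_ball_net_complex[of ?I t] that by (metis finite_lessThan)
  qed
  define Grid where "Grid = {k::int. \<bar>real_of_int k\<bar> \<le> 2 / \<rho> + 1}"
  have Grid: "finite Grid" "real (card Grid) \<le> 7 / \<rho>"
  proof -
    have "2 / \<rho> + 1 \<ge> 0" using \<rho>0 by (simp add: add_nonneg_nonneg)
    note * = card_int_interval_le[OF this]
    show "finite Grid" unfolding Grid_def by (rule *)
    have "real (card Grid) \<le> 2 * (2 / \<rho> + 1) + 1" unfolding Grid_def by (rule *)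
    also have "\<dots> \<le> 7 / \<rho>" using \<rho>0 \<rho>1 by (simp add: field_simps)
    finally show "real (card Grid) \<le> 7 / \<rho>" .
  qed
  define B where "B k = {\<omega> \<in> space (GS D s). T \<le> Phi Y (hent H0 \<omega>) (Complex (r * real_of_int k) r)}" for k
  have Ysub: "Y \<subseteq> ?I" by (auto simp: Y_def)
  have [measurable]: "(\<lambda>\<omega>. Phi Y (hent H0 \<omega>) (Complex (r * real_of_int k) r)) \<in> borel_measurable (GS D s)" for k
    by (rule Phi_measurable[OF s \<sigma>(1) s_ge H0 Ysub]) (use r0 in auto)
  have Bm: "B k \<in> events" for k unfolding B_def by measurable
  have Bp: "prob (\<Union>k\<in>Grid. B k) \<le> \<epsilon> / 4"
  proof -
    have "prob (\<Union>k\<in>Grid. B k) \<le> (\<Sum>k\<in>Grid. prob (B k))"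
      using Grid(1) Bm by (intro finite_measure_subadditive_finite) auto
    also have "\<dots> \<le> (\<Sum>k\<in>Grid. 16 * exp 1 * r\<^sup>2 * (real D)\<^sup>2 / (\<sigma>m\<^sup>2 * T ^ 3))"
      unfolding B_def using n by (intro sum_mono Phi_large_prob[OF s \<sigma>(1) s_ge H0 Ysub r0 _ D]) (auto simp: T_def)
    also have "\<dots> = card Grid * (16 * exp 1 * r\<^sup>2 * (real D)\<^sup>2 / (\<sigma>m\<^sup>2 * T ^ 3))" by simp
    also have "\<dots> \<le> 7 / \<rho> * (16 * 3 * r\<^sup>2 * (real D)\<^sup>2 / (\<sigma>m\<^sup>2 * T ^ 3))"
      using Grid(2) e3 \<rho>0 n by (intro mult_mono divide_right_mono mult_right_mono mult_left_mono) (auto simp: T_def)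
    also have "16 * 3 * r\<^sup>2 * (real D)\<^sup>2 / (\<sigma>m\<^sup>2 * T ^ 3) = 24576 * \<rho>\<^sup>2 / (q\<^sup>2 * \<nu> ^ 3)"
      unfolding r_def power_mult_distrib \<Lambda>2 T_def nn using \<sigma> D q \<nu>
      by (simp add: field_simps power2_eq_square power3_eq_cube)
    also have "7 / \<rho> * (24576 * \<rho>\<^sup>2 / (q\<^sup>2 * \<nu> ^ 3)) = 172032 * \<rho> / (q\<^sup>2 * \<nu> ^ 3)"
      using \<rho>0 by (simp add: power2_eq_square)
    also have "\<dots> \<le> 172032 * (\<epsilon> * q\<^sup>2 * \<nu> ^ 3 / (2 * 10 ^ 6)) / (q\<^sup>2 * \<nu> ^ 3)"
      using \<rho>q q \<nu> by (intro divide_right_mono mult_left_mono) auto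
    also have "\<dots> = \<epsilon> * (172032 / (2 * 10 ^ 6))" using q \<nu> by simp
    also have "\<dots> \<le> \<epsilon> * (1 / 4)" using \<epsilon> by (intro mult_left_mono) auto
    finally show ?thesis by simp
  qed
  define E where "E = {\<omega> \<in> space (GS D s). small_approx_eigvec H0 P Y Z \<Lambda> t \<omega>}"
  define E' where "E' = {\<omega> \<in> space (GS D s). small_approx_eigvec H0 P Y Z \<Lambda> t \<omega> \<and> \<omega> \<notin> A \<and>
     (\<forall>k\<in>Grid. Phi Y (hent H0 \<omega>) (Complex (r * real_of_int k) r) < T)}"
  have Em: "E \<in> events" unfolding E_def
    by (rule small_approx_eigvec_measurable[OF s \<sigma>(1) s_ge H0 PY P0 Z(1)])
  have E'eq: "E' = E - A - (\<Union>k\<in>Grid. B k)"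
    by (auto simp: E'_def E_def B_def not_le[symmetric])
  have Um: "(\<Union>k\<in>Grid. B k) \<in> events" using Grid(1) Bm by auto
  have Ep: "prob E' \<le> \<epsilon> / 4"
  proof -
    have "prob E' \<le> card Grid * (\<rho> / 9)\<^sup>2"
      unfolding E'_def
    proof (rule small_approx_eigvec_prob[OF s \<sigma>(1) s_ge H0 PY P0 A(1) Z(1) norm \<Lambda> \<rho>0 _ r_def])
      show "t = \<rho> * \<rho>" by (simp add: t_def power2_eq_square)
      show "4 * T + 2 \<le> real (card P)" using n by (simp add: T_def n_def[symmetric])
      have "32 * exp 1 * (20 * \<Lambda> * \<rho>)\<^sup>2 / (real (card P) * \<sigma>m\<^sup>2) = 12800 * exp 1 * \<rho>\<^sup>2 / (\<nu> * q\<^sup>2)"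
        unfolding power_mult_distrib \<Lambda>2 n_def[symmetric] nn using \<sigma> D q \<nu>
        by (simp add: field_simps)
      also have "\<dots> \<le> 12800 * 3 * \<rho>\<^sup>2 / (\<nu> * q\<^sup>2)"
        using e3 q \<nu> by (intro divide_right_mono mult_right_mono mult_left_mono) auto
      also have "\<dots> = \<rho> * (38400 * \<rho> / (\<nu> * q\<^sup>2))" by (simp add: power2_eq_square)
      also have "\<dots> \<le> \<rho> * (1 / 9)"
      proof (intro mult_left_mono)
        have "\<rho> \<le> \<epsilon> * q\<^sup>2 * \<nu> ^ 3 / (2 * 10 ^ 6)" by (rule \<rho>q)
        also have "\<dots> = (\<nu> * q\<^sup>2) * (\<epsilon> * \<nu>\<^sup>2) / (2 * 10 ^ 6)" by (simp add: power2_eq_square power3_eq_cube)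
        also have "\<dots> \<le> (\<nu> * q\<^sup>2) * (1 * 1) / (2 * 10 ^ 6)"
          using \<epsilon> \<nu>pow \<nu> by (intro divide_right_mono mult_left_mono mult_mono) auto
        finally show "38400 * \<rho> / (\<nu> * q\<^sup>2) \<le> 1 / 9" using q \<nu> \<rho>0 by (simp add: field_simps)
      qed (use \<rho>0 in simp)
      finally show "32 * exp 1 * (20 * \<Lambda> * \<rho>)\<^sup>2 / (real (card P) * \<sigma>m\<^sup>2) \<le> \<rho> / 9" by simp
    qed (use \<rho>0 \<rho>1 Grid(1) in \<open>auto simp: Grid_def\<close>)
    also have "\<dots> \<le> 7 / \<rho> * (\<rho> / 9)\<^sup>2" using Grid(2) by (intro mult_right_mono) auto
    also have "\<dots> = 7 / 81 * \<rho>" using \<rho>0 by (simp add: power2_eq_square)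
    also have "\<dots> \<le> \<epsilon> / 4" using \<rho>s \<epsilon> by simp
    finally show ?thesis .
  qed
  have Ap: "prob A \<le> \<epsilon> / 4"
  proof -
    \<comment> \<open>In \<open>1/128 = 1/2 * 1/64\<close> the first factor, raised to
      \<open>D \<ge> card P\<close>, is at most \<epsilon> by the assumption on the block size; the
      second supplies the constant.\<close>
    have "(1 / 128 :: real) ^ D = (1 / 2) ^ D * (1 / 64) ^ D" by (simp flip: power_mult_distrib)
    also have "\<dots> \<le> \<epsilon> * (1 / 64)"
    proof (intro mult_mono)
      have "(1 / 2 :: real) ^ D \<le> (1 / 2) ^ card P" using nD by (intro power_decreasing) (auto simp: n_def)
      then show "(1 / 2 :: real) ^ D \<le> \<epsilon>" using \<epsilon>(3) by linarith
      show "(1 / 64 :: real) ^ D \<le> 1 / 64" using D power_decreasing[of 1 D "1 / 64 :: real"] by simp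
    qed (use \<epsilon> in auto)
    finally show ?thesis using A(2) \<epsilon> by linarith
  qed
  \<comment> \<open>Removing these sets removes all of \<open>E\<close>, because \<open>E'\<close>
    is what remains of \<open>E\<close> outside the other two.\<close>
  define S where "S = space (GS D s) - (A \<union> ((\<Union>k\<in>Grid. B k) \<union> E'))"
  have Sm: "S \<in> events" unfolding S_def E'eq using A(1) Um Em by auto
  have "prob (A \<union> ((\<Union>k\<in>Grid. B k) \<union> E')) \<le> prob A + (prob (\<Union>k\<in>Grid. B k) + prob E')"
  proof -
    have E'm: "E' \<in> events" unfolding E'eq using A(1) Um Em by auto
    have "prob (A \<union> ((\<Union>k\<in>Grid. B k) \<union> E')) \<le> prob A + prob ((\<Union>k\<in>Grid. B k) \<union> E')"
      using A(1) Um E'm by (intro measure_Un_le) auto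
    also have "prob ((\<Union>k\<in>Grid. B k) \<union> E') \<le> prob (\<Union>k\<in>Grid. B k) + prob E'"
      using Um E'm by (intro measure_Un_le) auto
    finally show ?thesis by simp
  qed
  then have "prob (A \<union> ((\<Union>k\<in>Grid. B k) \<union> E')) \<le> \<epsilon>" using Ap Bp Ep \<epsilon> by linarith
  moreover have "prob S = 1 - prob (A \<union> ((\<Union>k\<in>Grid. B k) \<union> E'))"
    unfolding S_def E'eq using A(1) Um Em by (intro prob_compl) auto
  ultimately have SP: "prob S \<ge> 1 - \<epsilon>" by simp
  have "nsq P u \<ge> (1 / 1000) ^ 8 * \<kappa> ^ 8"
    if \<omega>: "\<omega> \<in> S" and u: "nsq ?I u = 1" "\<forall>i<D. mv ?I (hent H0 \<omega>) u i = complex_of_real x * u i" for \<omega> u x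
  proof (rule ccontr)
    assume "\<not> nsq P u \<ge> (1 / 1000) ^ 8 * \<kappa> ^ 8"
    \<comment> \<open>\<open>t^2 = \<rho>^4 = \<kappa>^8 / 10^24\<close>, and
      \<open>10^24 = 1000^8\<close>.\<close>
    moreover have "t\<^sup>2 = (1 / 1000) ^ 8 * \<kappa> ^ 8"
      by (simp add: t_def \<rho>_def power_divide flip: power_mult)
    ultimately have small: "nsq P u \<le> t\<^sup>2" by simp
    have \<omega>A: "\<omega> \<in> space (GS D s) - A" using \<omega> by (auto simp: S_def)
    have "small_approx_eigvec H0 P Y Z \<Lambda> t \<omega>"
    proof (rule small_eigvec_approx[OF s \<sigma>(1) s_ge H0 PY P0 norm[OF \<omega>A] \<Lambda> _ _ Z(2,3) u(1) _ small])
      show "0 < t" using \<rho>0 by (simp add: t_def)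
      have "t \<le> 1 * (1 / 100)" unfolding t_def power2_eq_square using \<rho>0 \<rho>1 by (intro mult_mono) auto
      then show "t \<le> 1 / 2" by simp
    qed (use u(2) in auto)
    then show False using \<omega> by (auto simp: S_def E'eq E_def)
  qed
  then show ?thesis using Sm SP by blast
qed

section \<open>Matrices, spectral projections and the coefficients M\<close>

definition mfun :: "complex mat \<Rightarrow> nat \<Rightarrow> nat \<Rightarrow> complex" where
  "mfun A i j = A $$ (i,j)"

lemma mat_adjoint_index:
  assumes "A \<in> carrier_mat D D" "i < D" "j < D"
  shows "mat_adjoint A $$ (i,j) = cnj (A $$ (j,i))"
  using assms unfolding mat_adjoint_def by (simp add: mat_of_rows_index)

lemma hermitian_iff_herm:
  assumes A: "A \<in> carrier_mat D D"
  shows "hermitian A \<longleftrightarrow> herm {..<D} (mfun A)"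
proof -
  have "mat_adjoint A \<in> carrier_mat D D" using A unfolding mat_adjoint_def by auto
  then have "hermitian A \<longleftrightarrow> (\<forall>i<D. \<forall>j<D. mat_adjoint A $$ (i,j) = A $$ (i,j))"
    using A unfolding hermitian_def by (auto intro!: eq_matI)
  also have "\<dots> \<longleftrightarrow> (\<forall>i<D. \<forall>j<D. cnj (A $$ (j,i)) = A $$ (i,j))"
    using mat_adjoint_index[OF A] by simp
  also have "\<dots> \<longleftrightarrow> herm {..<D} (mfun A)"
    unfolding herm_def mfun_def by (metis lessThan_iff)
  finally show ?thesis .
qed

lemma mult_mat_vec_mv:
  assumes "A \<in> carrier_mat D D" "v \<in> carrier_vec D" "i < D"
  shows "(A *\<^sub>v v) $ i = mv {..<D} (mfun A) (\<lambda>j. v $ j) i"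
  using assms by (simp add: scalar_prod_def mv_def mfun_def atLeast0LessThan)

lemma mult_mat_index:
  assumes "A \<in> carrier_mat D D" "B \<in> carrier_mat D D" "i < D" "j < D"
  shows "(A * B) $$ (i,j) = (\<Sum>k<D. A $$ (i,k) * B $$ (k,j))"
  using assms by (simp add: scalar_prod_def atLeast0LessThan)

text \<open>Entries of the spectral projection for \<open>e\<close>, written in an eigenbasis; they
  vanish if \<open>e\<close> is not an eigenvalue.\<close>

definition pe :: "nat \<Rightarrow> (nat \<Rightarrow> nat \<Rightarrow> complex) \<Rightarrow> (nat \<Rightarrow> real) \<Rightarrow> complex \<Rightarrow> nat \<Rightarrow> nat \<Rightarrow> complex" where
  "pe D w \<mu> e i j = (\<Sum>l\<in>{l. l < D \<and> complex_of_real (\<mu> l) = e}. w l i * cnj (w l j))"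

section \<open>Spectral projections and the coefficients \<open>Mcoef\<close> in an
  eigenbasis\<close>

context
  fixes D :: nat and H :: "complex mat" and w \<mu>
  assumes H: "H \<in> carrier_mat D D" "hermitian H"
    and eb: "eigbasis {..<D} (mfun H) w \<mu>"
begin

lemma hermH: "herm {..<D} (mfun H)"
  using H hermitian_iff_herm by blast

lemma eb_mv: "l < D \<Longrightarrow> i < D \<Longrightarrow> mv {..<D} (mfun H) (w l) i = complex_of_real (\<mu> l) * w l i"
  using eigbasis_mv[OF _ eb, of l i] by simp

lemma eb_ip: "k < D \<Longrightarrow> l < D \<Longrightarrow> ip {..<D} (w k) (w l) = (if k = l then 1 else 0)"
  using eigbasis_ip[OF _ eb, of k l] by simp

lemma cnj_pe: "cnj (pe D w \<mu> e i j) = pe D w \<mu> e j i"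
  unfolding pe_def by (simp add: mult.commute)

lemma pe_apply:
  "(\<Sum>k<D. pe D w \<mu> e i k * v k) = (\<Sum>l\<in>{l. l < D \<and> complex_of_real (\<mu> l) = e}. ip {..<D} (w l) v * w l i)"
  unfolding pe_def ip_def sum_distrib_right by (subst sum.swap) (simp add: mult_ac)

lemma pe_eigen:
  assumes "i < D"
  shows "mv {..<D} (mfun H) (\<lambda>i. \<Sum>l\<in>{l. l < D \<and> complex_of_real (\<mu> l) = e}. c l * w l i) i
    = e * (\<Sum>l\<in>{l. l < D \<and> complex_of_real (\<mu> l) = e}. c l * w l i)"
proof -
  have "mv {..<D} (mfun H) (\<lambda>i. \<Sum>l\<in>{l. l < D \<and> complex_of_real (\<mu> l) = e}. c l * w l i) i
     = (\<Sum>l\<in>{l. l < D \<and> complex_of_real (\<mu> l) = e}. c l * mv {..<D} (mfun H) (w l) i)"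
    unfolding mv_def sum_distrib_left by (subst sum.swap) (simp add: mult_ac)
  also have "\<dots> = (\<Sum>l\<in>{l. l < D \<and> complex_of_real (\<mu> l) = e}. c l * (e * w l i))"
    using assms by (intro sum.cong refl) (auto simp: eb_mv)
  finally show ?thesis by (simp add: sum_distrib_left mult_ac)
qed

text \<open>The nonzero columns of a spectral projection are the eigenvectors to which the mass
  bound is applied in the end.\<close>

lemma pe_col_eigen: "i < D \<Longrightarrow> mv {..<D} (mfun H) (\<lambda>i. pe D w \<mu> e i j) i = e * pe D w \<mu> e i j"
  using pe_eigen[where i = i and e = e and c = "\<lambda>l. cnj (w l j)"] by (simp add: pe_def mult.commute)

lemma nsq_pe_col: "complex_of_real (nsq {..<D} (\<lambda>i. pe D w \<mu> e i j)) = pe D w \<mu> e j j"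
proof -
  have "nsq {..<D} (\<lambda>i. pe D w \<mu> e i j)
      = nsq {..<D} (\<lambda>i. \<Sum>l\<in>{l. l < D \<and> complex_of_real (\<mu> l) = e}. cnj (w l j) * w l i)"
    by (simp add: pe_def mult.commute)
  also have "\<dots> = (\<Sum>l\<in>{l. l < D \<and> complex_of_real (\<mu> l) = e}. (cmod (w l j))\<^sup>2)"
    by (subst nsq_orthonormal_sum[OF _ eb]) auto
  finally show ?thesis
    unfolding pe_def by (simp only: of_real_sum complex_norm_square)
qed

lemma pe_idem: "(\<Sum>k<D. pe D w \<mu> e i k * pe D w \<mu> e k j) = pe D w \<mu> e i j"
proof -
  let ?L = "{l. l < D \<and> complex_of_real (\<mu> l) = e}"
  have fL: "finite ?L" by simp
  have "ip {..<D} (w l) (\<lambda>k. pe D w \<mu> e k j) = cnj (w l j)" if l: "l \<in> ?L" for l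
  proof -
    have "ip {..<D} (w l) (\<lambda>k. pe D w \<mu> e k j) = ip {..<D} (w l) (\<lambda>k. \<Sum>m\<in>?L. cnj (w m j) * w m k)"
      by (simp add: pe_def mult.commute)
    also have "\<dots> = (\<Sum>m\<in>?L. cnj (w m j) * (if l = m then 1 else 0))"
      unfolding ip_sum_scale_right using l by (intro sum.cong refl) (simp add: eb_ip)
    also have "\<dots> = cnj (w l j)" using fL l by (subst sum_mult_delta) auto
    finally show ?thesis .
  qed
  then show ?thesis unfolding pe_apply by (simp add: pe_def mult.commute)
qed

text \<open>An eigenvector is orthogonal to the basis vectors with other eigenvalues. Hence the
  fixed space of the projection is the eigenspace, also when \<open>e\<close> is no eigenvalue and
  both are zero.\<close>

lemma pe_fix_iff:
  "(\<forall>i<D. (\<Sum>k<D. pe D w \<mu> e i k * v k) = v i) \<longleftrightarrow> (\<forall>i<D. mv {..<D} (mfun H) v i = e * v i)"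
    (is "?l \<longleftrightarrow> ?r")
proof
  let ?L = "{l. l < D \<and> complex_of_real (\<mu> l) = e}"
  assume l: ?l
  then have v: "\<And>i. i \<in> {..<D} \<Longrightarrow> v i = (\<Sum>l\<in>?L. ip {..<D} (w l) v * w l i)" by (simp add: pe_apply)
  show ?r
  proof (intro allI impI)
    fix i assume i: "i < D"
    have "mv {..<D} (mfun H) v = mv {..<D} (mfun H) (\<lambda>i. \<Sum>l\<in>?L. ip {..<D} (w l) v * w l i)"
      by (rule mv_cong) (rule v)
    then show "mv {..<D} (mfun H) v i = e * v i"
      using pe_eigen[OF i] v[of i] i by simp
  qed
next
  let ?L = "{l. l < D \<and> complex_of_real (\<mu> l) = e}"
  assume r: ?r
  have z: "ip {..<D} (w l) v = 0" if "l < D" "complex_of_real (\<mu> l) \<noteq> e" for l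
  proof -
    have "ip {..<D} (w l) (\<lambda>i. e * v i) = ip {..<D} (w l) (mv {..<D} (mfun H) v)"
      using r by (intro ip_cong) auto
    also have "\<dots> = ip {..<D} (mv {..<D} (mfun H) (w l)) v" by (rule ip_mv[OF hermH])
    also have "\<dots> = ip {..<D} (\<lambda>i. \<mu> l * w l i) v"
      using that by (intro ip_cong) (auto simp: eb_mv)
    finally have "e * ip {..<D} (w l) v = \<mu> l * ip {..<D} (w l) v"
      by (simp add: ip_scale_left ip_scale_right)
    then show ?thesis using that(2) by simp
  qed
  show ?l
  proof (intro allI impI)
    fix i assume i: "i < D"
    have "v i = (\<Sum>l<D. ip {..<D} (w l) v * w l i)"
      using eigbasis_expand[OF _ eb, of i v] i by simp
    also have "\<dots> = (\<Sum>l\<in>?L. ip {..<D} (w l) v * w l i)"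
      using z by (intro sum.mono_neutral_right) auto
    finally show "(\<Sum>k<D. pe D w \<mu> e i k * v k) = v i" by (simp add: pe_apply)
  qed
qed

text \<open>A definite description needs uniqueness: orthogonal projections with the same fixed
  vectors satisfy \<open>Q P = P\<close> and \<open>P Q = Q\<close>, and the adjoint of the first
  identity is \<open>P Q = P\<close>.\<close>

lemma eigproj_eq: "eigproj H e = mat D D (\<lambda>(i,j). pe D w \<mu> e i j)" (is "_ = ?P")
proof -
  have dim: "dim_row H = D" using H by auto
  have P: "?P \<in> carrier_mat D D" by simp
  have mP: "mv {..<D} (mfun ?P) v i = (\<Sum>k<D. pe D w \<mu> e i k * v k)" if "i < D" for v i
    using that by (simp add: mv_def mfun_def)
  have fix_iff: "A *\<^sub>v v = c \<cdot>\<^sub>v v \<longleftrightarrow> (\<forall>i<D. mv {..<D} (mfun A) (\<lambda>j. v $ j) i = c * v $ i)"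
    if "A \<in> carrier_mat D D" "v \<in> carrier_vec D" for A v c
    using that mult_mat_vec_mv[OF that] by (auto simp: vec_eq_iff)
  have fix1: "A *\<^sub>v v = v \<longleftrightarrow> (\<forall>i<D. mv {..<D} (mfun A) (\<lambda>j. v $ j) i = v $ i)"
    if "A \<in> carrier_mat D D" "v \<in> carrier_vec D" for A v
    using that mult_mat_vec_mv[OF that] by (auto simp: vec_eq_iff)
  have PP: "?P * ?P = ?P"
  proof (rule eq_matI)
    fix i j assume "i < dim_row ?P" "j < dim_col ?P"
    then have ij: "i < D" "j < D" by auto
    show "(?P * ?P) $$ (i,j) = ?P $$ (i,j)"
      unfolding mult_mat_index[OF P P ij] using ij by (simp add: pe_idem)
  qed auto
  have hP: "hermitian ?P"
    unfolding hermitian_iff_herm[OF P] herm_def mfun_def by (simp add: cnj_pe)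
  have Pv: "?P *\<^sub>v v = v \<longleftrightarrow> H *\<^sub>v v = e \<cdot>\<^sub>v v" if v: "v \<in> carrier_vec D" for v
    unfolding fix_iff[OF H(1) v] fix1[OF P v] pe_fix_iff[of e "\<lambda>j. v $ j", symmetric]
    using mP by simp
  show ?thesis unfolding eigproj_def dim
  proof (rule the_equality)
    show "?P \<in> carrier_mat D D \<and> ?P * ?P = ?P \<and> hermitian ?P \<and>
      (\<forall>v\<in>carrier_vec D. (?P *\<^sub>v v = v) = (H *\<^sub>v v = e \<cdot>\<^sub>v v))"
      using P PP hP Pv by blast
    fix Q assume Q: "Q \<in> carrier_mat D D \<and> Q * Q = Q \<and> hermitian Q \<and>
      (\<forall>v\<in>carrier_vec D. (Q *\<^sub>v v = v) = (H *\<^sub>v v = e \<cdot>\<^sub>v v))"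
    then have Qc: "Q \<in> carrier_mat D D" and QQ: "Q * Q = Q" and hQ: "hermitian Q"
      and Qv: "\<And>v. v \<in> carrier_vec D \<Longrightarrow> (Q *\<^sub>v v = v) = (?P *\<^sub>v v = v)" using Pv by blast+
    \<comment> \<open>Each column of the idempotent \<open>B\<close> is fixed by \<open>B\<close>,
      hence by \<open>A\<close>.\<close>
    have absorb: "A * B = B" if A: "A \<in> carrier_mat D D" and B: "B \<in> carrier_mat D D" "B * B = B"
      and AB: "\<And>v. v \<in> carrier_vec D \<Longrightarrow> (A *\<^sub>v v = v) = (B *\<^sub>v v = v)" for A B
    proof (rule eq_matI)
      fix i j assume "i < dim_row B" "j < dim_col B"
      then have ij: "i < D" "j < D" using B by auto
      have c: "col B j \<in> carrier_vec D" using B ij by auto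
      have "B *\<^sub>v col B j = col B j"
        using col_mult2[OF B(1) B(1) ij(2)] B(2) by simp
      then have "A *\<^sub>v col B j = col B j" using AB[OF c] by simp
      then have "(A *\<^sub>v col B j) $ i = B $$ (i,j)" using B ij by simp
      then show "(A * B) $$ (i,j) = B $$ (i,j)" using A B ij by simp
    qed (use A B in auto)
    have QP: "Q * ?P = ?P" by (rule absorb[OF Qc P PP]) (rule Qv)
    have PQ: "?P * Q = Q" by (rule absorb[OF P Qc QQ]) (simp add: Qv)
    show "Q = ?P"
    proof (rule eq_matI)
      fix i j assume "i < dim_row ?P" "j < dim_col ?P"
      then have ij: "i < D" "j < D" by auto
      have hq: "cnj (Q $$ (k,l)) = Q $$ (l,k)" if "k < D" "l < D" for k l
        using hQ that herm_cnj[of "{..<D}" "mfun Q" k l] unfolding hermitian_iff_herm[OF Qc] by (simp add: mfun_def)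
      have "Q $$ (i,j) = (?P * Q) $$ (i,j)" by (simp add: PQ)
      also have "\<dots> = (\<Sum>k<D. pe D w \<mu> e i k * Q $$ (k,j))"
        using ij by (simp add: mult_mat_index[OF P Qc])
      also have "\<dots> = (\<Sum>k<D. cnj (Q $$ (j,k) * pe D w \<mu> e k i))"
        using ij by (intro sum.cong refl) (simp add: hq cnj_pe mult.commute)
      also have "\<dots> = cnj ((Q * ?P) $$ (j,i))"
        using ij by (simp add: mult_mat_index[OF Qc P])
      also have "\<dots> = ?P $$ (i,j)"
        unfolding QP using ij by (simp add: cnj_pe)
      finally show "Q $$ (i,j) = ?P $$ (i,j)" .
    qed (use Qc in auto)
  qed
qed

lemma eigenvalues_eq: "{e. eigenvalue H e} = (\<lambda>l. complex_of_real (\<mu> l)) ` {..<D}"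
proof -
  have dim: "dim_row H = D" using H by auto
  have fix_iff: "H *\<^sub>v v = c \<cdot>\<^sub>v v \<longleftrightarrow> (\<forall>i<D. mv {..<D} (mfun H) (\<lambda>j. v $ j) i = c * v $ i)"
    if "v \<in> carrier_vec D" for v c
    using that mult_mat_vec_mv[OF H(1) that] H(1) by (auto simp: vec_eq_iff)
  show ?thesis
  proof (intro equalityI subsetI)
    fix e assume "e \<in> {e. eigenvalue H e}"
    then obtain v where v: "v \<in> carrier_vec D" "v \<noteq> 0\<^sub>v D" "H *\<^sub>v v = e \<cdot>\<^sub>v v"
      by (auto simp: eigenvalue_def eigenvector_def dim)
    have "\<forall>i<D. (\<Sum>k<D. pe D w \<mu> e i k * v $ k) = v $ i"
      using v(3) unfolding fix_iff[OF v(1)] pe_fix_iff .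
    then have "{l. l < D \<and> complex_of_real (\<mu> l) = e} \<noteq> {}"
      using v(1,2) unfolding pe_apply by (force simp: vec_eq_iff)
    then show "e \<in> (\<lambda>l. complex_of_real (\<mu> l)) ` {..<D}" by auto
  next
    fix e assume "e \<in> (\<lambda>l. complex_of_real (\<mu> l)) ` {..<D}"
    then obtain l where l: "l < D" "e = complex_of_real (\<mu> l)" by auto
    define v where "v = vec D (w l)"
    have v: "v \<in> carrier_vec D" by (simp add: v_def)
    have "H *\<^sub>v v = e \<cdot>\<^sub>v v"
      unfolding fix_iff[OF v]
    proof (intro allI impI)
      fix i assume i: "i < D"
      have "mv {..<D} (mfun H) (\<lambda>j. v $ j) = mv {..<D} (mfun H) (w l)"
        by (rule mv_cong) (simp add: v_def)
      then show "mv {..<D} (mfun H) (\<lambda>j. v $ j) i = e * v $ i"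
        using eb_mv[OF l(1) i] i by (simp add: v_def l(2))
    qed
    moreover have "v \<noteq> 0\<^sub>v D"
    proof
      assume "v = 0\<^sub>v D"
      then have "w l i = 0" if "i < D" for i using that by (metis index_vec index_zero_vec(1) v_def)
      then have "ip {..<D} (w l) (w l) = 0" by (simp add: ip_def)
      then show False using eb_ip[OF l(1) l(1)] by simp
    qed
    ultimately show "e \<in> {e. eigenvalue H e}"
      using v by (auto simp: eigenvalue_def eigenvector_def dim)
  qed
qed

lemma sum_pe_diag: "j < D \<Longrightarrow> (\<Sum>e\<in>{e. eigenvalue H e}. pe D w \<mu> e j j) = 1"
proof -
  assume j: "j < D"
  have "(\<Sum>e\<in>{e. eigenvalue H e}. pe D w \<mu> e j j) = (\<Sum>l<D. w l j * cnj (w l j))"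
    unfolding eigenvalues_eq pe_def
    using sum.image_gen[of "{..<D}" "\<lambda>l. w l j * cnj (w l j)" "\<lambda>l. complex_of_real (\<mu> l)"]
    by simp
  then show ?thesis using eigbasis_complete[OF _ eb, of j j] j by simp
qed

lemma mtrace_blocks:
  "mtrace (Pblk D d \<alpha> * eigproj H e * Pblk D d \<beta> * eigproj H e)
    = complex_of_real (\<Sum>i\<in>{i. i < D \<and> in_block d \<alpha> i}. \<Sum>j\<in>{j. j < D \<and> in_block d \<beta> j}. (cmod (pe D w \<mu> e i j))\<^sup>2)"
proof -
  let ?P = "mat D D (\<lambda>(i,j). pe D w \<mu> e i j)"
  have c: "Pblk D d \<gamma> \<in> carrier_mat D D" for \<gamma> by (simp add: Pblk_def)
  have P: "?P \<in> carrier_mat D D" by simp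
  have left: "(Pblk D d \<alpha> * ?P) $$ (i,j) = (if in_block d \<alpha> i then pe D w \<mu> e i j else 0)" if "i < D" "j < D" for i j
  proof -
    have "(Pblk D d \<alpha> * ?P) $$ (i,j) = (\<Sum>k<D. if k = i then if in_block d \<alpha> i then pe D w \<mu> e i j else 0 else 0)"
      unfolding mult_mat_index[OF c P that] using that by (intro sum.cong refl) (auto simp: Pblk_def)
    then show ?thesis using that by simp
  qed
  have m2: "Pblk D d \<alpha> * ?P \<in> carrier_mat D D" using c P by (meson mult_carrier_mat)
  have mid: "(Pblk D d \<alpha> * ?P * Pblk D d \<beta>) $$ (i,j) = (if in_block d \<alpha> i \<and> in_block d \<beta> j then pe D w \<mu> e i j else 0)"
    if "i < D" "j < D" for i j
  proof -
    have "(Pblk D d \<alpha> * ?P * Pblk D d \<beta>) $$ (i,j)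
       = (\<Sum>k<D. if k = j then if in_block d \<alpha> i \<and> in_block d \<beta> j then pe D w \<mu> e i j else 0 else 0)"
      unfolding mult_mat_index[OF m2 c that]
    proof (intro sum.cong refl)
      fix k assume "k \<in> {..<D}"
      then have k: "k < D" by simp
      show "(Pblk D d \<alpha> * ?P) $$ (i,k) * Pblk D d \<beta> $$ (k,j)
        = (if k = j then if in_block d \<alpha> i \<and> in_block d \<beta> j then pe D w \<mu> e i j else 0 else 0)"
        unfolding left[OF that(1) k] using that k by (auto simp: Pblk_def)
    qed
    then show ?thesis using that by simp
  qed
  have m3: "Pblk D d \<alpha> * ?P * Pblk D d \<beta> \<in> carrier_mat D D" using m2 c by (meson mult_carrier_mat)
  have m4: "Pblk D d \<alpha> * ?P * Pblk D d \<beta> * ?P \<in> carrier_mat D D" using m3 P by (meson mult_carrier_mat)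
  have "mtrace (Pblk D d \<alpha> * ?P * Pblk D d \<beta> * ?P)
     = (\<Sum>i<D. \<Sum>k<D. if in_block d \<alpha> i \<and> in_block d \<beta> k then complex_of_real ((cmod (pe D w \<mu> e i k))\<^sup>2) else 0)"
  proof -
    have dr: "dim_row (Pblk D d \<alpha> * ?P * Pblk D d \<beta> * ?P) = D" using m4 by (rule carrier_matD(1))
    have sq: "complex_of_real ((cmod (pe D w \<mu> e i k))\<^sup>2) = pe D w \<mu> e i k * pe D w \<mu> e k i" for i k
      unfolding complex_norm_square cnj_pe ..
    show ?thesis unfolding mtrace_def dr
    proof (intro sum.cong refl)
      fix i assume "i \<in> {..<D}"
      then have i: "i < D" by simp
      have "(Pblk D d \<alpha> * ?P * Pblk D d \<beta> * ?P) $$ (i,i)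
        = (\<Sum>k<D. (Pblk D d \<alpha> * ?P * Pblk D d \<beta>) $$ (i,k) * ?P $$ (k,i))"
        by (rule mult_mat_index[OF m3 P i i])
      also have "\<dots> = (\<Sum>k<D. if in_block d \<alpha> i \<and> in_block d \<beta> k then complex_of_real ((cmod (pe D w \<mu> e i k))\<^sup>2) else 0)"
      proof (intro sum.cong refl)
        fix k assume "k \<in> {..<D}"
        then have k: "k < D" by simp
        have Pk: "?P $$ (k,i) = pe D w \<mu> e k i" using i k by simp
        show "(Pblk D d \<alpha> * ?P * Pblk D d \<beta>) $$ (i,k) * ?P $$ (k,i)
          = (if in_block d \<alpha> i \<and> in_block d \<beta> k then complex_of_real ((cmod (pe D w \<mu> e i k))\<^sup>2) else 0)"
          unfolding mid[OF i k] sq Pk by auto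
      qed
      finally show "(Pblk D d \<alpha> * ?P * Pblk D d \<beta> * ?P) $$ (i,i)
        = (\<Sum>k<D. if in_block d \<alpha> i \<and> in_block d \<beta> k then complex_of_real ((cmod (pe D w \<mu> e i k))\<^sup>2) else 0)" .
    qed
  qed
  also have "\<dots> = (\<Sum>i\<in>{i. i < D \<and> in_block d \<alpha> i}. \<Sum>j\<in>{j. j < D \<and> in_block d \<beta> j}. complex_of_real ((cmod (pe D w \<mu> e i j))\<^sup>2))"
  proof -
    have *: "(\<Sum>i\<in>{i. i < D \<and> p i}. f i) = (\<Sum>i<D. if p i then f i else 0)" for p and f :: "nat \<Rightarrow> complex"
      by (intro sum.mono_neutral_cong_left) auto
    show ?thesis unfolding * by (intro sum.cong refl) auto
  qed
  finally show ?thesis unfolding eigproj_eq of_real_sum .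
qed

text \<open>For fixed \<open>j\<close> in the block of \<open>\<gamma>'\<close>, the sum over the
  block of \<gamma> is the mass there of column \<open>j\<close> of the projection, at least
  \<delta> times its squared norm, the diagonal entry at \<open>j\<close>. These diagonal entries
  add up to 1 over the eigenvalues. Since the projection is Hermitian, either of the two blocks may
  take the role of \<gamma>.\<close>

lemma Mcoef_lower_bound:
  assumes mass: "\<And>u x. nsq {..<D} u = 1 \<Longrightarrow> (\<And>i. i < D \<Longrightarrow> mv {..<D} (mfun H) u i = complex_of_real x * u i)
      \<Longrightarrow> nsq {i. i < D \<and> in_block d \<gamma> i} u \<ge> \<delta>"
    and \<delta>: "\<delta> \<ge> 0"
    and \<gamma>: "\<gamma> = \<alpha> \<and> \<gamma>' = \<beta> \<or> \<gamma> = \<beta> \<and> \<gamma>' = \<alpha>"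
  shows "Re (Mcoef d H \<alpha> (Pblk D d \<beta>)) \<ge> \<delta> * card {j. j < D \<and> in_block d \<gamma>' j} / d \<alpha>"
proof -
  let ?B = "\<lambda>\<gamma>. {i. i < D \<and> in_block d \<gamma> i}"
  let ?p = "pe D w \<mu>"
  have dim: "dim_row H = D" using H by auto
  have col: "nsq (?B \<gamma>) (\<lambda>i. ?p e i j) \<ge> \<delta> * nsq {..<D} (\<lambda>i. ?p e i j)" if e: "eigenvalue H e" for e j
  proof (cases "nsq {..<D} (\<lambda>i. ?p e i j) = 0")
    case True
    then show ?thesis by simp
  next
    case False
    define N where "N = nsq {..<D} (\<lambda>i. ?p e i j)"
    have N: "N > 0" using False nsq_nonneg[of "{..<D}" "\<lambda>i. ?p e i j"] by (simp add: N_def less_le)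
    define c where "c = complex_of_real (1 / sqrt N)"
    have c2: "(cmod c)\<^sup>2 = 1 / N" using N by (simp add: c_def power_divide norm_divide)
    obtain x where x: "e = complex_of_real x" using e eigenvalues_eq by blast
    have "nsq (?B \<gamma>) (\<lambda>i. c * ?p e i j) \<ge> \<delta>"
    proof (rule mass)
      show "nsq {..<D} (\<lambda>i. c * ?p e i j) = 1" unfolding nsq_scale c2 N_def[symmetric] using N by simp
      fix i assume "i < D"
      then show "mv {..<D} (mfun H) (\<lambda>i. c * ?p e i j) i = complex_of_real x * (c * ?p e i j)"
        by (simp add: mv_scale pe_col_eigen x[symmetric])
    qed
    then show ?thesis unfolding nsq_scale c2 N_def[symmetric] using N by (simp add: field_simps)
  qed
  define F where "F e = (\<Sum>i\<in>?B \<alpha>. \<Sum>j\<in>?B \<beta>. (cmod (?p e i j))\<^sup>2)" for e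
  have swap: "F e = (\<Sum>j\<in>?B \<gamma>'. nsq (?B \<gamma>) (\<lambda>i. ?p e i j))" for e
  proof -
    have sym: "cmod (?p e i j) = cmod (?p e j i)" for i j
      by (metis cnj_pe complex_mod_cnj)
    show ?thesis
      using \<gamma>
    proof
      assume "\<gamma> = \<alpha> \<and> \<gamma>' = \<beta>"
      then show ?thesis unfolding F_def nsq_def by (subst sum.swap) simp
    next
      assume "\<gamma> = \<beta> \<and> \<gamma>' = \<alpha>"
      then show ?thesis unfolding F_def nsq_def using sym by simp
    qed
  qed
  have ev: "finite {e. eigenvalue H e}" unfolding eigenvalues_eq by simp
  have "\<delta> * card (?B \<gamma>') = (\<Sum>j\<in>?B \<gamma>'. \<delta> * 1)" by simp
  also have "\<dots> = (\<Sum>j\<in>?B \<gamma>'. \<delta> * (\<Sum>e\<in>{e. eigenvalue H e}. nsq {..<D} (\<lambda>i. ?p e i j)))"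
  proof (intro sum.cong refl)
    fix j assume "j \<in> ?B \<gamma>'"
    then have "complex_of_real (\<Sum>e\<in>{e. eigenvalue H e}. nsq {..<D} (\<lambda>i. ?p e i j)) = complex_of_real 1"
      unfolding of_real_sum nsq_pe_col using sum_pe_diag[of j] by simp
    then show "\<delta> * 1 = \<delta> * (\<Sum>e\<in>{e. eigenvalue H e}. nsq {..<D} (\<lambda>i. ?p e i j))"
      unfolding of_real_eq_iff by simp
  qed
  also have "\<dots> = (\<Sum>e\<in>{e. eigenvalue H e}. \<Sum>j\<in>?B \<gamma>'. \<delta> * nsq {..<D} (\<lambda>i. ?p e i j))"
    unfolding sum_distrib_left by (rule sum.swap)
  also have "\<dots> \<le> (\<Sum>e\<in>{e. eigenvalue H e}. F e)"
    unfolding swap using col by (intro sum_mono) auto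
  finally have le: "\<delta> * card (?B \<gamma>') \<le> (\<Sum>e\<in>{e. eigenvalue H e}. F e)" .
  have "Mcoef d H \<alpha> (Pblk D d \<beta>) = 1 / of_nat (d \<alpha>) * (\<Sum>e\<in>{e. eigenvalue H e}. complex_of_real (F e))"
    unfolding Mcoef_def dim mtrace_blocks F_def ..
  also have "\<dots> = complex_of_real ((\<Sum>e\<in>{e. eigenvalue H e}. F e) / d \<alpha>)"
    unfolding of_real_sum[symmetric] by simp
  finally have "(\<Sum>e\<in>{e. eigenvalue H e}. F e) / d \<alpha> = Re (Mcoef d H \<alpha> (Pblk D d \<beta>))"
    by (simp only: Re_complex_of_real)
  then show ?thesis using divide_right_mono[OF le, of "real (d \<alpha>)"] by simp
qed

end

lemma vnorm_nsq: "v \<in> carrier_vec D \<Longrightarrow> vnorm v = sqrt (nsq {..<D} (\<lambda>i. v $ i))"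
  by (simp add: vnorm_def nsq_def)

text \<open>\<open>opnorm\<close> is a real \<open>Sup\<close>, so the set has to be bounded above
  before anything follows; the sum of all entry moduli is a crude bound. Homogeneity then extends
  the estimate from unit vectors.\<close>

lemma opnorm_bound:
  assumes A: "A \<in> carrier_mat D D"
  shows "sqrt (nsq {..<D} (mv {..<D} (mfun A) u)) \<le> opnorm A * sqrt (nsq {..<D} u)" and "opnorm A \<ge> 0"
proof -
  let ?I = "{..<D}"
  let ?S = "{vnorm (A *\<^sub>v v) | v. v \<in> carrier_vec (dim_col A) \<and> vnorm v \<le> 1}"
  have dim: "dim_col A = D" using A by auto
  have vn: "vnorm (A *\<^sub>v v) = sqrt (nsq ?I (mv ?I (mfun A) (\<lambda>j. v $ j)))" if v: "v \<in> carrier_vec D" for v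
  proof -
    have "A *\<^sub>v v \<in> carrier_vec D" using A v by auto
    then have "vnorm (A *\<^sub>v v) = sqrt (nsq ?I (\<lambda>i. (A *\<^sub>v v) $ i))" by (rule vnorm_nsq)
    also have "nsq ?I (\<lambda>i. (A *\<^sub>v v) $ i) = nsq ?I (mv ?I (mfun A) (\<lambda>j. v $ j))"
      by (rule nsq_cong) (use mult_mat_vec_mv[OF A v] in simp)
    finally show ?thesis .
  qed
  have bdd: "bdd_above ?S"
  proof (rule bdd_aboveI)
    fix y assume "y \<in> ?S"
    then obtain v where v: "v \<in> carrier_vec D" "vnorm v \<le> 1" "y = vnorm (A *\<^sub>v v)" unfolding dim by auto
    have n1: "nsq ?I (\<lambda>j. v $ j) \<le> 1" using v(2) unfolding vnorm_nsq[OF v(1)] by simp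
    have "sqrt (nsq ?I (mv ?I (mfun A) (\<lambda>j. v $ j))) \<le> (\<Sum>i<D. cmod (mv ?I (mfun A) (\<lambda>j. v $ j) i))"
      using L2_set_le_sum[of ?I "\<lambda>i. cmod (mv ?I (mfun A) (\<lambda>j. v $ j) i)"] by (simp add: L2_set_def nsq_def)
    also have "\<dots> \<le> (\<Sum>i<D. \<Sum>j<D. cmod (mfun A i j) * 1)"
      unfolding mv_def
    proof (intro sum_mono order_trans[OF norm_sum])
      fix i j assume "j \<in> ?I"
      then have "(cmod (v $ j))\<^sup>2 \<le> nsq ?I (\<lambda>j. v $ j)"
        unfolding nsq_def by (intro member_le_sum) auto
      then have "(cmod (v $ j))\<^sup>2 \<le> 1\<^sup>2" using n1 by simp
      then have "cmod (v $ j) \<le> 1" by (rule power2_le_imp_le) simp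
      then show "cmod (mfun A i j * v $ j) \<le> cmod (mfun A i j) * 1"
        unfolding norm_mult by (intro mult_left_mono) auto
    qed
    finally show "y \<le> (\<Sum>i<D. \<Sum>j<D. cmod (mfun A i j) * 1)" unfolding v(3) vn[OF v(1)] .
  qed
  have le: "vnorm (A *\<^sub>v v) \<le> opnorm A" if "v \<in> carrier_vec D" "vnorm v \<le> 1" for v
    unfolding opnorm_def by (rule cSup_upper[OF _ bdd]) (use that dim in auto)
  have z: "vnorm (0\<^sub>v D) = 0" by (simp add: vnorm_def)
  have "0 \<le> vnorm (A *\<^sub>v 0\<^sub>v D)" by (simp add: vnorm_def sum_nonneg)
  then show op0: "opnorm A \<ge> 0" using le[of "0\<^sub>v D"] z by simp
  show "sqrt (nsq ?I (mv ?I (mfun A) u)) \<le> opnorm A * sqrt (nsq ?I u)"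
  proof (cases "nsq ?I u = 0")
    case True
    then have "\<forall>i\<in>?I. u i = 0" using nsq_eq_0_iff[of ?I u] by simp
    then have "nsq ?I (mv ?I (mfun A) u) = 0" by (simp add: mv_def nsq_def)
    then show ?thesis using True by simp
  next
    case False
    then have N: "nsq ?I u > 0" using nsq_nonneg[of ?I u] by linarith
    define c where "c = complex_of_real (1 / sqrt (nsq ?I u))"
    have cm: "cmod c = 1 / sqrt (nsq ?I u)" using N by (simp add: c_def norm_divide)
    define v where "v = vec D (\<lambda>i. c * u i)"
    have v: "v \<in> carrier_vec D" by (simp add: v_def)
    have "nsq ?I (\<lambda>i. v $ i) = nsq ?I (\<lambda>i. c * u i)" by (rule nsq_cong) (simp add: v_def)
    then have "vnorm v = 1" unfolding vnorm_nsq[OF v] using N by (simp add: nsq_scale cm power_divide)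
    then have "vnorm (A *\<^sub>v v) \<le> opnorm A" using le[OF v] by simp
    moreover have "mv ?I (mfun A) (\<lambda>j. v $ j) = mv ?I (mfun A) (\<lambda>i. c * u i)"
      by (rule mv_cong) (simp add: v_def)
    ultimately have "cmod c * sqrt (nsq ?I (mv ?I (mfun A) u)) \<le> opnorm A"
      unfolding vn[OF v] by (simp add: mv_scale nsq_scale real_sqrt_mult)
    then show ?thesis using N by (simp add: cm field_simps)
  qed
qed

text \<open>The factor 2 arises from splitting the matrix into its entrywise real and imaginary
  parts, each of norm at most \<open>sqrt D * CH0 D A\<close>.\<close>

lemma CH0_bound:
  assumes A: "A \<in> carrier_mat D D" and D: "D > 0"
  shows "nsq {..<D} (mv {..<D} (mfun A) v) \<le> (2 * sqrt D * CH0 D A)\<^sup>2 * nsq {..<D} v" and "CH0 D A \<ge> 0"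
proof -
  let ?I = "{..<D}"
  have c: "re_part A \<in> carrier_mat D D" "im_part A \<in> carrier_mat D D"
    using A by (auto simp: re_part_def im_part_def)
  define m where "m = max (opnorm (re_part A)) (opnorm (im_part A))"
  have m: "m = sqrt D * CH0 D A" using D by (simp add: m_def CH0_def)
  have m0: "m \<ge> 0" using opnorm_bound(2)[OF c(1)] by (simp add: m_def le_max_iff_disj)
  then show "CH0 D A \<ge> 0" by (simp add: CH0_def m_def[symmetric])
  have "nsq ?I (mv ?I (mfun A) v) = nsq ?I (\<lambda>i. mv ?I (mfun (re_part A)) v i + \<i> * mv ?I (mfun (im_part A)) v i)"
  proof (rule nsq_cong)
    fix i assume i: "i \<in> ?I"
    have "mfun A i j = mfun (re_part A) i j + \<i> * mfun (im_part A) i j" if "j \<in> ?I" for j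
      using i that A by (simp add: mfun_def re_part_def im_part_def complex_eq_iff)
    then have "mv ?I (mfun A) v i = (\<Sum>j<D. (mfun (re_part A) i j + \<i> * mfun (im_part A) i j) * v j)"
      unfolding mv_def by (intro sum.cong) auto
    then show "mv ?I (mfun A) v i = mv ?I (mfun (re_part A)) v i + \<i> * mv ?I (mfun (im_part A)) v i"
      by (simp add: mv_def distrib_right sum.distrib sum_distrib_left mult.assoc)
  qed
  then have "sqrt (nsq ?I (mv ?I (mfun A) v)) \<le> sqrt (nsq ?I (mv ?I (mfun (re_part A)) v)) + sqrt (nsq ?I (mv ?I (mfun (im_part A)) v))"
    using sqrt_nsq_add_le[of ?I "mv ?I (mfun (re_part A)) v" "\<lambda>i. \<i> * mv ?I (mfun (im_part A)) v i"]
    by (simp add: nsq_scale)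
  also have "\<dots> \<le> opnorm (re_part A) * sqrt (nsq ?I v) + opnorm (im_part A) * sqrt (nsq ?I v)"
    by (intro add_mono opnorm_bound c)
  also have "\<dots> \<le> m * sqrt (nsq ?I v) + m * sqrt (nsq ?I v)"
    by (intro add_mono mult_right_mono) (auto simp: m_def)
  finally have "sqrt (nsq ?I (mv ?I (mfun A) v)) \<le> 2 * m * sqrt (nsq ?I v)" by simp
  also have "\<dots> = sqrt ((2 * m)\<^sup>2 * nsq ?I v)" using m0 by (simp add: real_sqrt_mult)
  finally show "nsq ?I (mv ?I (mfun A) v) \<le> (2 * sqrt D * CH0 D A)\<^sup>2 * nsq ?I v"
    by (simp add: m mult.assoc)
qed

section \<open>The lower bound\<close>

lemma block_card:
  assumes "(\<Sum>k<m. d k) = D" "\<gamma> < m"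
  shows "card {i. i < D \<and> in_block d \<gamma> i} = d \<gamma>"
proof -
  have "blk_start d \<gamma> + d \<gamma> = (\<Sum>k<Suc \<gamma>. d k)" by (simp add: blk_start_def)
  also have "\<dots> \<le> (\<Sum>k<m. d k)" using assms(2) by (intro sum_mono2) auto
  finally have "{i. i < D \<and> in_block d \<gamma> i} = {blk_start d \<gamma>..<blk_start d \<gamma> + d \<gamma>}"
    using assms(1) by (auto simp: in_block_def)
  then show ?thesis by simp
qed

text \<open>The value 1 at index pairs outside the matrix makes the deviations positive everywhere,
  as the Gaussian lemmas assume, and does not affect the product measure.\<close>

lemma gauss_space_eq_GS:
  "gauss_space D \<sigma> = GS D (\<lambda>i j. if i < D \<and> j < D then \<sigma> i j / sqrt 2 else 1)"
  unfolding gauss_space_def GS_def gN_def by (intro PiM_cong refl) auto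

lemma randA_carrier:
  "randA D \<omega> \<in> carrier_mat D D" "mat_adjoint (randA D \<omega>) \<in> carrier_mat D D"
proof -
  show A: "randA D \<omega> \<in> carrier_mat D D" by (simp add: randA_def)
  then show "mat_adjoint (randA D \<omega>) \<in> carrier_mat D D" unfolding mat_adjoint_def by auto
qed

lemma randV_index:
  assumes "i < D" "j < D"
  shows "randV D \<omega> $$ (i,j) = (aent \<omega> i j + cnj (aent \<omega> j i)) / sqrt 2"
proof -
  note A = randA_carrier[of D \<omega>]
  have "randV D \<omega> $$ (i,j) = complex_of_real (1 / sqrt 2) * (randA D \<omega> $$ (i,j) + mat_adjoint (randA D \<omega>) $$ (i,j))"
    using A assms unfolding randV_def by simp
  then show ?thesis
    unfolding mat_adjoint_index[OF A(1) assms] using assms by (simp add: randA_def aent_def)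
qed

text \<open>Only \<open>- n \<le> log 2 (\<epsilon> / sqrt 2)\<close> is extracted from the
  hypothesis, which already gives \<open>2 powr (- n) \<le> \<epsilon> / sqrt 2\<close>.\<close>

lemma half_power_le:
  fixes \<epsilon> :: real
  assumes \<epsilon>: "0 < \<epsilon>" and n: "real n > 4 * \<bar>log 2 (\<epsilon> / sqrt 2)\<bar>"
  shows "(1 / 2) ^ n \<le> \<epsilon>"
proof -
  have "- real n \<le> log 2 (\<epsilon> / sqrt 2)" using n by linarith
  then have "2 powr (- real n) \<le> 2 powr (log 2 (\<epsilon> / sqrt 2))" by simp
  also have "\<dots> = \<epsilon> / sqrt 2" using \<epsilon> by simp
  also have "\<dots> \<le> \<epsilon> / 1" using \<epsilon> by (intro divide_left_mono) auto
  finally show ?thesis by (simp add: powr_minus powr_realpow power_divide field_simps)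
qed

text \<open>The block \<gamma> on which eigenvectors are known to have mass may be either index of
  the coefficient; the other one, \<open>\<gamma>'\<close>, only contributes its dimension.\<close>

lemma Mcoef_random_lower_bound:
  fixes D m :: nat and d :: "nat \<Rightarrow> nat" and \<sigma> :: "nat \<Rightarrow> nat \<Rightarrow> real" and H0 :: "complex mat"
    and \<epsilon> \<sigma>m \<sigma>p :: real and \<alpha> \<beta> \<gamma> \<gamma>' :: nat
  assumes dD: "(\<Sum>k<m. d k) = D"
    and \<sigma>: "\<And>i j. i < D \<Longrightarrow> j < D \<Longrightarrow> \<sigma>m \<le> \<sigma> i j \<and> \<sigma> i j \<le> \<sigma>p" "0 < \<sigma>m" "\<sigma>m \<le> \<sigma>p"
    and H0: "H0 \<in> carrier_mat D D" "hermitian H0"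
    and \<epsilon>: "0 < \<epsilon>" "\<epsilon> < 1 / 2" "(1 / 2) ^ d \<gamma> \<le> \<epsilon>"
    and \<gamma>: "\<gamma> = \<alpha> \<and> \<gamma>' = \<beta> \<or> \<gamma> = \<beta> \<and> \<gamma>' = \<alpha>" "\<gamma> < m" "\<gamma>' < m" "d \<gamma> \<ge> 16"
  shows "\<exists>S\<in>sets (gauss_space D \<sigma>). measure (gauss_space D \<sigma>) S \<ge> 1 - \<epsilon> \<and>
    (\<forall>\<omega>\<in>S. Re (Mcoef d (H0 + randV D \<omega>) \<alpha> (Pblk D d \<beta>)) \<ge>
      (1 / 1000) ^ 8 * (\<epsilon> * (\<sigma>m / (2 * (12 * \<sigma>p + CH0 D H0))) * (d \<gamma> / D)\<^sup>2) ^ 8 * d \<gamma>' / d \<alpha>)"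
proof -
  define s where "s i j = (if i < D \<and> j < D then \<sigma> i j / sqrt 2 else 1)" for i j
  define \<kappa> where "\<kappa> = \<epsilon> * (\<sigma>m / (2 * (12 * \<sigma>p + CH0 D H0))) * (d \<gamma> / D)\<^sup>2"
  define P where "P = {i. i < D \<and> in_block d \<gamma> i}"
  have cP: "card P = d \<gamma>" unfolding P_def by (rule block_card[OF dD \<gamma>(2)])
  have cP': "card {i. i < D \<and> in_block d \<gamma>' i} = d \<gamma>'" by (rule block_card[OF dD \<gamma>(3)])
  have D: "D > 0" using \<gamma>(4) card_mono[of "{..<D}" P] cP by (auto simp: P_def subset_eq)
  have s0: "s i j > 0" for i j using \<sigma>(1)[of i j] \<sigma>(2) by (auto simp: s_def)
  have s_sq: "(s i j)\<^sup>2 = (\<sigma> i j)\<^sup>2 / 2" if "i < D" "j < D" for i j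
    using that by (simp add: s_def power_divide)
  have GS: "gauss_space D \<sigma> = GS D s" unfolding gauss_space_eq_GS s_def[abs_def] ..
  have "\<exists>S\<in>sets (GS D s). measure (GS D s) S \<ge> 1 - \<epsilon> \<and>
    (\<forall>\<omega>\<in>S. \<forall>u x. nsq {..<D} u = 1 \<longrightarrow> (\<forall>i<D. mv {..<D} (hent (mfun H0) \<omega>) u i = complex_of_real x * u i) \<longrightarrow>
       nsq P u \<ge> (1 / 1000) ^ 8 * (\<epsilon> * (\<sigma>m / (2 * (12 * \<sigma>p + CH0 D H0))) * (card P / D)\<^sup>2) ^ 8)"
  proof (rule eigenvector_mass[OF s0 \<sigma>(2,3)])
    show "CH0 D H0 \<ge> 0" by (rule CH0_bound(2)[OF H0(1) D])
    show "nsq {..<D} (mv {..<D} (mfun H0) v) \<le> (2 * sqrt D * CH0 D H0)\<^sup>2 * nsq {..<D} v" for v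
      by (rule CH0_bound(1)[OF H0(1) D])
    show "herm {..<D} (mfun H0)" using H0 hermitian_iff_herm by blast
    fix i j assume ij: "i < D" "j < D"
    show "\<sigma>m\<^sup>2 / 2 \<le> (s i j)\<^sup>2" "(s i j)\<^sup>2 \<le> \<sigma>p\<^sup>2 / 2"
      unfolding s_sq[OF ij] using \<sigma>(1)[OF ij] \<sigma>(2) by (auto intro!: divide_right_mono power_mono)
  qed (use \<epsilon> \<gamma>(4) cP in \<open>auto simp: P_def\<close>)
  then obtain S where S: "S \<in> sets (GS D s)" "measure (GS D s) S \<ge> 1 - \<epsilon>"
    and mass: "\<And>\<omega> u x. \<omega> \<in> S \<Longrightarrow> nsq {..<D} u = 1 \<Longrightarrow>
      (\<And>i. i < D \<Longrightarrow> mv {..<D} (hent (mfun H0) \<omega>) u i = complex_of_real x * u i) \<Longrightarrow> nsq P u \<ge> (1 / 1000) ^ 8 * \<kappa> ^ 8"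
    unfolding cP \<kappa>_def by blast
  have "Re (Mcoef d (H0 + randV D \<omega>) \<alpha> (Pblk D d \<beta>)) \<ge> (1 / 1000) ^ 8 * \<kappa> ^ 8 * d \<gamma>' / d \<alpha>"
    if \<omega>: "\<omega> \<in> S" for \<omega>
  proof -
    define H where "H = H0 + randV D \<omega>"
    have dV: "randV D \<omega> \<in> carrier_mat D D"
      unfolding randV_def using randA_carrier[of D \<omega>] by simp
    have Hc: "H \<in> carrier_mat D D" using H0 dV by (simp add: H_def)
    have ent: "mfun H i j = hent (mfun H0) \<omega> i j" if "i < D" "j < D" for i j
      using that H0 dV by (simp add: H_def mfun_def hent_def randV_index)
    have hh: "herm {..<D} (hent (mfun H0) \<omega>)"
      using herm_hent H0 hermitian_iff_herm by blast
    have hm: "herm {..<D} (mfun H)"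
      unfolding herm_def
    proof (intro ballI)
      fix i j assume "i \<in> {..<D}" "j \<in> {..<D}"
      then show "mfun H i j = cnj (mfun H j i)" by (simp add: ent herm_cnj[OF hh])
    qed
    then have hH: "hermitian H" using hermitian_iff_herm[OF Hc] by blast
    obtain w \<mu> where eb: "eigbasis {..<D} (mfun H) w \<mu>"
      using hermitian_eigbasis[OF finite_lessThan hm] by blast
    have mvH: "mv {..<D} (mfun H) u i = mv {..<D} (hent (mfun H0) \<omega>) u i" if "i < D" for u i
      using that ent by (simp add: mv_def)
    have "\<kappa> ^ 8 \<ge> 0" by (simp add: zero_le_even_power)
    then have \<delta>: "(1 / 1000) ^ 8 * \<kappa> ^ 8 \<ge> 0" by simp
    have "Re (Mcoef d H \<alpha> (Pblk D d \<beta>)) \<ge> (1 / 1000) ^ 8 * \<kappa> ^ 8 * card {i. i < D \<and> in_block d \<gamma>' i} / d \<alpha>"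
    proof (rule Mcoef_lower_bound[OF Hc hH eb _ \<delta> \<gamma>(1)])
      fix u x assume "nsq {..<D} u = 1" "\<And>i. i < D \<Longrightarrow> mv {..<D} (mfun H) u i = complex_of_real x * u i"
      then show "nsq {i. i < D \<and> in_block d \<gamma> i} u \<ge> (1 / 1000) ^ 8 * \<kappa> ^ 8"
        using mass[OF \<omega>, of u x] mvH by (simp add: P_def)
    qed
    then show ?thesis unfolding cP' H_def .
  qed
  then show ?thesis using S unfolding GS \<kappa>_def by blast
qed

theorem mainTheorem4:
  "\<exists>c_minus c_plus :: real. c_minus > 0 \<and> c_plus > 0 \<and>
    (\<forall>(D::nat) (m::nat) (d::nat \<Rightarrow> nat) (\<sigma>::nat \<Rightarrow> nat \<Rightarrow> real) (H0::complex mat)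
        (\<epsilon>'::real) (\<mu>::nat) (\<nu>::nat).
      m \<ge> 2 \<longrightarrow> (\<forall>k<m. d k > 0) \<longrightarrow> (\<Sum>k<m. d k) = D \<longrightarrow>
      (\<forall>i<D. \<forall>j<D. \<sigma> i j = \<sigma> j i \<and> \<sigma> i j > 0) \<longrightarrow>
      H0 \<in> carrier_mat D D \<longrightarrow> hermitian H0 \<longrightarrow>
      0 < \<epsilon>' \<longrightarrow> \<epsilon>' < 1/2 \<longrightarrow> \<mu> < m \<longrightarrow> \<nu> < m \<longrightarrow>
      real (d \<mu>) > max 166 (4 * \<bar>log 2 (\<epsilon>' / sqrt 2)\<bar>) \<longrightarrow>
      real (d \<nu>) > max 166 (4 * \<bar>log 2 (\<epsilon>' / sqrt 2)\<bar>) \<longrightarrow>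
      (let \<sigma>_minus = Min {\<sigma> i j | i j. i < D \<and> j < D};
           \<sigma>_plus = Max {\<sigma> i j | i j. i < D \<and> j < D};
           C\<sigma> = c_minus * \<sigma>_minus / (c_plus * \<sigma>_plus + CH0 D H0)
       in \<exists>S \<in> sets (gauss_space D \<sigma>). measure (gauss_space D \<sigma>) S \<ge> 1 - \<epsilon>' \<and>
            (\<forall>\<omega> \<in> S. Re (Mcoef d (H0 + randV D \<omega>) \<mu> (Pblk D d \<nu>)) \<ge>
               (sqrt (\<epsilon>' * C\<sigma>) * real (max (d \<mu>) (d \<nu>)) / real D) ^ 16
                 * min 1 (real (d \<nu>) / real (d \<mu>)))))"
proof (rule exI[of _ "1 / 2000"], rule exI[of _ "12"], intro conjI allI impI)
  fix D m :: nat and d :: "nat \<Rightarrow> nat" and \<sigma> :: "nat \<Rightarrow> nat \<Rightarrow> real" and H0 :: "complex mat"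
    and \<epsilon> :: real and \<mu> \<nu> :: nat
  assume d0: "\<forall>k<m. d k > 0" and dD: "(\<Sum>k<m. d k) = D"
    and sym: "\<forall>i<D. \<forall>j<D. \<sigma> i j = \<sigma> j i \<and> \<sigma> i j > 0"
    and H0: "H0 \<in> carrier_mat D D" "hermitian H0"
    and \<epsilon>: "0 < \<epsilon>" "\<epsilon> < 1/2" and mn: "\<mu> < m" "\<nu> < m"
    and d\<mu>: "real (d \<mu>) > max 166 (4 * \<bar>log 2 (\<epsilon> / sqrt 2)\<bar>)"
    and d\<nu>: "real (d \<nu>) > max 166 (4 * \<bar>log 2 (\<epsilon> / sqrt 2)\<bar>)"
  define X where "X = {\<sigma> i j | i j. i < D \<and> j < D}"
  have Xeq: "X = (\<lambda>(i,j). \<sigma> i j) ` ({..<D} \<times> {..<D})" by (auto simp: X_def)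
  have D: "D > 0" using d\<mu> dD mn(1) member_le_sum[of \<mu> "{..<m}" d] by auto
  have X: "finite X" "X \<noteq> {}" using D by (auto simp: Xeq)
  have "Min X \<in> X" using X by simp
  then have m0: "Min X > 0" using sym by (auto simp: X_def)
  have mp: "Min X \<le> Max X" using X by (meson Max_ge Min_in)
  have rng: "Min X \<le> \<sigma> i j \<and> \<sigma> i j \<le> Max X" if "i < D" "j < D" for i j
  proof -
    have "\<sigma> i j \<in> X" using that by (auto simp: X_def)
    then show ?thesis using X by simp
  qed
  \<comment> \<open>12 is the constant of the norm bound for the Gaussian part;
    \<open>1/2000\<close> is the product of the \<open>1/2\<close> in \<open>q\<close> and of
    \<open>1/1000\<close>, the eighth root of the numerical factor in \<delta>.\<close>
  define C\<sigma> where "C\<sigma> = 1 / 2000 * Min X / (12 * Max X + CH0 D H0)"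
  \<comment> \<open>The larger block carries the mass bound. The ratio
    \<open>d \<gamma>' / d \<mu>\<close> with the smaller block on top is then exactly
    \<open>min 1 (d \<nu> / d \<mu>)\<close>.\<close>
  define \<gamma> where "\<gamma> = (if d \<nu> \<le> d \<mu> then \<mu> else \<nu>)"
  define \<gamma>' where "\<gamma>' = (if d \<nu> \<le> d \<mu> then \<nu> else \<mu>)"
  have \<gamma>: "\<gamma> = \<mu> \<and> \<gamma>' = \<nu> \<or> \<gamma> = \<nu> \<and> \<gamma>' = \<mu>" "\<gamma> < m" "\<gamma>' < m" "d \<gamma> \<ge> 16"
    using mn d\<mu> d\<nu> by (auto simp: \<gamma>_def \<gamma>'_def)
  have dmax: "d \<gamma> = max (d \<mu>) (d \<nu>)" by (auto simp: \<gamma>_def)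
  have pw: "(1 / 2) ^ d \<gamma> \<le> \<epsilon>"
    using half_power_le[OF \<epsilon>(1), of "d \<gamma>"] d\<mu> d\<nu> by (auto simp: \<gamma>_def)
  have C0: "C\<sigma> \<ge> 0"
    using m0 mp CH0_bound(2)[OF H0(1) D] by (simp add: C\<sigma>_def)
  have eq: "(sqrt (\<epsilon> * C\<sigma>) * real (max (d \<mu>) (d \<nu>)) / real D) ^ 16
      = (1 / 1000) ^ 8 * (\<epsilon> * (Min X / (2 * (12 * Max X + CH0 D H0))) * (d \<gamma> / D)\<^sup>2) ^ 8"
  proof -
    have "sqrt (\<epsilon> * C\<sigma>) ^ 2 = \<epsilon> * C\<sigma>" using \<epsilon> C0 by simp
    then have sq: "(sqrt (\<epsilon> * C\<sigma>) * real (max (d \<mu>) (d \<nu>)) / real D)\<^sup>2 = \<epsilon> * C\<sigma> * (d \<gamma> / D)\<^sup>2"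
      by (simp add: dmax power_mult_distrib power_divide)
    have eC: "\<epsilon> * C\<sigma> = (1 / 1000) * (\<epsilon> * (Min X / (2 * (12 * Max X + CH0 D H0))))"
      by (simp add: C\<sigma>_def del: distrib_left_numeral)
    have e: "(sqrt (\<epsilon> * C\<sigma>) * real (max (d \<mu>) (d \<nu>)) / real D)\<^sup>2
      = (1 / 1000) * (\<epsilon> * (Min X / (2 * (12 * Max X + CH0 D H0))) * (d \<gamma> / D)\<^sup>2)"
      unfolding sq by (simp only: eC mult.assoc)
    have "(sqrt (\<epsilon> * C\<sigma>) * real (max (d \<mu>) (d \<nu>)) / real D) ^ 16
       = ((sqrt (\<epsilon> * C\<sigma>) * real (max (d \<mu>) (d \<nu>)) / real D)\<^sup>2) ^ 8"
      by (simp flip: power_mult)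
    then show ?thesis unfolding e power_mult_distrib .
  qed
  have "\<exists>S\<in>sets (gauss_space D \<sigma>). measure (gauss_space D \<sigma>) S \<ge> 1 - \<epsilon> \<and>
    (\<forall>\<omega>\<in>S. Re (Mcoef d (H0 + randV D \<omega>) \<mu> (Pblk D d \<nu>)) \<ge>
      (1 / 1000) ^ 8 * (\<epsilon> * (Min X / (2 * (12 * Max X + CH0 D H0))) * (d \<gamma> / D)\<^sup>2) ^ 8 * d \<gamma>' / d \<mu>)"
    by (rule Mcoef_random_lower_bound[OF dD _ m0 mp H0 \<epsilon> pw \<gamma>]) (use rng in blast)
  then obtain S where S: "S \<in> sets (gauss_space D \<sigma>)" "measure (gauss_space D \<sigma>) S \<ge> 1 - \<epsilon>"
    "\<And>\<omega>. \<omega> \<in> S \<Longrightarrow> Re (Mcoef d (H0 + randV D \<omega>) \<mu> (Pblk D d \<nu>)) \<ge>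
      (1 / 1000) ^ 8 * (\<epsilon> * (Min X / (2 * (12 * Max X + CH0 D H0))) * (d \<gamma> / D)\<^sup>2) ^ 8 * d \<gamma>' / d \<mu>"
    by blast
  have "Re (Mcoef d (H0 + randV D \<omega>) \<mu> (Pblk D d \<nu>)) \<ge>
     (sqrt (\<epsilon> * C\<sigma>) * real (max (d \<mu>) (d \<nu>)) / real D) ^ 16 * min 1 (real (d \<nu>) / real (d \<mu>))"
    if \<omega>: "\<omega> \<in> S" for \<omega>
  proof -
    have d\<mu>0: "d \<mu> > 0" using d0 mn by simp
    have "min 1 (real (d \<nu>) / real (d \<mu>)) \<le> d \<gamma>' / d \<mu>"
      using d\<mu>0 by (auto simp: \<gamma>'_def)
    then have "(sqrt (\<epsilon> * C\<sigma>) * real (max (d \<mu>) (d \<nu>)) / real D) ^ 16 * min 1 (real (d \<nu>) / real (d \<mu>))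
       \<le> (sqrt (\<epsilon> * C\<sigma>) * real (max (d \<mu>) (d \<nu>)) / real D) ^ 16 * (d \<gamma>' / d \<mu>)"
      by (intro mult_left_mono) (simp_all add: zero_le_even_power)
    also have "\<dots> \<le> Re (Mcoef d (H0 + randV D \<omega>) \<mu> (Pblk D d \<nu>))"
      unfolding eq using S(3)[OF \<omega>] by simp
    finally show ?thesis .
  qed
  with S(1,2) show "let \<sigma>_minus = Min {\<sigma> i j | i j. i < D \<and> j < D};
           \<sigma>_plus = Max {\<sigma> i j | i j. i < D \<and> j < D};
           C\<sigma> = 1 / 2000 * \<sigma>_minus / (12 * \<sigma>_plus + CH0 D H0)
       in \<exists>S \<in> sets (gauss_space D \<sigma>). measure (gauss_space D \<sigma>) S \<ge> 1 - \<epsilon> \<and>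
            (\<forall>\<omega> \<in> S. Re (Mcoef d (H0 + randV D \<omega>) \<mu> (Pblk D d \<nu>)) \<ge>
               (sqrt (\<epsilon> * C\<sigma>) * real (max (d \<mu>) (d \<nu>)) / real D) ^ 16
                 * min 1 (real (d \<nu>) / real (d \<mu>)))"
    unfolding Let_def X_def[symmetric] C\<sigma>_def[symmetric] by blast
qed simp_all

end
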